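(* Let $d\ge2$ and let $f\in W_2^1(\mathbb{S}^{d-1})$ be such that $\int_{\mathbb{S}^{d-1}}f(y)\,d\sigma(y)=0$ and $\|f\|_2=1$. Then $$(1-\|\tau(f)\|)\,\|\nabla_0f\|_2^2\ge B_d,$$ where $B_2=\frac18$ and $B_d=(d-1)\left(1-\frac{2}{\sqrt{d+3}}\right)$ for $d\ge3$; alternatively, for $d\neq3$, $B_d$ may be taken as $C_d^{-1}$, where $C_d$ is a constant such that $$\int_{\mathbb{S}^{d-1}}|g(x)|^2\,d\sigma(x)\le C_d\min_{e\in\mathbb{S}^{d-1}}\int_{\mathbb{S}^{d-1}}(1-\langle x,e\rangle)\left|(-\Delta_0)^{1/2}g(x)\right|^2d\sigma(x)$$ for all $g\in W_2^1(\mathbb{S}^{d-1})$ with zero mean.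
   Context: $\mathbb{S}^{d-1}$ is the unit sphere of $\mathbb{R}^d$, $d\sigma$ its rotation-invariant surface measure, $\omega_d=2\pi^{d/2}/\Gamma(d/2)$ its total mass, and $\|f\|_2=\left(\frac1{\omega_d}\int_{\mathbb{S}^{d-1}}|f|^2\,d\sigma\right)^{1/2}$. Functions are real-valued when $d\ge3$. $\tau(f)=\frac1{\omega_d}\int_{\mathbb{S}^{d-1}}x\,|f(x)|^2\,d\sigma(x)\in\mathbb{R}^d$, and $\|\tau(f)\|$ is its Euclidean norm. $\mathcal{H}_n^d$ is the space of spherical harmonics of degree $n$, $\operatorname{proj}_n$ the orthogonal projection of $L^2(\mathbb{S}^{d-1})$ onto it. $\Delta_0$ is the Laplace-Beltrami operator; for $r\ne0$, $(-\Delta_0)^r$ is defined by $\operatorname{proj}_0[(-\Delta_0)^rf]=0$ and $\operatorname{proj}_n[(-\Delta_0)^rf]=(n(n+d-2))^r\operatorname{proj}_nf$, $n\ge1$. $W_2^1(\mathbb{S}^{d-1})=\{f\in L^2(\mathbb{S}^{d-1}):(-\Delta_0)^{1/2}f\in L^2(\mathbb{S}^{d-1})\}$. $\nabla_0$ is the tangential gradient, $\nabla_0f=\nabla F|_{\mathbb{S}^{d-1}}$ with $F(x)=f(x/\|x\|)$, and $\|\nabla_0f\|_2=\|(-\Delta_0)^{1/2}f\|_2$. *)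

theory Defs
  imports "HOL-Analysis.Analysis"
begin

text \<open>The space \<open>\<real>\<^sup>d\<close> is \<^typ>\<open>real^'n\<close> with \<open>d = CARD('n)\<close>. A function on the unit sphere is a
  function on \<^typ>\<open>real^'n\<close> of which only the values on \<^term>\<open>sphere 0 1\<close> matter, and elements of
  \<open>L\<^sup>2\<close> are represented by Borel functions.\<close>


section \<open>Surface measure\<close>

text \<open>The cone measure: \<open>\<sigma>(A) = d \<cdot> vol {t x | 0 < t < 1, x \<in> A}\<close>.\<close>

definition sphere_measure :: "(real^'n) measure" (\<open>\<sigma>\<close>) where
  "\<sigma> = distr (scale_measure (of_nat CARD('n)) (restrict_space lborel (ball 0 1 - {0})))
          (restrict_space borel (sphere 0 1)) sgn"

definition sphere_area :: "nat \<Rightarrow> real" (\<open>\<omega>\<close>) where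
  "\<omega> d = 2 * pi powr (real d / 2) / Gamma (real d / 2)"

lemma space_sphere_measure [simp]: "space (\<sigma> :: (real^'n) measure) = sphere 0 1"
  by (simp add: sphere_measure_def space_restrict_space)

lemma sets_sphere_measure [simp, measurable_cong]:
  "sets (\<sigma> :: (real^'n) measure) = sets (restrict_space borel (sphere 0 1))"
  by (simp add: sphere_measure_def)

lemma sgn_measurable_sphere:
  "sgn \<in> scale_measure c (restrict_space lborel (ball 0 1 - {0 :: real^'n}))
           \<rightarrow>\<^sub>M restrict_space borel (sphere 0 1)"
proof -
  have "(sgn :: real^'n \<Rightarrow> real^'n) \<in> borel_measurable borel"
    unfolding sgn_div_norm by measurable
  then have "sgn \<in> restrict_space lborel (ball 0 1 - {0 :: real^'n}) \<rightarrow>\<^sub>M restrict_space borel (sphere 0 1)"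
    by (intro measurable_restrict_space3) (auto simp: norm_sgn)
  then show ?thesis
    by (simp add: measurable_def space_scale_measure)
qed

lemma emeasure_sphere_measure:
  assumes "A \<in> sets (\<sigma> :: (real^'n) measure)"
  shows "emeasure \<sigma> A
    = of_nat CARD('n) * emeasure lborel {x \<in> ball 0 1 - {0}. sgn x \<in> A}"
proof -
  have s: "ball 0 1 - {0 :: real^'n} \<in> sets lborel" by simp
  have "emeasure \<sigma> A = of_nat CARD('n) *
     emeasure (restrict_space lborel (ball 0 1 - {0})) {x \<in> ball 0 1 - {0}. sgn x \<in> A}"
    unfolding sphere_measure_def
    by (subst emeasure_distr[OF sgn_measurable_sphere])
       (use assms in \<open>auto simp: space_restrict_space space_scale_measure
          intro!: arg_cong[where f = "\<lambda>S. _ * emeasure _ S"]\<close>)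
  also have "emeasure (restrict_space lborel (ball 0 1 - {0})) {x \<in> ball 0 1 - {0}. sgn x \<in> A}
     = emeasure lborel {x \<in> ball 0 1 - {0}. sgn x \<in> A}"
    by (rule emeasure_restrict_space) (use s in auto)
  finally show ?thesis .
qed

lemma emeasure_sphere_measure_total:
  "emeasure (\<sigma> :: (real^'n) measure) (sphere 0 1) = ennreal (\<omega> CARD('n))"
proof -
  let ?d = "real CARD('n)"
  have d: "?d > 0" by simp
  have "sphere 0 1 \<in> sets (\<sigma> :: (real^'n) measure)"
    by (simp add: sets_restrict_space_iff)
  moreover have "{x \<in> ball 0 1 - {0}. sgn x \<in> sphere 0 1} = ball 0 1 - {0 :: real^'n}"
    by (auto simp: norm_sgn)
  moreover have "emeasure lborel (ball 0 1 - {0 :: real^'n}) = emeasure lborel (ball (0 :: real^'n) 1)"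
    by (rule emeasure_Diff_null_set) auto
  moreover have "emeasure lborel (ball (0 :: real^'n) 1) = ennreal (unit_ball_vol ?d)"
    using emeasure_ball[of 1 "0 :: real^'n"] by simp
  ultimately have "emeasure (\<sigma> :: (real^'n) measure) (sphere 0 1) = ennreal (?d * unit_ball_vol ?d)"
    by (simp add: emeasure_sphere_measure ennreal_mult' flip: ennreal_of_nat_eq_real_of_nat)
  also have "?d * unit_ball_vol ?d = \<omega> CARD('n)"
  proof -
    have "Gamma (?d / 2 + 1) = ?d / 2 * Gamma (?d / 2)"
    proof (rule Gamma_plus1)
      show "?d / 2 \<notin> \<int>\<^sub>\<le>\<^sub>0"
        using d nonpos_Ints_nonpos[of "?d / 2"] by linarith
    qed
    then have "?d * unit_ball_vol ?d = ?d * pi powr (?d / 2) / (?d / 2 * Gamma (?d / 2))"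
      by (simp only: unit_ball_vol_def times_divide_eq_right)
    then show ?thesis
      using d by (simp add: sphere_area_def)
  qed
  finally show ?thesis .
qed


section \<open>Square-integrable functions\<close>

definition square_integrable :: "(real^'n \<Rightarrow> 'b::real_normed_vector) \<Rightarrow> bool" where
  "square_integrable f \<longleftrightarrow> f \<in> borel_measurable \<sigma> \<and> integrable \<sigma> (\<lambda>x. (norm (f x))\<^sup>2)"

definition sphere_norm2 :: "(real^'n \<Rightarrow> 'b::real_normed_vector) \<Rightarrow> real" where
  "sphere_norm2 f = sqrt (1 / \<omega> CARD('n) * (LINT x|\<sigma>. (norm (f x))\<^sup>2))"

text \<open>Functions are complex-valued on the circle and real-valued in dimension \<open>d \<ge> 3\<close>.\<close>

definition scalar_convention :: "(real^'n \<Rightarrow> complex) \<Rightarrow> bool" where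
  "scalar_convention f \<longleftrightarrow> (CARD('n) \<ge> 3 \<longrightarrow> (\<forall>x\<in>sphere 0 1. f x \<in> \<real>))"

definition sphere_L2 :: "(real^'n \<Rightarrow> complex) set" where
  "sphere_L2 = {f. square_integrable f \<and> scalar_convention f}"

definition mean_zero :: "(real^'n \<Rightarrow> complex) \<Rightarrow> bool" where
  "mean_zero f \<longleftrightarrow> (LINT y|\<sigma>. f y) = 0"

definition tau :: "(real^'n \<Rightarrow> complex) \<Rightarrow> real^'n" (\<open>\<tau>\<close>) where
  "\<tau> f = (1 / \<omega> CARD('n)) *\<^sub>R (LINT x|\<sigma>. (norm (f x))\<^sup>2 *\<^sub>R x)"


section \<open>Spherical harmonics and powers of the Laplace--Beltrami operator\<close>

definition laplacian :: "(real^'n \<Rightarrow> complex) \<Rightarrow> real^'n \<Rightarrow> complex" where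
  "laplacian P x = (\<Sum>i\<in>UNIV. vector_derivative
      (\<lambda>t. vector_derivative (\<lambda>s. P (x + s *\<^sub>R axis i 1)) (at t)) (at 0))"

text \<open>Restrictions to the sphere of homogeneous harmonic polynomials, extended by \<open>0\<close> so that each
  spherical harmonic is a single function.\<close>

definition spherical_harmonics :: "nat \<Rightarrow> (real^'n \<Rightarrow> complex) set" (\<open>\<H>\<close>) where
  "\<H> n = {Y. scalar_convention Y \<and>
     (\<exists>P. polynomial_function P \<and> (\<forall>c x. P (c *\<^sub>R x) = c ^ n *\<^sub>R P x) \<and>
          (\<forall>x. laplacian P x = 0) \<and>
          Y = (\<lambda>x. if x \<in> sphere 0 1 then P x else 0))}"

definition proj :: "nat \<Rightarrow> (real^'n \<Rightarrow> complex) \<Rightarrow> real^'n \<Rightarrow> complex" where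
  "proj n f = (THE p. p \<in> \<H> n \<and> (\<forall>Y\<in>\<H> n. (LINT x|\<sigma>. (f x - p x) * cnj (Y x)) = 0))"

text \<open>\<open>h\<close> represents \<open>(-\<Delta>\<^sub>0)\<^sup>r f\<close> and lies in \<open>L\<^sup>2\<close>; this determines \<open>h\<close> up to a null set.\<close>

definition is_LB_power :: "real \<Rightarrow> (real^'n \<Rightarrow> complex) \<Rightarrow> (real^'n \<Rightarrow> complex) \<Rightarrow> bool" where
  "is_LB_power r f h \<longleftrightarrow> h \<in> sphere_L2 \<and> proj 0 h = (\<lambda>_. 0) \<and>
     (\<forall>n\<ge>1. proj n h =
        (\<lambda>x. ((real n * (real n + real CARD('n) - 2)) powr r) *\<^sub>R proj n f x))"

definition LB_power :: "real \<Rightarrow> (real^'n \<Rightarrow> complex) \<Rightarrow> real^'n \<Rightarrow> complex" where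
  "LB_power r f = (SOME h. is_LB_power r f h)"

definition sobolev_W21 :: "(real^'n \<Rightarrow> complex) set" where
  "sobolev_W21 = {f \<in> sphere_L2. \<exists>h. is_LB_power (1/2) f h}"


section \<open>Tangential gradient\<close>

text \<open>On \<open>W\<^sub>2\<^sup>1\<close> the tangential gradient \<open>\<nabla>\<^sub>0 f = \<nabla>F|\<^bsub>S\<^esub>\<close>, \<open>F x = f (x / \<parallel>x\<parallel>)\<close>, is to be read in the weak
  sense. As \<open>F\<close> is homogeneous of degree \<open>0\<close>, \<open>\<nabla>F\<close> is homogeneous of degree \<open>-1\<close>, so that
  \<open>\<nabla>F x = \<nabla>\<^sub>0 f (x / \<parallel>x\<parallel>) / \<parallel>x\<parallel>\<close>. Below, \<open>\<phi>\<close> ranges over the \<open>C\<^sup>1\<close> functions with compact support in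
  \<open>\<real>\<^sup>d - {0}\<close>, and \<open>D\<close> is the gradient of \<open>\<phi>\<close>. This determines \<open>G\<close> up to a null set.\<close>

definition is_tangential_gradient ::
    "(real^'n \<Rightarrow> complex) \<Rightarrow> (real^'n \<Rightarrow> complex^'n) \<Rightarrow> bool" where
  "is_tangential_gradient f G \<longleftrightarrow> square_integrable G \<and>
     (\<forall>\<phi> D. (\<forall>x. (\<phi> has_derivative (\<lambda>h. D x \<bullet> h)) (at x)) \<longrightarrow> continuous_on UNIV D \<longrightarrow>
        (\<exists>K. compact K \<and> 0 \<notin> K \<and> (\<forall>x. x \<notin> K \<longrightarrow> \<phi> x = 0)) \<longrightarrow>
        (\<forall>i. (LINT x|lborel. (D x $ i) *\<^sub>R f (sgn x))
             = - (LINT x|lborel. (\<phi> x / norm x) *\<^sub>R (G (sgn x) $ i))))"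

definition tangential_gradient :: "(real^'n \<Rightarrow> complex) \<Rightarrow> real^'n \<Rightarrow> complex^'n" (\<open>\<nabla>\<^sub>0\<close>) where
  "\<nabla>\<^sub>0 f = (SOME G. is_tangential_gradient f G)"


section \<open>The constants\<close>

text \<open>The minimum over \<open>e\<close> is attained, the integral being continuous in \<open>e\<close>; hence it is the infimum.\<close>

definition hardy_rellich_constant :: "'n::finite itself \<Rightarrow> real \<Rightarrow> bool" where
  "hardy_rellich_constant _ C \<longleftrightarrow>
     (\<forall>g \<in> sobolev_W21 :: (real^'n \<Rightarrow> complex) set. mean_zero g \<longrightarrow>
        (LINT x|\<sigma>. (norm (g x))\<^sup>2)
        \<le> C * (INF e\<in>sphere 0 1. LINT x|\<sigma>. (1 - x \<bullet> e) * (norm (LB_power (1/2) g x))\<^sup>2))"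

definition uncertainty_constant :: "nat \<Rightarrow> real" where
  "uncertainty_constant d =
     (if d = 2 then 1 / 8 else (real d - 1) * (1 - 2 / sqrt (real d + 3)))"

end

theory Submission
  imports Defs "HOL-Computational_Algebra.Polynomial"
begin

text \<open>Write \<open>t = \<parallel>\<tau>(f)\<parallel>\<close> and \<open>N = \<parallel>\<nabla>\<^sub>0 f\<parallel>\<^sup>2\<close>, expand \<open>f = \<Sum> f\<^sub>n\<close> into spherical harmonics and put \<open>a\<^sub>n = \<parallel>f\<^sub>n\<parallel>\<^sup>2\<close>
  and \<open>\<lambda>\<^sub>n = n (n + d - 2)\<close>. Then \<open>\<Sum> a\<^sub>n = 1\<close> (\<open>degree_energy_sums\<close>), \<open>\<Sum> \<lambda>\<^sub>n a\<^sub>n \<le> N\<close>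
  (\<open>degree_energy_gradient\<close>), and \<open>a\<^sub>0 = 0\<close> because \<open>f\<close> has mean zero.

  For \<open>d \<ge> 3\<close> two estimates compete. As \<open>\<lambda>\<^sub>n \<ge> d - 1\<close> for \<open>n \<ge> 1\<close>, \<open>N \<ge> d - 1\<close>. Secondly, the tangential part
  \<open>e - \<langle>x, e\<rangle> x\<close> of the constant field \<open>e = \<tau>(f) / t\<close> has divergence \<open>-(d - 1) \<langle>x, e\<rangle>\<close>; integrating it against
  \<open>\<nabla>\<^sub>0 \<bar>f\<bar>\<^sup>2\<close> and applying Cauchy--Schwarz gives \<open>(d - 1)\<^sup>2 t\<^sup>2 / 4 \<le> (1 - t\<^sup>2) N\<close> (\<open>uncertainty_principle\<close>). The first
  bounds \<open>(1 - t) N\<close> below by a decreasing function of \<open>t\<close>, the second by the increasing function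
  \<open>(d - 1)\<^sup>2 t\<^sup>2 / (4 (1 + t))\<close>. They cross at \<open>t = 2 / \<surd>(d + 3)\<close>, and the common value there is \<open>B\<^sub>d\<close>
  (\<open>uncertainty_optimisation\<close>).

  For the other bounds, \<open>1 = (\<Sum> a\<^sub>n)\<^sup>2 \<le> (\<Sum> a\<^sub>n / \<lambda>\<^sub>n) (\<Sum> \<lambda>\<^sub>n a\<^sub>n)\<close> reduces everything to
  \<open>\<Sum> a\<^sub>n / \<lambda>\<^sub>n \<le> C (1 - t)\<close>. The left side is \<open>\<parallel>g\<parallel>\<^sup>2\<close> for \<open>g = (-\<Delta>\<^sub>0)\<^bsup>-1/2\<^esup> f\<close>, and \<open>1 - t\<close> is the minimum over \<open>e\<close>
  of the normalised integral of \<open>(1 - \<langle>x, e\<rangle>) \<bar>f\<bar>\<^sup>2\<close>: for a Hardy--Rellich constant \<open>C\<close> this is the defining inequality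
  (\<open>hardy_rellich_degree_energy\<close>). On the circle it holds with \<open>C = 8\<close>, which is where \<open>B\<^sub>2 = 1/8\<close> comes from: in
  terms of Fourier coefficients \<open>1 - t\<close> is a sum of squared differences, and the discrete Hardy inequality bounds
  \<open>\<Sum> a\<^sub>n / n\<^sup>2\<close> by it (\<open>hardy_rellich_circle\<close>).

  The analytic work is to make sense of the expansion. The gradient is a weak one, so it has to be constructed as the
  limit of the gradients of the partial sums (\<open>weak_gradient_exists\<close>), and any weak gradient has to be bounded below by
  Green's formula against harmonics (\<open>harmonics_green\<close>, \<open>weak_gradient_energy\<close>). Completeness of the harmonics combines
  Stone--Weierstrass (\<open>polynomials_complete\<close>) with the decomposition of polynomials into harmonic ones
  (\<open>hpoly_sphere_sum_harmonics\<close>). All of this is done for real-valued functions: every quantity above is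
  additive over the real and the imaginary part.\<close>

section \<open>Gradients and homogeneous polynomials\<close>

definition has_gradient :: "(real^'n \<Rightarrow> real) \<Rightarrow> (real^'n \<Rightarrow> real^'n) \<Rightarrow> bool" where
  "has_gradient p D \<longleftrightarrow> (\<forall>x. (p has_derivative (\<lambda>h. D x \<bullet> h)) (at x)) \<and> continuous_on UNIV D"

definition grad :: "(real^'n \<Rightarrow> real) \<Rightarrow> real^'n \<Rightarrow> real^'n" where
  "grad p x = (\<chi> i. frechet_derivative p (at x) (axis i 1))"

definition lap :: "(real^'n \<Rightarrow> real) \<Rightarrow> real^'n \<Rightarrow> real" where
  "lap p x = (\<Sum>i\<in>UNIV. grad (\<lambda>y. grad p y $ i) x $ i)"

lemma grad_eqI:
  assumes "(p has_derivative (\<lambda>h. D \<bullet> h)) (at x)"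
  shows "grad p x = D"
proof -
  have "frechet_derivative p (at x) = (\<lambda>h. D \<bullet> h)"
    using frechet_derivative_at[OF assms] by simp
  then show ?thesis
    by (simp add: grad_def vec_eq_iff inner_axis)
qed

lemma has_gradient_unique: "has_gradient p D \<Longrightarrow> grad p = D"
  by (auto simp: has_gradient_def intro!: grad_eqI)

lemma has_gradientD:
  assumes "has_gradient p D"
  shows "(p has_derivative (\<lambda>h. grad p x \<bullet> h)) (at x)" "continuous_on UNIV (grad p)"
  using has_gradient_unique[OF assms] assms by (auto simp: has_gradient_def)

lemma has_gradient_continuous:
  assumes "has_gradient p D"
  shows "continuous_on S p"
  using assms unfolding has_gradient_def
  by (meson continuous_at_imp_continuous_on has_derivative_continuous)

lemma has_gradient_const: "has_gradient (\<lambda>x. c) (\<lambda>x. 0)"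
  by (auto simp: has_gradient_def intro!: derivative_eq_intros)

lemma has_gradient_coord: "has_gradient (\<lambda>x. x $ i) (\<lambda>x. axis i 1)"
  by (simp add: has_gradient_def inner_axis' bounded_linear_imp_has_derivative bounded_linear_vec_nth)

lemma has_gradient_add:
  "has_gradient p D \<Longrightarrow> has_gradient q E \<Longrightarrow> has_gradient (\<lambda>x. p x + q x) (\<lambda>x. D x + E x)"
  by (auto simp: has_gradient_def inner_add_left intro!: derivative_eq_intros continuous_intros)

lemma has_gradient_scale:
  "has_gradient p D \<Longrightarrow> has_gradient (\<lambda>x. c * p x) (\<lambda>x. c *\<^sub>R D x)"
  by (auto simp: has_gradient_def intro!: derivative_eq_intros continuous_intros)

lemma has_gradient_mult:
  assumes p: "has_gradient p D" and q: "has_gradient q E"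
  shows "has_gradient (\<lambda>x. p x * q x) (\<lambda>x. q x *\<^sub>R D x + p x *\<^sub>R E x)"
  unfolding has_gradient_def
proof safe
  fix x
  show "((\<lambda>x. p x * q x) has_derivative (\<bullet>) (q x *\<^sub>R D x + p x *\<^sub>R E x)) (at x)"
    using p q by (auto simp: has_gradient_def inner_add_left algebra_simps intro!: derivative_eq_intros)
  show "continuous_on UNIV (\<lambda>x. q x *\<^sub>R D x + p x *\<^sub>R E x)"
    using p q has_gradient_continuous[OF p] has_gradient_continuous[OF q]
    by (auto simp: has_gradient_def intro!: continuous_intros)
qed

lemma has_gradient_sum:
  "finite I \<Longrightarrow> (\<And>i. i \<in> I \<Longrightarrow> has_gradient (p i) (D i)) \<Longrightarrow>
     has_gradient (\<lambda>x. \<Sum>i\<in>I. p i x) (\<lambda>x. \<Sum>i\<in>I. D i x)"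
  by (induction I rule: finite_induct) (auto intro!: has_gradient_const has_gradient_add)

text \<open>Homogeneous polynomials of degree \<open>n\<close>. Peeling off one coordinate at a time makes inductions on the degree direct,
  and with Euler's identity the degree is visible in the gradient; the zero function belongs to every degree.\<close>

primrec hpoly :: "nat \<Rightarrow> (real^('n::finite) \<Rightarrow> real) set" where
  "hpoly 0 = {\<lambda>x. c | c. True}"
| "hpoly (Suc n) = {\<lambda>x. \<Sum>i\<in>UNIV. x $ i * q i x | q. \<forall>i. q i \<in> hpoly n}"

lemma hpoly_Suc_I: "(\<And>i. q i \<in> hpoly n) \<Longrightarrow> (\<lambda>x. \<Sum>i\<in>UNIV. x $ i * q i x) \<in> hpoly (Suc n)"
  by auto

lemma hpoly_Suc_iff: "p \<in> hpoly (Suc n) \<longleftrightarrow>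
    (\<exists>q. p = (\<lambda>x. \<Sum>i\<in>UNIV. x $ i * q i x) \<and> (\<forall>i. q i \<in> hpoly n))"
  by auto

declare hpoly.simps(2) [simp del]

lemma hpoly_const: "(\<lambda>x. c) \<in> hpoly 0"
  by auto

lemma hpoly_zero: "(\<lambda>x. 0) \<in> hpoly n"
proof (induction n)
  case (Suc n)
  from hpoly_Suc_I[OF Suc] show ?case by simp
qed auto

lemma hpoly_add: "p \<in> hpoly n \<Longrightarrow> q \<in> hpoly n \<Longrightarrow> (\<lambda>x. p x + q x) \<in> hpoly n"
proof (induction n arbitrary: p q)
  case (Suc n)
  from Suc.prems(1) obtain a where a: "p = (\<lambda>x. \<Sum>i\<in>UNIV. x $ i * a i x)" "\<And>i. a i \<in> hpoly n"
    by (auto simp: hpoly_Suc_iff)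
  from Suc.prems(2) obtain b where b: "q = (\<lambda>x. \<Sum>i\<in>UNIV. x $ i * b i x)" "\<And>i. b i \<in> hpoly n"
    by (auto simp: hpoly_Suc_iff)
  have "(\<lambda>x. \<Sum>i\<in>UNIV. x $ i * (a i x + b i x)) \<in> hpoly (Suc n)"
    by (intro hpoly_Suc_I Suc.IH a b)
  then show ?case by (simp add: a b sum.distrib algebra_simps)
qed auto

lemma hpoly_scale: "p \<in> hpoly n \<Longrightarrow> (\<lambda>x. c * p x) \<in> hpoly n"
proof (induction n arbitrary: p)
  case (Suc n)
  from Suc.prems obtain a where a: "p = (\<lambda>x. \<Sum>i\<in>UNIV. x $ i * a i x)" "\<And>i. a i \<in> hpoly n"
    by (auto simp: hpoly_Suc_iff)
  have "(\<lambda>x. \<Sum>i\<in>UNIV. x $ i * (c * a i x)) \<in> hpoly (Suc n)"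
    by (intro hpoly_Suc_I Suc.IH a)
  then show ?case by (simp add: a sum_distrib_left mult.left_commute)
qed auto

lemma hpoly_diff: "p \<in> hpoly n \<Longrightarrow> q \<in> hpoly n \<Longrightarrow> (\<lambda>x. p x - q x) \<in> hpoly n"
  using hpoly_add[of p n "\<lambda>x. (-1) * q x"] hpoly_scale[of q n "-1"] by simp

lemma hpoly_sum: "finite I \<Longrightarrow> (\<And>i. i \<in> I \<Longrightarrow> p i \<in> hpoly n) \<Longrightarrow> (\<lambda>x. \<Sum>i\<in>I. p i x) \<in> hpoly n"
  by (induction I rule: finite_induct) (auto intro!: hpoly_zero hpoly_add)

lemma hpoly_coord_mult:
  assumes "p \<in> hpoly n"
  shows "(\<lambda>x. x $ i * p x) \<in> hpoly (Suc n)"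
proof -
  have "(\<lambda>x. \<Sum>j\<in>UNIV. x $ j * (if j = i then p else (\<lambda>x. 0)) x) \<in> hpoly (Suc n)"
    using assms hpoly_zero[of n] by (intro hpoly_Suc_I) auto
  moreover have "(\<Sum>j\<in>UNIV. x $ j * (if j = i then p else (\<lambda>x. 0)) x) = x $ i * p x" for x
    by (subst sum.mono_neutral_cong_right[of _ "{i}" _ "\<lambda>j. x $ i * p x"]) auto
  ultimately show ?thesis by simp
qed

lemma hpoly_mult: "p \<in> hpoly m \<Longrightarrow> q \<in> hpoly n \<Longrightarrow> (\<lambda>x. p x * q x) \<in> hpoly (m + n)"
proof (induction m arbitrary: p)
  case 0
  then show ?case by (auto intro!: hpoly_scale)
next
  case (Suc m)
  from Suc.prems(1) obtain a where a: "p = (\<lambda>x. \<Sum>i\<in>UNIV. x $ i * a i x)" "\<And>i. a i \<in> hpoly m"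
    by (auto simp: hpoly_Suc_iff)
  have "(\<lambda>x. \<Sum>i\<in>UNIV. x $ i * (a i x * q x)) \<in> hpoly (Suc (m + n))"
    by (intro hpoly_Suc_I Suc.IH a Suc.prems)
  then show ?case by (simp add: a sum_distrib_right mult.assoc)
qed

lemma hpoly_homogeneous: "p \<in> hpoly n \<Longrightarrow> p (c *\<^sub>R x) = c ^ n * p x"
proof (induction n arbitrary: p)
  case (Suc n)
  from Suc.prems obtain a where a: "p = (\<lambda>x. \<Sum>i\<in>UNIV. x $ i * a i x)" "\<And>i. a i \<in> hpoly n"
    by (auto simp: hpoly_Suc_iff)
  show ?case using Suc.IH[OF a(2)] by (simp add: a sum_distrib_left algebra_simps)
qed auto

lemma hpoly_real_polynomial: "p \<in> hpoly n \<Longrightarrow> real_polynomial_function p"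
proof (induction n arbitrary: p)
  case (Suc n)
  from Suc.prems obtain a where a: "p = (\<lambda>x. \<Sum>i\<in>UNIV. x $ i * a i x)" "\<And>i. a i \<in> hpoly n"
    by (auto simp: hpoly_Suc_iff)
  show ?case unfolding a
    by (intro real_polynomial_function_sum real_polynomial_function.intros Suc.IH a
        bounded_linear_vec_nth) auto
qed auto

text \<open>Homogeneity enters all later computations through Euler's identity, so it is established together with the
  gradient, by the product rule on \<open>\<Sum> x\<^sub>i q\<^sub>i\<close>.\<close>

lemma hpoly_has_gradient:
  assumes "p \<in> hpoly n"
  shows "\<exists>D. has_gradient p D \<and> (\<forall>i. (\<lambda>x. D x $ i) \<in> hpoly (n - 1)) \<and>
     (\<forall>x. D x \<bullet> x = real n * p x)"
  using assms
proof (induction n arbitrary: p)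
  case 0
  then show ?case by (auto intro!: exI[of _ "\<lambda>x. 0"] has_gradient_const)
next
  case (Suc n)
  from Suc.prems obtain a where a: "p = (\<lambda>x. \<Sum>i\<in>UNIV. x $ i * a i x)" "\<And>i. a i \<in> hpoly n"
    by (auto simp: hpoly_Suc_iff)
  obtain D where D: "\<And>i. has_gradient (a i) (D i)" "\<And>i j. (\<lambda>x. D i x $ j) \<in> hpoly (n - 1)"
    "\<And>i x. D i x \<bullet> x = real n * a i x"
    using Suc.IH[OF a(2)] by metis
  define E where "E x = (\<Sum>i\<in>UNIV. a i x *\<^sub>R axis i 1 + (x $ i) *\<^sub>R D i x)" for x
  have "has_gradient p E"
    unfolding a E_def
    by (intro has_gradient_sum has_gradient_mult has_gradient_coord D) auto
  moreover have "(\<lambda>x. E x $ j) \<in> hpoly n" for j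
  proof -
    have "(\<lambda>x. x $ i * D i x $ j) \<in> hpoly n" for i
    proof (cases n)
      case 0
      have "D i = (\<lambda>x. 0)"
      proof -
        obtain c where "a i = (\<lambda>x. c)" using a(2)[of i] by (auto simp: 0)
        with D(1)[of i] have "has_gradient (\<lambda>x. c) (D i)" by simp
        then show ?thesis using has_gradient_unique has_gradient_const by metis
      qed
      then show ?thesis by (simp add: hpoly_zero)
    next
      case (Suc m)
      then show ?thesis using hpoly_coord_mult[OF D(2)[of i j], of i] by simp
    qed
    moreover have "(\<lambda>x. a i x * axis i 1 $ j) \<in> hpoly n" for i
      using hpoly_scale[OF a(2), of "axis i 1 $ j"] by (simp add: mult.commute)
    ultimately show ?thesis
      unfolding E_def sum_component vector_add_component vector_scaleR_component real_scaleR_def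
      by (intro hpoly_sum hpoly_add) auto
  qed
  moreover have "E x \<bullet> x = real (Suc n) * p x" for x
    by (simp add: E_def inner_sum_left inner_add_left inner_axis' D a sum.distrib sum_distrib_left algebra_simps)
  ultimately show ?case by auto
qed

lemma
  assumes "p \<in> hpoly n"
  shows hpoly_gradient: "has_gradient p (grad p)"
    and hpoly_grad: "(\<lambda>x. grad p x $ i) \<in> hpoly (n - 1)"
    and hpoly_euler: "grad p x \<bullet> x = real n * p x"
  using hpoly_has_gradient[OF assms] has_gradient_unique by metis+

lemma hpoly_continuous: "p \<in> hpoly n \<Longrightarrow> continuous_on S p"
  using hpoly_gradient has_gradient_continuous by blast

lemma hpoly_lap:
  assumes "p \<in> hpoly n"
  shows "lap p \<in> hpoly (n - 2)"
proof -
  have "(\<lambda>x. grad (\<lambda>y. grad p y $ i) x $ i) \<in> hpoly (n - 2)" for i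
    using hpoly_grad[OF hpoly_grad[OF assms], of i i] by (simp add: numeral_2_eq_2)
  then show ?thesis unfolding lap_def[abs_def] by (intro hpoly_sum) auto
qed

lemma grad_const: "grad (\<lambda>x. c) = (\<lambda>x. 0)"
  using has_gradient_const by (rule has_gradient_unique)

lemma hpoly_lap_zero:
  assumes "p \<in> hpoly n" "n < 2"
  shows "lap p x = 0"
proof -
  have "(\<lambda>y. grad p y $ i) \<in> hpoly 0" for i
    using hpoly_grad[OF assms(1), of i] assms(2) by (cases "n = 0") (auto simp: less_2_cases_iff)
  then have "\<exists>c. (\<lambda>y. grad p y $ i) = (\<lambda>x. c)" for i
    by (simp only: hpoly.simps mem_Collect_eq) blast
  then have "grad (\<lambda>y. grad p y $ i) = (\<lambda>x. 0)" for i
    using grad_const by metis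
  then show ?thesis by (simp add: lap_def)
qed

lemma grad_add: "p \<in> hpoly n \<Longrightarrow> q \<in> hpoly m \<Longrightarrow> grad (\<lambda>x. p x + q x) = (\<lambda>x. grad p x + grad q x)"
  by (intro has_gradient_unique has_gradient_add hpoly_gradient)

lemma grad_scale: "p \<in> hpoly n \<Longrightarrow> grad (\<lambda>x. c * p x) = (\<lambda>x. c *\<^sub>R grad p x)"
  by (intro has_gradient_unique has_gradient_scale hpoly_gradient)

lemma grad_mult: "p \<in> hpoly n \<Longrightarrow> q \<in> hpoly m \<Longrightarrow>
    grad (\<lambda>x. p x * q x) = (\<lambda>x. q x *\<^sub>R grad p x + p x *\<^sub>R grad q x)"
  by (intro has_gradient_unique has_gradient_mult hpoly_gradient)

lemma lap_add:
  "p \<in> hpoly n \<Longrightarrow> q \<in> hpoly n \<Longrightarrow> lap (\<lambda>x. p x + q x) = (\<lambda>x. lap p x + lap q x)"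
  by (simp add: lap_def[abs_def] grad_add grad_add[OF hpoly_grad hpoly_grad] sum.distrib)

lemma lap_scale: "p \<in> hpoly n \<Longrightarrow> lap (\<lambda>x. c * p x) = (\<lambda>x. c * lap p x)"
  by (simp add: lap_def[abs_def] grad_scale grad_scale[OF hpoly_grad] sum_distrib_left)

lemma lap_diff:
  assumes "p \<in> hpoly n" "q \<in> hpoly n"
  shows "lap (\<lambda>x. p x - q x) = (\<lambda>x. lap p x - lap q x)"
  using lap_add[OF assms(1) hpoly_scale[OF assms(2), of "-1"]] lap_scale[OF assms(2), of "-1"] by simp

lemma hpoly_normsq: "(\<lambda>x::real^'n. x \<bullet> x) \<in> hpoly 2"
proof -
  have "(\<lambda>x::real^'n. x $ i * (x $ i * 1)) \<in> hpoly 2" for i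
    unfolding numeral_2_eq_2 by (intro hpoly_coord_mult hpoly_const)
  then have "(\<lambda>x::real^'n. \<Sum>i\<in>UNIV. x $ i * (x $ i * 1)) \<in> hpoly 2"
    by (intro hpoly_sum) auto
  then show ?thesis by (simp add: inner_vec_def)
qed

lemma grad_normsq: "grad (\<lambda>x::real^'n. x \<bullet> x) = (\<lambda>x. 2 *\<^sub>R x)"
  by (intro has_gradient_unique) (auto simp: has_gradient_def inner_commute intro!: derivative_eq_intros continuous_intros)

lemma lap_normsq_mult:
  fixes p :: "real^'n \<Rightarrow> real"
  assumes p: "p \<in> hpoly m"
  shows "lap (\<lambda>x. (x \<bullet> x) * p x) =
    (\<lambda>x. (2 * real CARD('n) + 4 * real m) * p x + (x \<bullet> x) * lap p x)"
proof
  fix x :: "real^'n"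
  have c: "(\<lambda>y::real^'n. y $ i) \<in> hpoly 1" for i
    using hpoly_coord_mult[OF hpoly_const[of 1], of i] by simp
  have gc: "grad (\<lambda>y::real^'n. y $ i) = (\<lambda>y. axis i 1)" for i
    by (rule has_gradient_unique[OF has_gradient_coord])
  have 1: "(\<lambda>y. grad (\<lambda>x. (x \<bullet> x) * p x) y $ i) = (\<lambda>y. 2 * (p y * y $ i) + (y \<bullet> y) * grad p y $ i)" for i
    by (simp only: grad_mult[OF hpoly_normsq p] grad_normsq) (simp add: algebra_simps)
  have 2: "grad (\<lambda>y. 2 * (p y * y $ i) + (y \<bullet> y) * grad p y $ i) x =
     2 *\<^sub>R (x $ i *\<^sub>R grad p x + p x *\<^sub>R axis i 1) +
     (grad p x $ i *\<^sub>R (2 *\<^sub>R x) + (x \<bullet> x) *\<^sub>R grad (\<lambda>y. grad p y $ i) x)" for i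
    using grad_add[OF hpoly_scale[OF hpoly_mult[OF p c[of i]], of 2] hpoly_mult[OF hpoly_normsq hpoly_grad[OF p, of i]]]
       grad_scale[OF hpoly_mult[OF p c[of i]], of 2] grad_mult[OF p c[of i]]
       grad_mult[OF hpoly_normsq hpoly_grad[OF p, of i]]
    by (simp add: gc grad_normsq)
  have "lap (\<lambda>x. (x \<bullet> x) * p x) x = (\<Sum>i\<in>UNIV. 2 * (p x) + 4 * (grad p x $ i * x $ i)
      + (x \<bullet> x) * (grad (\<lambda>y. grad p y $ i) x $ i))"
    unfolding lap_def 1 2 by (intro sum.cong) (auto simp: algebra_simps)
  also have "\<dots> = 2 * real CARD('n) * p x + 4 * (grad p x \<bullet> x) + (x \<bullet> x) * lap p x"
    by (simp add: sum.distrib sum_distrib_left[symmetric] lap_def inner_vec_def)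
  finally show "lap (\<lambda>x. (x \<bullet> x) * p x) x = (2 * real CARD('n) + 4 * real m) * p x + (x \<bullet> x) * lap p x"
    by (simp add: hpoly_euler[OF p] algebra_simps)
qed

text \<open>The Laplacian \<open>w = \<Delta>q\<close> of a solution satisfies an equation of the same shape, with \<open>\<Delta>g\<close> on the right, degree
  lower by two and a larger constant. So \<open>w\<close> is found first, by induction, and \<open>q\<close> is read off from the equation.\<close>

lemma solve_radial_laplace:
  fixes g :: "real^'n \<Rightarrow> real"
  assumes "c > 0" "g \<in> hpoly m"
  shows "\<exists>q\<in>hpoly m. \<forall>x. c * q x + (x \<bullet> x) * lap q x = g x"
  using assms
proof (induction m arbitrary: c g rule: less_induct)
  case (less m)
  show ?case
  proof (cases "m < 2")
    case True
    have "(\<lambda>x. (1 / c) * g x) \<in> hpoly m" by (intro hpoly_scale less.prems)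
    moreover from hpoly_lap_zero[OF this True] have "\<forall>x. c * ((1/c) * g x) + (x \<bullet> x) * lap (\<lambda>x. (1 / c) * g x) x = g x"
      using less.prems(1) by simp
    ultimately show ?thesis by (rule bexI[where P = "\<lambda>q. \<forall>x. c * q x + (x \<bullet> x) * lap q x = g x", rotated])
  next
    case False
    define c' where "c' = c + 2 * real CARD('n) + 4 * real (m - 2)"
    have "c' > 0" using less.prems(1) by (simp add: c'_def add_pos_nonneg)
    from less.IH[OF _ this hpoly_lap[OF less.prems(2)]] False obtain w where
      w: "w \<in> hpoly (m - 2)" "\<And>x. c' * w x + (x \<bullet> x) * lap w x = lap g x" by auto
    define q where "q x = (1 / c) * (g x - (x \<bullet> x) * w x)" for x
    have nw: "(\<lambda>x. (x \<bullet> x) * w x) \<in> hpoly m"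
      using hpoly_mult[OF hpoly_normsq w(1)] False by (simp only: le_add_diff_inverse not_less)
    have q: "q \<in> hpoly m" unfolding q_def[abs_def] by (intro hpoly_scale hpoly_diff less.prems nw)
    have "lap q x = w x" for x
    proof -
      have "lap q x = (1 / c) * (lap g x - lap (\<lambda>x. (x \<bullet> x) * w x) x)"
        unfolding q_def[abs_def]
        by (simp only: lap_scale[OF hpoly_diff[OF less.prems(2) nw]] lap_diff[OF less.prems(2) nw])
      also have "\<dots> = (1 / c) * (lap g x - (2 * real CARD('n) + 4 * real (m-2)) * w x - (x \<bullet> x) * lap w x)"
        by (simp add: lap_normsq_mult[OF w(1)])
      also have "\<dots> = w x"
        using less.prems(1) by (simp add: w(2)[symmetric] c'_def field_simps)
      finally show ?thesis .
    qed
    then have "\<forall>x. c * q x + (x \<bullet> x) * lap q x = g x"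
      using less.prems(1) by (auto simp: q_def)
    with q show ?thesis by blast
  qed
qed

section \<open>Harmonic polynomials\<close>

definition harmonics :: "nat \<Rightarrow> (real^'n \<Rightarrow> real) set" where
  "harmonics n = {p \<in> hpoly n. \<forall>x. lap p x = 0}"

lemma harmonics_hpoly: "p \<in> harmonics n \<Longrightarrow> p \<in> hpoly n"
  by (simp add: harmonics_def)

lemma harmonics_zero: "(\<lambda>x. 0) \<in> harmonics n"
  by (simp add: harmonics_def hpoly_zero lap_def grad_const)

lemma harmonics_add: "p \<in> harmonics n \<Longrightarrow> q \<in> harmonics n \<Longrightarrow> (\<lambda>x. p x + q x) \<in> harmonics n"
  by (auto simp: harmonics_def lap_add intro: hpoly_add)

lemma harmonics_scale: "p \<in> harmonics n \<Longrightarrow> (\<lambda>x. c * p x) \<in> harmonics n"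
  by (auto simp: harmonics_def lap_scale intro: hpoly_scale)

text \<open>It suffices that \<open>\<Delta>(\<bar>x\<bar>\<^sup>2 q) = \<Delta>p\<close>, and this is the equation just solved, with \<open>c = 2 d + 4 n\<close>.\<close>

lemma hpoly_normsq_decomposition:
  fixes p :: "real^'n \<Rightarrow> real"
  assumes "p \<in> hpoly (Suc (Suc n))"
  shows "\<exists>h\<in>harmonics (Suc (Suc n)). \<exists>q\<in>hpoly n. \<forall>x. p x = h x + (x \<bullet> x) * q x"
proof -
  have "2 * real CARD('n) + 4 * real n > 0" by (simp add: add_pos_nonneg)
  moreover have "lap p \<in> hpoly n" using hpoly_lap[OF assms] by simp
  ultimately obtain q where q: "q \<in> hpoly n"
    "\<And>x. (2 * real CARD('n) + 4 * real n) * q x + (x \<bullet> x) * lap q x = lap p x"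
    using solve_radial_laplace by blast
  have nq: "(\<lambda>x. (x \<bullet> x) * q x) \<in> hpoly (Suc (Suc n))"
    using hpoly_mult[OF hpoly_normsq q(1)] by simp
  define h where "h x = p x - (x \<bullet> x) * q x" for x
  have "lap h x = 0" for x
    unfolding h_def[abs_def] using q by (simp add: lap_diff[OF assms nq] lap_normsq_mult)
  then have "h \<in> harmonics (Suc (Suc n))"
    using hpoly_diff[OF assms nq] by (simp add: harmonics_def h_def[abs_def])
  then show ?thesis using q(1) by (intro bexI[of _ h] bexI[of _ q]) (auto simp: h_def)
qed

lemma hpoly_sphere_sum_harmonics:
  assumes "p \<in> hpoly n"
  shows "\<exists>h. (\<forall>k. h k \<in> harmonics k) \<and> (\<forall>x\<in>sphere 0 1. p x = (\<Sum>k\<le>n. h k x))"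
  using assms
proof (induction n arbitrary: p rule: less_induct)
  case (less n)
  show ?case
  proof (cases "n < 2")
    case True
    then have "p \<in> harmonics n" using less.prems hpoly_lap_zero by (auto simp: harmonics_def)
    then have "(if k = n then p else (\<lambda>x. 0)) \<in> harmonics k" for k
      by (auto simp: harmonics_zero)
    moreover have "p x = (\<Sum>k\<le>n. (if k = n then p else (\<lambda>x. 0)) x)" for x
      by (simp add: if_distrib[of "\<lambda>f. f x" for x])
    ultimately show ?thesis by (intro exI[of _ "\<lambda>k. if k = n then p else (\<lambda>x. 0)"]) blast
  next
    case False
    then obtain m where m: "n = Suc (Suc m)" by (metis add_2_eq_Suc not_less le_Suc_ex)
    from hpoly_normsq_decomposition[OF less.prems[unfolded m]] obtain h q where
      h: "h \<in> harmonics (Suc (Suc m))" "q \<in> hpoly m" "\<And>x. p x = h x + (x \<bullet> x) * q x" by blast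
    have "m < n" by (simp add: m)
    from less.IH[OF this h(2)] obtain h' where
      h': "\<And>k. h' k \<in> harmonics k" "\<And>x. x \<in> sphere 0 1 \<Longrightarrow> q x = (\<Sum>k\<le>m. h' k x)" by blast
    define H where "H k = (if k \<le> m then h' k else if k = n then h else (\<lambda>x. 0))" for k
    have "p x = (\<Sum>k\<le>n. H k x)" if "x \<in> sphere 0 1" for x
    proof -
      have "x \<bullet> x = 1" using that by (simp add: norm_eq_1)
      then have "p x = (\<Sum>k\<le>m. h' k x) + h x" using h'(2)[OF that] h(3) by simp
      also have "(\<Sum>k\<le>m. h' k x) = (\<Sum>k\<le>m. H k x)" by (simp add: H_def)
      finally show ?thesis by (simp add: m H_def)
    qed
    moreover have "H k \<in> harmonics k" for k
      using h h' m by (auto simp: H_def harmonics_zero)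
    ultimately show ?thesis by blast
  qed
qed

text \<open>The vanishing of \<open>P k\<close> beyond \<open>N\<close> is what allows two such decompositions to be added.\<close>

lemma real_polynomial_sum_hpoly:
  fixes p :: "real^'n \<Rightarrow> real"
  assumes "real_polynomial_function p"
  shows "\<exists>N P. (\<forall>k. P k \<in> hpoly k) \<and> (\<forall>k>N. P k = (\<lambda>x. 0)) \<and> p = (\<lambda>x. \<Sum>k\<le>N. P k x)"
proof -
  define Q where "Q p \<longleftrightarrow> (\<exists>N P. (\<forall>k. P k \<in> hpoly k) \<and> (\<forall>k>N. P k = (\<lambda>x. 0)) \<and> p = (\<lambda>x. \<Sum>k\<le>N. P k x))" for p :: "real^'n \<Rightarrow> real"
  have hp: "Q p" if "p \<in> hpoly n" for p n
  proof -
    have "p = (\<lambda>x. \<Sum>k\<le>n. (if k = n then p else (\<lambda>x. 0)) x)"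
      by (auto simp: if_distribR cong: if_cong)
    with that show ?thesis unfolding Q_def
      by (intro exI[of _ n] exI[of _ "\<lambda>k. if k = n then p else (\<lambda>x. 0)"])
        (auto simp: hpoly_zero)
  qed
  have ad: "Q (\<lambda>x. p x + q x)" if "Q p" "Q q" for p q
  proof -
    from that obtain N P where P: "\<And>k. P k \<in> hpoly k" "\<And>k. k > N \<Longrightarrow> P k = (\<lambda>x. 0)" "p = (\<lambda>x. \<Sum>k\<le>N. P k x)"
      unfolding Q_def by blast
    from that obtain M R where R: "\<And>k. R k \<in> hpoly k" "\<And>k. k > M \<Longrightarrow> R k = (\<lambda>x. 0)" "q = (\<lambda>x. \<Sum>k\<le>M. R k x)"
      unfolding Q_def by blast
    have "(\<Sum>k\<le>N. P k x) = (\<Sum>k\<le>max N M. P k x)" "(\<Sum>k\<le>M. R k x) = (\<Sum>k\<le>max N M. R k x)" for x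
      using P(2) R(2) by (simp_all add: sum.mono_neutral_left)
    then have "(\<lambda>x. p x + q x) = (\<lambda>x. \<Sum>k\<le>max N M. P k x + R k x)"
      by (simp add: P R sum.distrib)
    then show ?thesis unfolding Q_def using P R
      by (intro exI[of _ "max N M"] exI[of _ "\<lambda>k x. P k x + R k x"]) (auto intro: hpoly_add)
  qed
  have sm: "Q (\<lambda>x. \<Sum>i\<in>I. p i x)" if "finite I" "\<And>i. i \<in> I \<Longrightarrow> Q (p i)" for I and p :: "nat \<Rightarrow> _ \<Rightarrow> _"
    using that by (induction I rule: finite_induct) (auto intro: ad hp hpoly_zero)
  have "Q p" using assms
  proof (induction rule: real_polynomial_function.induct)
    case (linear f)
    have "f = (\<lambda>x. \<Sum>i\<in>UNIV. x $ i * f (axis i 1))"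
    proof
      fix x
      have "f x = f (\<Sum>i\<in>UNIV. (x $ i) *\<^sub>R axis i 1)"
        by (metis basis_expansion scalar_mult_eq_scaleR)
      also have "\<dots> = (\<Sum>i\<in>UNIV. x $ i * f (axis i 1))"
        using linear by (simp add: linear_sum bounded_linear.linear linear_cmul)
      finally show "f x = (\<Sum>i\<in>UNIV. x $ i * f (axis i 1))" .
    qed
    moreover have "(\<lambda>x. \<Sum>i\<in>UNIV. x $ i * f (axis i 1)) \<in> hpoly (Suc 0)"
      by (intro hpoly_Suc_I hpoly_const)
    ultimately show ?case using hp by metis
  next
    case (const c)
    show ?case by (rule hp[OF hpoly_const])
  next
    case (add f g)
    from ad[OF add.IH] show ?case .
  next
    case (mult f g)
    then obtain N P M R where P: "\<And>k. P k \<in> hpoly k" "f = (\<lambda>x. \<Sum>k\<le>N. P k x)"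
      and R: "\<And>k. R k \<in> hpoly k" "g = (\<lambda>x. \<Sum>k\<le>M. R k x)"
      unfolding Q_def by blast
    have "Q (\<lambda>x. \<Sum>j\<le>N. \<Sum>k\<le>M. P j x * R k x)"
      by (intro sm hp[OF hpoly_mult[OF P(1) R(1)]]) auto
    then show ?case by (simp add: P R sum_product)
  qed
  then show ?thesis by (simp add: Q_def)
qed

text \<open>For fixed \<open>x\<close>, both sides of \<open>p (c x) = c\<^sup>n p x\<close> are polynomials in \<open>c\<close>; compare coefficients.\<close>

lemma homogeneous_polynomial_hpoly:
  fixes p :: "real^'n \<Rightarrow> real"
  assumes "real_polynomial_function p" "\<And>c x. p (c *\<^sub>R x) = c ^ n * p x"
  shows "p \<in> hpoly n"
proof -
  obtain N P where P: "\<And>k. P k \<in> hpoly k" "\<And>k. k > N \<Longrightarrow> P k = (\<lambda>x. 0)" "p = (\<lambda>x. \<Sum>k\<le>N. P k x)"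
    using real_polynomial_sum_hpoly[OF assms(1)] by blast
  have p: "p x = (\<Sum>k\<le>max N n. P k x)" for x
    unfolding P(3) using P(2) by (simp add: sum.mono_neutral_left)
  have "p x = P n x" for x
  proof -
    have "(\<Sum>k\<le>max N n. P k x * c ^ k) = (\<Sum>k\<le>max N n. (if k = n then p x else 0) * c ^ k)" for c
    proof -
      have "(\<Sum>k\<le>max N n. P k x * c ^ k) = p (c *\<^sub>R x)"
        by (simp add: p hpoly_homogeneous[OF P(1)] mult.commute)
      also have "\<dots> = (\<Sum>k\<le>max N n. (if k = n then p x else 0) * c ^ k)"
        unfolding assms(2) by (simp add: if_distrib[of "\<lambda>f. f * _"] cong: if_cong)
      finally show ?thesis .
    qed
    then have "\<forall>k\<le>max N n. P k x = (if k = n then p x else 0)"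
      using polyfun_eq_coeffs[of "\<lambda>k. P k x" "max N n" "\<lambda>k. if k = n then p x else 0"] by blast
    then show ?thesis by simp
  qed
  then have "p = P n" by auto
  then show ?thesis using P(1) by simp
qed

text \<open>Finite dimension is needed once: it gives the existence of orthogonal projections onto the harmonics.\<close>

lemma hpoly_finite_spanning:
  "\<exists>B :: (real^'n \<Rightarrow> real) set. finite B \<and> B \<subseteq> hpoly n \<and> (\<forall>p\<in>hpoly n. \<exists>c. p = (\<lambda>x. \<Sum>b\<in>B. c b * b x))"
proof (induction n)
  case 0
  show ?case
    by (intro exI[of _ "{\<lambda>x. 1}"]) auto
next
  case (Suc n)
  then obtain B :: "(real^'n \<Rightarrow> real) set" where B': "finite B \<and> B \<subseteq> hpoly n \<and>
      (\<forall>p\<in>hpoly n. \<exists>c. p = (\<lambda>x. \<Sum>b\<in>B. c b * b x))"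
    ..
  then have B: "finite B" "B \<subseteq> hpoly n" and
    Bc: "\<And>p. p \<in> hpoly n \<Longrightarrow> \<exists>c. p = (\<lambda>x. \<Sum>b\<in>B. c b * b x)"
    by simp_all
  define f where "f = (\<lambda>(i, b) (x::real^'n). x $ i * b x :: real)"
  define C where "C = f ` (UNIV \<times> B)"
  have "\<exists>c. p = (\<lambda>x. \<Sum>b\<in>C. c b * b x)" if "p \<in> hpoly (Suc n)" for p
  proof -
    from that obtain a where a: "p = (\<lambda>x. \<Sum>i\<in>UNIV. x $ i * a i x)" "\<And>i. a i \<in> hpoly n"
      by (auto simp: hpoly_Suc_iff)
    obtain c where c: "\<And>i. a i = (\<lambda>x. \<Sum>b\<in>B. c i b * b x)" using Bc[OF a(2)] by metis
    \<comment> \<open>Different pairs may give the same product, so coefficients are collected over fibres.\<close>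
    define d where "d g = (\<Sum>(i, b)\<in>{s \<in> UNIV \<times> B. f s = g}. c i b)" for g
    have "p x = (\<Sum>g\<in>C. d g * g x)" for x
    proof -
      have "p x = (\<Sum>(i,b)\<in>UNIV \<times> B. c i b * f (i, b) x)"
        by (simp add: a c f_def sum.cartesian_product[symmetric] sum_distrib_left algebra_simps)
      also have "\<dots> = (\<Sum>g\<in>C. \<Sum>(i,b)\<in>{s \<in> UNIV \<times> B. f s = g}. c i b * f (i, b) x)"
        unfolding C_def using B(1) by (subst sum.image_gen[of _ _ f]) (auto)
      also have "\<dots> = (\<Sum>g\<in>C. d g * g x)"
        by (intro sum.cong refl) (auto simp: d_def sum_distrib_right intro!: sum.cong)
      finally show ?thesis .
    qed
    then show ?thesis by (intro exI[of _ d]) auto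
  qed
  moreover have "finite C" using B(1) by (simp add: C_def)
  moreover have "C \<subseteq> hpoly (Suc n)" using B(2) by (auto simp: C_def f_def intro: hpoly_coord_mult)
  ultimately show ?case by (intro exI[of _ C] conjI ballI)
qed

section \<open>Polar coordinates\<close>

lemma sphere_area_pos: "\<omega> CARD('n::finite) > 0"
  by (simp add: sphere_area_def Gamma_real_pos)

lemma finite_measure_sphere: "finite_measure (\<sigma> :: (real^'n) measure)"
  by (rule finite_measureI) (simp add: emeasure_sphere_measure_total)

interpretation sphere: finite_measure \<sigma>
  by (rule finite_measure_sphere)

lemma measure_sphere: "measure (\<sigma> :: (real^'n) measure) (sphere 0 1) = \<omega> CARD('n)"
  using sphere_area_pos[where 'n='n] by (simp add: measure_def emeasure_sphere_measure_total)

lemma sgn_borel: "(sgn :: real^'n \<Rightarrow> real^'n) \<in> borel_measurable borel"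
  unfolding sgn_div_norm by measurable

lemma sgn_punctured_measurable:
  "sgn \<in> restrict_space lborel (-{0}) \<rightarrow>\<^sub>M (\<sigma> :: (real^'n) measure)"
proof -
  have "sgn \<in> restrict_space lborel (-{0}) \<rightarrow>\<^sub>M restrict_space borel (sphere (0::real^'n) 1)"
    using sgn_borel by (intro measurable_restrict_space3) (auto simp: norm_sgn)
  then show ?thesis unfolding measurable_cong_sets[OF refl sets_sphere_measure] .
qed

text \<open>Scaling by \<open>r\<close> reduces the claim to the unit ball, where it is the definition of \<open>\<sigma>\<close>.\<close>

lemma sphere_cone_emeasure:
  assumes B: "B \<in> sets (\<sigma> :: (real^'n) measure)" and r: "r > 0"
  shows "emeasure lborel {x. x \<noteq> 0 \<and> norm x < r \<and> sgn x \<in> B}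
     = ennreal (r ^ CARD('n) / real CARD('n)) * emeasure \<sigma> B"
proof -
  let ?C = "\<lambda>r. {x::real^'n. x \<noteq> 0 \<and> norm x < r \<and> sgn x \<in> B}"
  have B': "B \<in> sets borel" using B by (auto simp: sets_restrict_space_iff)
  have m: "?C r \<in> sets borel" for r
  proof -
    have "?C r = (-{0}) \<inter> {x. norm x < r} \<inter> sgn -` B" by auto
    moreover have "sgn -` B \<in> sets borel"
      using measurable_sets[OF sgn_borel B'] by simp
    moreover have "{x::real^'n. norm x < r} \<in> sets borel" by measurable
    ultimately show ?thesis by auto
  qed
  have "emeasure lborel (?C r) = emeasure (density (distr lborel borel (\<lambda>x. 0 + r *\<^sub>R x)) (\<lambda>_. \<bar>r\<bar>^DIM(real^'n))) (?C r)"
    using lborel_affine[of r "0::real^'n"] r by simp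
  also have "\<dots> = ennreal (r ^ CARD('n)) * emeasure lborel ((\<lambda>x. r *\<^sub>R x) -` ?C r)"
    using m r by (subst emeasure_density_const) (auto simp: emeasure_distr)
  also have "(\<lambda>x. r *\<^sub>R x) -` ?C r = ?C 1"
    using r by (auto simp: sgn_scaleR)
  finally have 1: "emeasure lborel (?C r) = ennreal (r ^ CARD('n)) * emeasure lborel (?C 1)" .
  have "?C 1 = {x \<in> ball 0 1 - {0}. sgn x \<in> B}" by auto
  then have "emeasure \<sigma> B = of_nat CARD('n) * emeasure lborel (?C 1)"
    using emeasure_sphere_measure[OF B] by simp
  then have "ennreal (1 / real CARD('n)) * emeasure \<sigma> B
      = (ennreal (1 / real CARD('n)) * of_nat CARD('n)) * emeasure lborel (?C 1)"
    by (simp add: mult.assoc)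
  also have "ennreal (1 / real CARD('n)) * of_nat CARD('n) = 1"
    by (simp add: ennreal_of_nat_eq_real_of_nat ennreal_mult[symmetric])
  finally have 2: "emeasure lborel (?C 1) = ennreal (1 / real CARD('n)) * emeasure \<sigma> B" by simp
  show ?thesis unfolding 1 2 using r
    by (simp add: mult.assoc[symmetric] ennreal_mult[symmetric])
qed

definition radial_measure :: "'n::finite itself \<Rightarrow> real measure" where
  "radial_measure _ = density lborel (\<lambda>r. ennreal (indicator {0<..} r * r ^ (CARD('n) - 1)))"

lemma sets_radial_measure [simp, measurable_cong]: "sets (radial_measure x) = sets borel"
  by (simp add: radial_measure_def)

lemma emeasure_radial_measure:
  "emeasure (radial_measure TYPE('n::finite)) {..<r} = ennreal ((max r 0) ^ CARD('n) / real CARD('n))"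
proof -
  have "emeasure (radial_measure TYPE('n)) {..<r} =
     (\<integral>\<^sup>+x. ennreal (indicator {0<..} x * x ^ (CARD('n) - 1)) * indicator {..<r} x \<partial>lborel)"
    unfolding radial_measure_def by (rule emeasure_density) auto
  also have "\<dots> = (\<integral>\<^sup>+x. ennreal (x ^ (CARD('n) - 1)) * indicator {0..max r 0} x \<partial>lborel)"
  proof (rule nn_integral_cong_AE)
    have "AE x in lborel. x \<notin> {0, r, max r 0}" by (rule AE_not_in) (intro finite_imp_null_set_lborel, auto)
    then show "AE x in lborel. ennreal (indicator {0<..} x * x ^ (CARD('n) - 1)) * indicator {..<r} x
      = ennreal (x ^ (CARD('n) - 1)) * indicator {0..max r 0} x"
      by eventually_elim (auto simp: indicator_def)
  qed
  also have "\<dots> = ennreal ((max r 0) ^ CARD('n) / real CARD('n) - 0 ^ CARD('n) / real CARD('n))"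
  proof (rule nn_integral_FTC_Icc)
    fix x :: real
    show "((\<lambda>x. x ^ CARD('n) / real CARD('n)) has_real_derivative x ^ (CARD('n) - 1)) (at x)"
      by (auto intro!: derivative_eq_intros)
  qed auto
  also have "(0::real) ^ CARD('n) = 0" by (simp add: power_0_left)
  finally show ?thesis by simp
qed

lemma sigma_finite_radial_measure: "sigma_finite_measure (radial_measure TYPE('n::finite))"
proof
  show "\<exists>A. countable A \<and> A \<subseteq> sets (radial_measure TYPE('n)) \<and> \<Union> A = space (radial_measure TYPE('n)) \<and>
     (\<forall>a\<in>A. emeasure (radial_measure TYPE('n)) a \<noteq> \<infinity>)"
  proof (intro exI[of _ "range (\<lambda>i::nat. {..<real i})"] conjI)
    show "\<Union> (range (\<lambda>i::nat. {..<real i})) = space (radial_measure TYPE('n))"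
      by (auto simp: radial_measure_def reals_Archimedean2)
    show "\<forall>a\<in>range (\<lambda>i::nat. {..<real i}). emeasure (radial_measure TYPE('n)) a \<noteq> \<infinity>"
      by (simp add: emeasure_radial_measure)
  qed auto
qed

text \<open>For a fixed set of directions both sides are measures of the radius. They agree on initial segments by the preceding
  lemma, hence on all Borel sets.\<close>

lemma polar_measure:
  "radial_measure TYPE('n) \<Otimes>\<^sub>M (\<sigma> :: (real^'n) measure) =
     distr (restrict_space lborel (-{0})) (borel \<Otimes>\<^sub>M \<sigma>) (\<lambda>x. (norm x, sgn x))" (is "_ = ?M")
proof (rule pair_measure_eqI)
  show "sigma_finite_measure (radial_measure TYPE('n))" by (rule sigma_finite_radial_measure)
  show "sigma_finite_measure (\<sigma> :: (real^'n) measure)" by unfold_locales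
  show "sets (radial_measure TYPE('n) \<Otimes>\<^sub>M (\<sigma> :: (real^'n) measure)) = sets ?M"
    unfolding sets_distr by (rule sets_pair_measure_cong) auto
  fix A B assume A: "A \<in> sets (radial_measure TYPE('n))" and B: "B \<in> sets (\<sigma> :: (real^'n) measure)"
  have B': "B \<in> sets borel" "B \<subseteq> sphere 0 1" using B by (auto simp: sets_restrict_space_iff)
  let ?R = "restrict_space lborel (-{0::real^'n})"
  note [measurable] = sgn_punctured_measurable
  have nm [measurable]: "norm \<in> ?R \<rightarrow>\<^sub>M borel"
    by (intro measurable_restrict_space1) auto
  define S where "S = {x::real^'n. x \<noteq> 0 \<and> sgn x \<in> B}"
  have S: "S \<in> sets borel"
  proof -
    have "S = (-{0}) \<inter> sgn -` B" by (auto simp: S_def)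
    then show ?thesis using measurable_sets[OF sgn_borel B'(1)] by auto
  qed
  define N1 where "N1 = scale_measure (emeasure \<sigma> B) (radial_measure TYPE('n))"
  define N2 where "N2 = distr (restrict_space lborel S) borel norm"
  have N2: "emeasure N2 X = emeasure lborel {x. x \<noteq> 0 \<and> norm x \<in> X \<and> sgn x \<in> B}"
    if "X \<in> sets borel" for X
  proof -
    have "emeasure N2 X = emeasure (restrict_space lborel S) (norm -` X \<inter> S)"
      unfolding N2_def using that S
      by (subst emeasure_distr) (auto simp: space_restrict_space intro!: measurable_restrict_space1)
    also have "\<dots> = emeasure lborel (norm -` X \<inter> S)"
      using S by (intro emeasure_restrict_space) auto
    also have "norm -` X \<inter> S = {x. x \<noteq> 0 \<and> norm x \<in> X \<and> sgn x \<in> B}" by (auto simp: S_def)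
    finally show ?thesis .
  qed
  have "N1 = N2"
  proof (rule measure_eqI_generator_eq[where \<Omega> = UNIV and E = "range lessThan" and A = "\<lambda>i. {..<real i}"])
    show "Int_stable (range (lessThan :: real \<Rightarrow> _))"
    proof (rule Int_stableI_image)
      fix i j :: real show "\<exists>k\<in>UNIV. {..<i} \<inter> {..<j} = {..<k}" by (intro bexI[of _ "min i j"]) auto
    qed
    show "emeasure N1 X = emeasure N2 X" if X: "X \<in> range lessThan" for X
    proof -
      from X obtain r where r: "X = {..<r}" by auto
      show ?thesis
      proof (cases "r > 0")
        case True
        then show ?thesis using sphere_cone_emeasure[OF B True]
          by (simp add: N1_def r N2 emeasure_radial_measure mult.commute)
      next
        case False
        have "{x. x \<noteq> 0 \<and> norm x \<in> X \<and> sgn x \<in> B} = {}"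
          using False le_less_trans[OF norm_ge_zero] by (auto simp: r)
        then have "emeasure N2 X = 0" using N2[of X] by (simp only: emeasure_empty) (simp add: r)
        moreover have "emeasure N1 X = 0"
          using False by (simp add: N1_def r emeasure_radial_measure power_0_left)
        ultimately show ?thesis by simp
      qed
    qed
    show "sets N1 = sigma_sets UNIV (range lessThan)" "sets N2 = sigma_sets UNIV (range lessThan)"
      by (simp_all add: N1_def N2_def borel_Iio)
    show "(\<Union>i. {..<real i}) = UNIV" using reals_Archimedean2 by auto
    show "emeasure N1 {..<real i} \<noteq> \<infinity>" for i
      by (simp add: N1_def emeasure_radial_measure ennreal_mult_eq_top_iff)
  qed auto
  moreover have "emeasure N1 A = emeasure \<sigma> B * emeasure (radial_measure TYPE('n)) A"
    unfolding N1_def by (rule emeasure_scale_measure)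
  moreover have "emeasure N2 A = emeasure lborel {x. x \<noteq> 0 \<and> norm x \<in> A \<and> sgn x \<in> B}"
    by (rule N2) (use A in simp)
  moreover have "emeasure lborel {x. x \<noteq> 0 \<and> norm x \<in> A \<and> sgn x \<in> B}
     = emeasure ?R {x. x \<noteq> 0 \<and> norm x \<in> A \<and> sgn x \<in> B}"
    by (rule emeasure_restrict_space[symmetric]) auto
  moreover have "\<dots> = emeasure ?M (A \<times> B)"
  proof -
    have nsm: "(\<lambda>x. (norm x, sgn x)) \<in> ?R \<rightarrow>\<^sub>M borel \<Otimes>\<^sub>M \<sigma>" by measurable
    have "A \<times> B \<in> sets (borel \<Otimes>\<^sub>M \<sigma>)" using A B by (intro pair_measureI) simp_all
    then have "emeasure ?M (A \<times> B) = emeasure ?R ((\<lambda>x. (norm x, sgn x)) -` (A \<times> B) \<inter> space ?R)"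
      by (rule emeasure_distr[OF nsm])
    also have "(\<lambda>x. (norm x, sgn x)) -` (A \<times> B) \<inter> space ?R = {x. x \<noteq> 0 \<and> norm x \<in> A \<and> sgn x \<in> B}"
      by (auto simp: space_restrict_space)
    finally show ?thesis by (rule sym)
  qed
  ultimately show "emeasure (radial_measure TYPE('n)) A * emeasure \<sigma> B = emeasure ?M (A \<times> B)"
    by (simp only: mult.commute[of "emeasure \<sigma> B"])
qed

lemma
  fixes u :: "real^'n \<Rightarrow> real"
  assumes \<alpha>: "\<alpha> \<in> borel_measurable borel" "\<alpha> 0 = 0"
    and \<alpha>i: "integrable lborel (\<lambda>r. indicator {0<..} r * r ^ (CARD('n) - 1) * \<alpha> r)"
    and u: "integrable \<sigma> u"
  shows polar_integrable: "integrable lborel (\<lambda>x. \<alpha> (norm x) * u (sgn x))"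
    and polar_integral: "(LINT x|lborel. \<alpha> (norm x) * u (sgn x)) =
      (LINT r|lborel. indicator {0<..} r * r ^ (CARD('n) - 1) * \<alpha> r) * (LINT x|\<sigma>. u x)"
proof -
  let ?R = "restrict_space lborel (-{0::real^'n})"
  let ?M1 = "radial_measure TYPE('n)"
  let ?M = "distr ?R (borel \<Otimes>\<^sub>M \<sigma>) (\<lambda>x. (norm x, sgn x))"
  note [measurable] = sgn_punctured_measurable \<alpha>(1) borel_measurable_integrable[OF u]
  have nm [measurable]: "norm \<in> ?R \<rightarrow>\<^sub>M borel"
    by (intro measurable_restrict_space1) auto
  interpret r: sigma_finite_measure ?M1 by (rule sigma_finite_radial_measure)
  interpret P: pair_sigma_finite ?M1 "\<sigma> :: (real^'n) measure" ..
  have a1: "integrable ?M1 \<alpha>"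
    unfolding radial_measure_def using \<alpha>i
    by (subst integrable_density) (auto simp: mult.assoc indicator_def)
  have a2: "(LINT r|?M1. \<alpha> r) = (LINT r|lborel. indicator {0<..} r * r ^ (CARD('n) - 1) * \<alpha> r)"
    unfolding radial_measure_def by (subst integral_density) (auto simp: mult.assoc indicator_def)
  define F where "F = (\<lambda>(r, s). \<alpha> r * u s)"
  have Fm: "F \<in> borel_measurable (?M1 \<Otimes>\<^sub>M \<sigma>)" unfolding F_def by measurable
  then have Fm': "F \<in> borel_measurable (borel \<Otimes>\<^sub>M \<sigma>)" 
    unfolding measurable_cong_sets[OF sets_pair_measure_cong[OF sets_radial_measure refl] refl] .
  have Fi: "integrable (?M1 \<Otimes>\<^sub>M \<sigma>) F"
  proof (rule P.Fubini_integrable[OF Fm])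
    show "integrable ?M1 (\<lambda>x. LINT y|\<sigma>. norm (F (x, y)))"
      using a1 by (simp add: F_def abs_mult)
    show "AE x in ?M1. integrable \<sigma> (\<lambda>y. F (x, y))"
      using u by (simp add: F_def)
  qed
  have nsm: "(\<lambda>x. (norm x, sgn x)) \<in> ?R \<rightarrow>\<^sub>M borel \<Otimes>\<^sub>M \<sigma>" by measurable
  have "integrable ?R (\<lambda>x. F (norm x, sgn x))"
    using Fi unfolding polar_measure by (subst (asm) integrable_distr_eq[OF nsm Fm']) 
  then have "integrable lborel (\<lambda>x. indicator (-{0}) x *\<^sub>R F (norm x, sgn x))"
    by (subst (asm) integrable_restrict_space) auto
  moreover have eq: "indicator (-{0}) x *\<^sub>R F (norm x, sgn x) = \<alpha> (norm x) * u (sgn x)" for x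
    using \<alpha>(2) by (auto simp: F_def indicator_def)
  ultimately show "integrable lborel (\<lambda>x. \<alpha> (norm x) * u (sgn x))" by simp
  have "(LINT x|lborel. \<alpha> (norm x) * u (sgn x)) = (LINT x|?R. F (norm x, sgn x))"
    by (subst integral_restrict_space) (simp, simp only: eq)
  also have "\<dots> = integral\<^sup>L (?M1 \<Otimes>\<^sub>M \<sigma>) F"
    unfolding polar_measure by (rule integral_distr[OF nsm Fm', symmetric])
  also have "\<dots> = (LINT r|?M1. LINT s|\<sigma>. F (r, s))"
    using P.integral_fst'[OF Fi] by simp
  also have "\<dots> = (LINT r|?M1. \<alpha> r) * (LINT s|\<sigma>. u s)"
    by (simp add: F_def)
  finally show "(LINT x|lborel. \<alpha> (norm x) * u (sgn x)) =
      (LINT r|lborel. indicator {0<..} r * r ^ (CARD('n) - 1) * \<alpha> r) * (LINT x|\<sigma>. u x)"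
    by (simp add: a2)
qed

section \<open>Completeness of the polynomials\<close>

lemma continuous_sphere_measurable:
  fixes u :: "real^'n \<Rightarrow> 'b::topological_space"
  assumes "continuous_on (sphere 0 1) u"
  shows "u \<in> borel_measurable \<sigma>"
  using borel_measurable_continuous_on_restrict[OF assms]
  unfolding measurable_cong_sets[OF sets_sphere_measure refl] .

lemma continuous_sphere_bounded:
  fixes u :: "real^'n \<Rightarrow> 'b::real_normed_vector"
  assumes "continuous_on (sphere 0 1) u"
  shows "\<exists>B. \<forall>x\<in>sphere 0 1. norm (u x) \<le> B"
  using compact_imp_bounded[OF compact_continuous_image[OF assms compact_sphere]]
  unfolding bounded_iff by auto

lemma continuous_sphere_integrable:
  fixes u :: "real^'n \<Rightarrow> 'b::{banach, second_countable_topology}"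
  assumes "continuous_on (sphere 0 1) u"
  shows "integrable \<sigma> u"
proof -
  obtain B where "\<forall>x\<in>sphere 0 1. norm (u x) \<le> B"
    using continuous_sphere_bounded[OF assms] by blast
  then show ?thesis
    by (intro sphere.integrable_const_bound[of _ B] continuous_sphere_measurable assms) auto
qed

lemma integrable_mult_continuous_sphere:
  fixes u c :: "real^'n \<Rightarrow> real"
  assumes "integrable \<sigma> u" "continuous_on (sphere 0 1) c"
  shows "integrable \<sigma> (\<lambda>x. c x * u x)"
proof -
  obtain B where B: "\<forall>x\<in>sphere 0 1. norm (c x) \<le> B"
    using continuous_sphere_bounded[OF assms(2)] by blast
  note [measurable] = continuous_sphere_measurable[OF assms(2)] borel_measurable_integrable[OF assms(1)]
  show ?thesis
  proof (rule Bochner_Integration.integrable_bound[where f = "\<lambda>x. B * u x"])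
    show "AE x in \<sigma>. norm (c x * u x) \<le> norm (B * u x)"
    proof (rule AE_I2)
      fix x :: "real^'n" assume "x \<in> space \<sigma>"
      with B have "\<bar>c x\<bar> \<le> B" by auto
      then have "\<bar>c x\<bar> \<le> \<bar>B\<bar>" by linarith
      then show "norm (c x * u x) \<le> norm (B * u x)" by (simp add: abs_mult mult_right_mono)
    qed
  qed (use assms in auto)
qed

text \<open>By Stone--Weierstrass \<open>u\<close> is orthogonal to all continuous functions. Indicators of closed sets are bounded limits of
  continuous functions, and closed sets generate the Borel sets, so \<open>u\<close> integrates to \<open>0\<close> over every Borel set.\<close>

lemma polynomials_complete:
  fixes u :: "real^'n \<Rightarrow> real"
  assumes u: "integrable \<sigma> u"
    and orth: "\<And>p. real_polynomial_function p \<Longrightarrow> (LINT x|\<sigma>. p x * u x) = 0"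
  shows "AE x in \<sigma>. u x = 0"
proof -
  note [measurable] = borel_measurable_integrable[OF u]
  have cont: "(LINT x|\<sigma>. c x * u x) = 0" if c: "continuous_on (sphere 0 1) c" for c
  proof -
    define K where "K = (LINT x|\<sigma>. \<bar>u x\<bar>)"
    have K: "K \<ge> 0" by (simp add: K_def)
    have cu: "integrable \<sigma> (\<lambda>x. c x * u x)" by (rule integrable_mult_continuous_sphere[OF u c])
    have eK: "\<bar>LINT x|\<sigma>. c x * u x\<bar> \<le> e * K" if e: "e > 0" for e
    proof -
      obtain p where p: "real_polynomial_function p" "\<And>x. x \<in> sphere 0 1 \<Longrightarrow> \<bar>c x - p x\<bar> < e"
        using Stone_Weierstrass_real_polynomial_function[OF compact_sphere c e] by metis
      have pu: "integrable \<sigma> (\<lambda>x. p x * u x)"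
        by (intro integrable_mult_continuous_sphere[OF u] continuous_on_polymonial_function)
           (simp add: p(1) polynomial_function_iff_Basis_inner)
      have "(LINT x|\<sigma>. c x * u x) = (LINT x|\<sigma>. (c x - p x) * u x)"
        using orth[OF p(1)] cu pu by (simp add: left_diff_distrib)
      also have "\<bar>\<dots>\<bar> \<le> (LINT x|\<sigma>. \<bar>(c x - p x) * u x\<bar>)"
        by (rule integral_abs_bound)
      also have "\<dots> \<le> (LINT x|\<sigma>. e * \<bar>u x\<bar>)"
      proof (rule integral_mono)
        show "integrable \<sigma> (\<lambda>x. \<bar>(c x - p x) * u x\<bar>)"
          using cu pu by (auto simp: left_diff_distrib)
        show "\<bar>(c x - p x) * u x\<bar> \<le> e * \<bar>u x\<bar>" if "x \<in> space \<sigma>" for x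
          using p(2)[of x] that by (auto simp: abs_mult intro!: mult_right_mono)
      qed (use u in auto)
      finally show ?thesis by (simp add: K_def)
    qed
    then have "\<bar>LINT x|\<sigma>. c x * u x\<bar> \<le> 0 + e" if "e > 0" for e
    proof -
      have "\<bar>LINT x|\<sigma>. c x * u x\<bar> \<le> (e / (K + 1)) * K"
        by (rule eK) (use that K in simp)
      also have "\<dots> \<le> e" using that K by (simp add: field_simps)
      finally show ?thesis by simp
    qed
    then have "\<bar>LINT x|\<sigma>. c x * u x\<bar> \<le> 0" by (rule field_le_epsilon)
    then show ?thesis by simp
  qed
  have closed: "(LINT x|\<sigma>. indicator C x * u x) = 0" if C: "closed C" for C
  proof (cases "C = {}")
    case False
    let ?c = "\<lambda>k x. max 0 (1 - real k * infdist x C)"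
    have "(\<lambda>k. LINT x|\<sigma>. ?c k x * u x) \<longlonglongrightarrow> (LINT x|\<sigma>. indicator C x * u x)"
    proof (rule integral_dominated_convergence[where w = "\<lambda>x. \<bar>u x\<bar>"])
      show "(\<lambda>x. indicator C x * u x) \<in> borel_measurable \<sigma>"
      proof -
        have "(indicator C :: _ \<Rightarrow> real) \<in> borel_measurable borel" using C by auto
        then have "(indicator C :: _ \<Rightarrow> real) \<in> borel_measurable (restrict_space borel (sphere 0 1))"
          by (rule measurable_restrict_space1)
        then have "(indicator C :: _ \<Rightarrow> real) \<in> borel_measurable \<sigma>" unfolding measurable_cong_sets[OF sets_sphere_measure refl] .
        then show ?thesis by measurable
      qed
      show "(\<lambda>x. ?c k x * u x) \<in> borel_measurable \<sigma>" for k
      proof -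
        have "?c k \<in> borel_measurable \<sigma>"
          by (intro continuous_sphere_measurable continuous_intros)
        then show ?thesis by measurable
      qed
      show "AE x in \<sigma>. norm (?c k x * u x) \<le> \<bar>u x\<bar>" for k
        by (rule AE_I2) (auto simp: abs_mult infdist_nonneg intro!: mult_left_le_one_le)
      have "(\<lambda>k. ?c k x * u x) \<longlonglongrightarrow> indicator C x * u x" for x
      proof (cases "x \<in> C")
        case True
        then show ?thesis by simp
      next
        case nx: False
        then have d: "infdist x C > 0"
          using infdist_pos_not_in_closed[OF C False] by simp
        obtain N where N: "real N * infdist x C > 1"
          using reals_Archimedean3[OF d] by blast
        have "eventually (\<lambda>k. ?c k x * u x = indicator C x * u x) sequentially"
          using eventually_ge_at_top[of N]
        proof eventually_elim
          case (elim k)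
          then have "real N * infdist x C \<le> real k * infdist x C"
            using d by (intro mult_right_mono) auto
          with N have "1 - real k * infdist x C \<le> 0" by linarith
          then show ?case using nx by simp
        qed
        then show ?thesis by (rule tendsto_eventually)
      qed
      then show "AE x in \<sigma>. (\<lambda>k. ?c k x * u x) \<longlonglongrightarrow> indicator C x * u x" by simp
    qed (use u in auto)
    moreover have "(LINT x|\<sigma>. ?c k x * u x) = 0" for k
      by (intro cont continuous_intros)
    ultimately show ?thesis using LIMSEQ_unique[OF _ tendsto_const] by force
  qed simp
  have ind [measurable]: "(indicator A :: _ \<Rightarrow> real) \<in> borel_measurable (\<sigma> :: (real^'n) measure)"
    if "A \<in> sets borel" for A
    using measurable_restrict_space1[OF borel_measurable_indicator[OF that]]
    unfolding measurable_cong_sets[OF sets_sphere_measure refl] .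
  have iu: "integrable \<sigma> (\<lambda>x. indicator A x * u x)" if "A \<in> sets borel" for A
  proof (rule Bochner_Integration.integrable_bound[OF u])
    show "(\<lambda>x. indicator A x * u x) \<in> borel_measurable \<sigma>"
      using ind[OF that] borel_measurable_integrable[OF u] by (rule borel_measurable_times)
  qed (auto simp: indicator_def)
  have borel: "(LINT x|\<sigma>. indicator A x * u x) = 0" if "A \<in> sets borel" for A
  proof -
    have "Int_stable (Collect (closed :: (real^'n) set \<Rightarrow> bool))"
      by (auto simp: Int_stable_def)
    moreover have "Collect (closed :: (real^'n) set \<Rightarrow> bool) \<subseteq> Pow UNIV" by simp
    moreover have "A \<in> sigma_sets UNIV (Collect closed)"
      using that by (simp add: borel_eq_closed)
    ultimately show ?thesis
    proof (induction A rule: sigma_sets_induct_disjoint)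
      fix A :: "(real^'n) set" assume A: "A \<in> Collect closed"
      then show "(LINT x|\<sigma>. indicator A x * u x) = 0" using closed by simp
    next
      fix A :: "(real^'n) set" assume A: "A \<in> sigma_sets UNIV (Collect closed)" "(LINT x|\<sigma>. indicator A x * u x) = 0"
      have Ab: "A \<in> sets borel" using A(1) by (simp add: borel_eq_closed)
      have "(LINT x|\<sigma>. indicator (UNIV - A) x * u x) = (LINT x|\<sigma>. indicator UNIV x * u x - indicator A x * u x)"
        by (intro Bochner_Integration.integral_cong) (auto simp: indicator_def)
      also have "\<dots> = (LINT x|\<sigma>. indicator UNIV x * u x) - (LINT x|\<sigma>. indicator A x * u x)"
        by (intro Bochner_Integration.integral_diff iu Ab) auto
      finally show "(LINT x|\<sigma>. indicator (UNIV - A) x * u x) = 0" using A(2) closed[OF closed_UNIV] by simp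
    next
      fix A :: "nat \<Rightarrow> (real^'n) set"
      assume A: "disjoint_family A" "range A \<subseteq> sigma_sets UNIV (Collect closed)"
        "\<And>i. (LINT x|\<sigma>. indicator (A i) x * u x) = 0"
      have Ab: "A i \<in> sets borel" for i using A(2) by (auto simp: borel_eq_closed)
      let ?B = "\<lambda>k. \<Union>i<k. A i"
      have fin: "(LINT x|\<sigma>. indicator (?B k) x * u x) = 0" for k
      proof -
        have "indicator (?B k) x = (\<Sum>i<k. indicator (A i) x :: real)" for x
        proof (rule indicator_UN_disjoint)
          show "disjoint_family_on A {..<k}" using A(1) by (rule disjoint_family_on_mono[rotated]) auto
        qed auto
        then have "(LINT x|\<sigma>. indicator (?B k) x * u x) = (LINT x|\<sigma>. (\<Sum>i<k. indicator (A i) x * u x))"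
          by (simp add: sum_distrib_right)
        also have "\<dots> = (\<Sum>i<k. LINT x|\<sigma>. indicator (A i) x * u x)"
          by (intro Bochner_Integration.integral_sum iu Ab)
        finally show ?thesis using A(3) by simp
      qed
      have "(\<lambda>k. LINT x|\<sigma>. indicator (?B k) x * u x) \<longlonglongrightarrow> (LINT x|\<sigma>. indicator (\<Union>i. A i) x * u x)"
      proof (rule integral_dominated_convergence[where w = "\<lambda>x. \<bar>u x\<bar>"])
        show "AE x in \<sigma>. (\<lambda>k. indicator (?B k) x * u x) \<longlonglongrightarrow> indicator (\<Union>i. A i) x * u x"
          by (intro AE_I2 tendsto_mult tendsto_const LIMSEQ_indicator_UN)
        show "(\<lambda>x. indicator (\<Union>i. A i) x * u x) \<in> borel_measurable \<sigma>"
          using Ab by (intro borel_measurable_integrable iu) auto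
        show "(\<lambda>x. indicator (?B k) x * u x) \<in> borel_measurable \<sigma>" for k
          using Ab by (intro borel_measurable_integrable iu) auto
        show "AE x in \<sigma>. norm (indicator (?B k) x * u x) \<le> \<bar>u x\<bar>" for k
          by (rule AE_I2) (auto simp: indicator_def)
      qed (use u in auto)
      then show "(LINT x|\<sigma>. indicator (\<Union>i. A i) x * u x) = 0"
        using fin LIMSEQ_unique[OF _ tendsto_const] by force
    qed auto
  qed
  have pos: "AE x in \<sigma>. v x \<le> 0" if v: "integrable \<sigma> v"
    and z: "\<And>A. A \<in> sets borel \<Longrightarrow> (LINT x|\<sigma>. indicator A x * v x) = 0" for v :: "real^'n \<Rightarrow> real"
  proof -
    note [measurable] = borel_measurable_integrable[OF v]
    have "{x \<in> space \<sigma>. v x > 0} \<in> sets \<sigma>" by measurable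
    then have A: "{x \<in> sphere 0 1. v x > 0} \<in> sets borel"
      by (simp add: sets_restrict_space_iff)
    have eq: "indicator {x \<in> sphere 0 1. v x > 0} x * v x = max 0 (v x)" if "x \<in> space \<sigma>" for x
      using that by (auto simp: indicator_def)
    have "(LINT x|\<sigma>. max 0 (v x)) = 0"
      using z[OF A] by (subst Bochner_Integration.integral_cong[OF refl eq[symmetric]]) auto
    moreover have "integrable \<sigma> (\<lambda>x. max 0 (v x))" using v by simp
    ultimately have "AE x in \<sigma>. max 0 (v x) = 0"
      by (subst (asm) integral_nonneg_eq_0_iff_AE) auto
    then show ?thesis by eventually_elim auto
  qed
  have "AE x in \<sigma>. u x \<le> 0" by (rule pos[OF u borel])
  moreover have "AE x in \<sigma>. - u x \<le> 0"
    using u borel by (intro pos) auto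
  ultimately show ?thesis by eventually_elim auto
qed

section \<open>Weak gradients\<close>

lemma integrable_lborel_compact_support:
  fixes f :: "real^'n \<Rightarrow> real"
  assumes "continuous_on UNIV f" "compact K" "\<And>x. x \<notin> K \<Longrightarrow> f x = 0"
  shows "integrable lborel f"
proof -
  have "integrable lborel (\<lambda>x. indicator K x *\<^sub>R f x)"
    using assms(2) continuous_on_subset[OF assms(1)] by (intro borel_integrable_compact) auto
  also have "(\<lambda>x. indicator K x *\<^sub>R f x) = f"
    using assms(3) by (auto simp: indicator_def fun_eq_iff)
  finally show ?thesis .
qed

lemma continuous_extend_by_zero:
  fixes f :: "real^'n \<Rightarrow> 'b::real_normed_vector"
  assumes "continuous_on (-{0}) f" "compact K" "0 \<notin> K" "\<And>x. x \<notin> K \<Longrightarrow> f x = 0"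
  shows "continuous_on UNIV f"
proof -
  have "continuous_on (-K) f"
    using assms(4) by (subst continuous_on_cong[OF refl, of _ _ "\<lambda>_. 0"]) auto
  then have "continuous_on (-{0} \<union> -K) f"
    using assms compact_imp_closed by (intro continuous_on_open_Un) auto
  moreover have "-{0} \<union> -K = UNIV" using assms(3) by auto
  ultimately show ?thesis by simp
qed

lemma has_gradient_outside_support:
  fixes p :: "real^'n \<Rightarrow> real"
  assumes "has_gradient p D" "compact K" "\<And>x. x \<notin> K \<Longrightarrow> p x = 0" "x \<notin> K"
  shows "D x = 0"
proof -
  have "open (-K)" using compact_imp_closed[OF assms(2)] by auto
  moreover have "((\<lambda>_. 0) has_derivative (\<lambda>h. 0 \<bullet> h)) (at x)" by simp
  ultimately have "(p has_derivative (\<lambda>h. 0 \<bullet> h)) (at x)"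
    using has_derivative_transform_within_open[of "\<lambda>_. 0" "\<lambda>h. 0 \<bullet> h" x UNIV "-K" p] assms(3,4) by force
  from grad_eqI[OF this] have "grad p x = 0" .
  then show ?thesis using has_gradient_unique[OF assms(1)] by simp
qed

text \<open>The integral of \<open>p (x + t e\<^sub>i)\<close> does not depend on \<open>t\<close>; differentiate under the integral sign at \<open>t = 0\<close>.\<close>

lemma integral_gradient_compact_support:
  fixes p :: "real^'n \<Rightarrow> real"
  assumes p: "has_gradient p D" and K: "compact K" "\<And>x. x \<notin> K \<Longrightarrow> p x = 0"
  shows "(LINT x|lborel. D x $ i) = 0"
proof -
  let ?e = "axis i 1 :: real^'n"
  have Dc: "continuous_on UNIV D" and pd: "\<And>x. (p has_derivative (\<lambda>h. D x \<bullet> h)) (at x)"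
    using p by (auto simp: has_gradient_def)
  have pc: "continuous_on UNIV p" using has_gradient_continuous[OF p] .
  have D0: "D x = 0" if "x \<notin> K" for x
    using has_gradient_outside_support[OF p K that] .
  obtain R where R: "\<And>x. x \<in> K \<Longrightarrow> norm x \<le> R"
    using compact_imp_bounded[OF K(1)] unfolding bounded_iff by auto
  obtain a where a: "cball (0::real^'n) (R + 1) \<subseteq> cbox (-a) a"
    using bounded_subset_cbox_symmetric[OF bounded_cball] by metis
  have box: "x \<in> cbox (-a) a" if "x + t *\<^sub>R ?e \<in> K" "\<bar>t\<bar> < 1" for x t
  proof -
    have "norm x \<le> norm (x + t *\<^sub>R ?e) + norm (t *\<^sub>R ?e)"
      using norm_triangle_ineq4[of "x + t *\<^sub>R ?e" "t *\<^sub>R ?e"] by simp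
    with R[OF that(1)] that(2) have "norm x \<le> R + 1" by simp
    with a show ?thesis by auto
  qed
  have eq: "integral (cbox (-a) a) f = (LINT x|lborel. f x)"
    if "continuous_on UNIV f" "\<And>x. x \<notin> cbox (-a) a \<Longrightarrow> f x = 0" for f :: "real^'n \<Rightarrow> real"
  proof -
    have "set_integrable lborel (cbox (-a) a) f"
      unfolding set_integrable_def using that(1)
      by (intro borel_integrable_compact compact_cbox) (auto intro: continuous_on_subset)
    from set_borel_integral_eq_integral(2)[OF this]
    have "integral (cbox (-a) a) f = (LINT x|lborel. indicator (cbox (-a) a) x *\<^sub>R f x)"
      by (simp add: set_lebesgue_integral_def)
    also have "(\<lambda>x. indicator (cbox (-a) a) x *\<^sub>R f x) = f"
      using that(2) by (auto simp: indicator_def fun_eq_iff)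
    finally show ?thesis .
  qed
  let ?U = "{-1<..<1::real}"
  let ?F = "\<lambda>t. integral (cbox (-a) a) (\<lambda>x. p (x + t *\<^sub>R ?e))"
  have "(?F has_field_derivative integral (cbox (-a) a) (\<lambda>x. D (x + 0 *\<^sub>R ?e) \<bullet> ?e)) (at 0 within ?U)"
  proof (rule leibniz_rule_field_derivative)
    fix t :: real and x :: "real^'n"
    have "((\<lambda>t. p (x + t *\<^sub>R ?e)) has_derivative (\<lambda>s. D (x + t *\<^sub>R ?e) \<bullet> (s *\<^sub>R ?e))) (at t)"
      by (rule has_derivative_compose[OF _ pd]) (auto intro!: derivative_eq_intros)
    then show "((\<lambda>t. p (x + t *\<^sub>R ?e)) has_field_derivative D (x + t *\<^sub>R ?e) \<bullet> ?e) (at t within ?U)"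
      by (auto simp: has_field_derivative_def mult.commute[of _ "_ \<bullet> _"] intro: has_derivative_at_withinI)
    show "(\<lambda>x. p (x + t *\<^sub>R ?e)) integrable_on cbox (-a) a"
      by (intro integrable_continuous continuous_on_compose2[OF pc] continuous_intros) auto
  next
    show "continuous_on (?U \<times> cbox (-a) a) (\<lambda>(t, x). D (x + t *\<^sub>R ?e) \<bullet> ?e)"
      unfolding split_beta
      by (intro continuous_intros continuous_on_compose2[OF Dc]) auto
  qed auto
  moreover have Fconst: "?F t = (LINT x|lborel. p x)" if "t \<in> ?U" for t
  proof -
    have "?F t = (LINT x|lborel. p (x + t *\<^sub>R ?e))"
      using box[of _ t] that K(2)
      by (intro eq continuous_on_compose2[OF pc] continuous_intros) (auto simp: abs_less_iff)
    also have "\<dots> = (LINT x|distr lborel borel ((+) (t *\<^sub>R ?e)). p x)"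
      using borel_measurable_continuous_onI[OF pc]
      by (subst integral_distr) (auto simp: add.commute)
    finally show ?thesis by (simp add: lborel_distr_plus)
  qed
  have "(?F has_field_derivative 0) (at 0)"
  proof (rule has_field_derivative_transform_within_open[OF DERIV_const])
    show "open ?U" "0 \<in> ?U" by auto
  qed (rule Fconst[symmetric])
  moreover have "at 0 within ?U = at (0::real)" by (rule at_within_open) auto
  ultimately have "integral (cbox (-a) a) (\<lambda>x. D (x + 0 *\<^sub>R ?e) \<bullet> ?e) = 0"
    by (metis DERIV_unique)
  then have "integral (cbox (-a) a) (\<lambda>x. D x \<bullet> ?e) = 0" by simp
  moreover have "integral (cbox (-a) a) (\<lambda>x. D x \<bullet> ?e) = (LINT x|lborel. D x \<bullet> ?e)"
  proof (rule eq)
    show "continuous_on UNIV (\<lambda>x. D x \<bullet> ?e)" by (intro continuous_intros Dc)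
    show "D x \<bullet> ?e = 0" if "x \<notin> cbox (-a) a" for x
      using box[of x 0] D0[of x] that by (cases "x \<in> K") auto
  qed
  ultimately show ?thesis by (simp add: inner_axis)
qed

text \<open>The defining property of \<open>is_tangential_gradient\<close>, for real-valued functions: \<open>u (sgn x)\<close> is the extension of \<open>u\<close>
  of degree \<open>0\<close>, whose gradient is \<open>g (sgn x) / norm x\<close>.\<close>

definition weak_gradient :: "(real^'n \<Rightarrow> real) \<Rightarrow> (real^'n \<Rightarrow> real^'n) \<Rightarrow> bool" where
  "weak_gradient u g \<longleftrightarrow>
     (\<forall>\<phi> D. has_gradient \<phi> D \<longrightarrow> (\<exists>K. compact K \<and> 0 \<notin> K \<and> (\<forall>x. x \<notin> K \<longrightarrow> \<phi> x = 0)) \<longrightarrow>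
        (\<forall>i. (LINT x|lborel. D x $ i * u (sgn x)) = - (LINT x|lborel. \<phi> x / norm x * g (sgn x) $ i)))"

text \<open>For \<open>x\<close> on the unit sphere, the orthogonal projection onto the tangent space at \<open>x\<close>.\<close>

definition tangential :: "real^'n \<Rightarrow> real^'n \<Rightarrow> real^'n" where
  "tangential x v = v - (v \<bullet> x) *\<^sub>R x"

lemma tangential_inner: "tangential x v \<bullet> w = v \<bullet> w - (v \<bullet> x) * (x \<bullet> w)"
  by (simp add: tangential_def inner_diff_left)

lemma continuous_on_sgn_punctured: "continuous_on (-{0}) (sgn :: real^'n \<Rightarrow> real^'n)"
  unfolding sgn_div_norm by (intro continuous_intros) auto

lemma has_derivative_sgn_vector:
  fixes x :: "real^'n"
  assumes "x \<noteq> 0"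
  shows "(sgn has_derivative (\<lambda>h. (1 / norm x) *\<^sub>R tangential (sgn x) h)) (at x)"
proof -
  have "((\<lambda>x. inverse (norm x) *\<^sub>R x) has_derivative
     (\<lambda>h. inverse (norm x) *\<^sub>R h + (- (inverse (norm x) * (sgn x \<bullet> h) * inverse (norm x))) *\<^sub>R x)) (at x)"
    using assms by (auto simp: inner_commute intro!: derivative_eq_intros has_derivative_norm)
  moreover have "(\<lambda>x. inverse (norm x) *\<^sub>R x) = (sgn :: real^'n \<Rightarrow> real^'n)"
    by (auto simp: sgn_div_norm)
  moreover have "inverse (norm x) *\<^sub>R h + (- (inverse (norm x) * (sgn x \<bullet> h) * inverse (norm x))) *\<^sub>R x
     = (1 / norm x) *\<^sub>R tangential (sgn x) h" for h
    by (simp add: tangential_def sgn_div_norm algebra_simps inner_commute divide_inverse)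
  ultimately show ?thesis by simp
qed

lemma has_derivative_sgn_compose:
  fixes x :: "real^'n"
  assumes "has_gradient p D" "x \<noteq> 0"
  shows "((\<lambda>y. p (sgn y)) has_derivative (\<lambda>h. ((1 / norm x) *\<^sub>R tangential (sgn x) (D (sgn x))) \<bullet> h)) (at x)"
proof -
  have "((\<lambda>y. p (sgn y)) has_derivative (\<lambda>h. D (sgn x) \<bullet> ((1 / norm x) *\<^sub>R tangential (sgn x) h))) (at x)"
    using assms by (intro has_derivative_compose[OF has_derivative_sgn_vector]) (auto simp: has_gradient_def)
  then show ?thesis
    by (simp add: tangential_def inner_diff_left inner_diff_right inner_commute algebra_simps)
qed

lemma has_gradient_punctured:
  fixes p :: "real^'n \<Rightarrow> real"
  assumes "compact K" "0 \<notin> K" "\<And>x. x \<notin> K \<Longrightarrow> p x = 0" "\<And>x. x \<notin> K \<Longrightarrow> D x = 0"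
    and "\<And>x. x \<noteq> 0 \<Longrightarrow> (p has_derivative (\<lambda>h. D x \<bullet> h)) (at x)"
    and "continuous_on (-{0}) D"
  shows "has_gradient p D"
  unfolding has_gradient_def
proof safe
  fix x
  show "(p has_derivative (\<lambda>h. D x \<bullet> h)) (at x)"
  proof (cases "x \<in> K")
    case True
    then show ?thesis using assms(2) by (intro assms(5)) auto
  next
    case False
    have "open (-K)" using compact_imp_closed[OF assms(1)] by auto
    have "(p has_derivative (\<lambda>h. 0)) (at x)"
    proof (rule has_derivative_transform_within_open[OF has_derivative_const \<open>open (-K)\<close>])
      show "x \<in> -K" using False by simp
      show "0 = p y" if "y \<in> -K" for y using assms(3)[of y] that by simp
    qed
    then show ?thesis unfolding assms(4)[OF False] inner_zero_left .
  qed
qed (rule continuous_extend_by_zero[OF assms(6,1,2,4)])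

text \<open>The product of the test function with \<open>p (sgn x)\<close> is again \<open>C\<^sup>1\<close> with compact support away from \<open>0\<close>, so the integral
  of its gradient vanishes; expand that gradient by the product rule.\<close>

lemma weak_gradient_smooth:
  fixes p :: "real^'n \<Rightarrow> real"
  assumes p: "has_gradient p D"
  shows "weak_gradient p (\<lambda>x. tangential x (D x))"
  unfolding weak_gradient_def
proof safe
  fix \<phi> :: "real^'n \<Rightarrow> real" and D\<phi> K i
  assume \<phi>: "has_gradient \<phi> D\<phi>" and K: "compact K" "0 \<notin> K" "\<forall>x. x \<notin> K \<longrightarrow> \<phi> x = 0"
  have z: "\<phi> x = 0" "D\<phi> x = 0" if "x \<notin> K" for x
    using has_gradient_outside_support[OF \<phi> K(1) _ that] K(3) that by auto
  define T where "T x = tangential x (D x)" for x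
  define E where "E x = p (sgn x) *\<^sub>R D\<phi> x + (\<phi> x / norm x) *\<^sub>R T (sgn x)" for x
  have Dc: "continuous_on UNIV D" "continuous_on UNIV D\<phi>"
    using p \<phi> by (auto simp: has_gradient_def)
  have c1: "continuous_on (-{0}) (\<lambda>x. p (sgn x))"
    by (rule continuous_on_compose2[OF has_gradient_continuous[OF p, of UNIV] continuous_on_sgn_punctured]) auto
  have c2: "continuous_on (-{0}) (\<lambda>x. T (sgn x))"
    unfolding T_def tangential_def
    by (intro continuous_intros continuous_on_sgn_punctured
        continuous_on_compose2[OF Dc(1) continuous_on_sgn_punctured]) auto
  have cD: "continuous_on (-{0}) D\<phi>" "continuous_on (-{0}) \<phi>"
    using continuous_on_subset[OF Dc(2)] has_gradient_continuous[OF \<phi>] by auto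
  have "has_gradient (\<lambda>x. \<phi> x * p (sgn x)) E"
  proof (rule has_gradient_punctured[OF K(1,2)])
    fix x :: "real^'n" assume x: "x \<noteq> 0"
    show "((\<lambda>x. \<phi> x * p (sgn x)) has_derivative (\<lambda>h. E x \<bullet> h)) (at x)"
      using \<phi> has_derivative_sgn_compose[OF p x]
      by (auto simp: has_gradient_def E_def T_def inner_add_left algebra_simps intro!: derivative_eq_intros)
  next
    show "continuous_on (-{0}) E"
      unfolding E_def by (intro continuous_intros c1 c2 cD) auto
  qed (auto simp: z E_def)
  then have "(LINT x|lborel. E x $ i) = 0"
    by (rule integral_gradient_compact_support[OF _ K(1)]) (simp add: z)
  moreover have int: "integrable lborel f" if "continuous_on (-{0}) f" "\<And>x. x \<notin> K \<Longrightarrow> f x = 0"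
    for f :: "real^'n \<Rightarrow> real"
    by (rule integrable_lborel_compact_support[OF continuous_extend_by_zero[OF that(1) K(1,2)] K(1)])
       (use that(2) in auto)
  have "integrable lborel (\<lambda>x. D\<phi> x $ i * p (sgn x))"
    by (rule int) (intro continuous_intros c1 cD, simp add: z)
  moreover have "integrable lborel (\<lambda>x. \<phi> x / norm x * T (sgn x) $ i)"
    by (rule int) (intro continuous_intros c2 cD, auto simp: z)
  ultimately have "(LINT x|lborel. D\<phi> x $ i * p (sgn x)) + (LINT x|lborel. \<phi> x / norm x * T (sgn x) $ i) = 0"
    by (subst Bochner_Integration.integral_add[symmetric]) (auto simp: E_def algebra_simps)
  then show "(LINT x|lborel. D\<phi> x $ i * p (sgn x)) = - (LINT x|lborel. \<phi> x / norm x * tangential (sgn x) (D (sgn x)) $ i)"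
    by (simp add: T_def)
qed

text \<open>A nonnegative \<open>C\<^sup>1\<close> function supported in \<open>[1, 2]\<close>: squaring the positive part removes the kinks.\<close>

definition bump :: "real \<Rightarrow> real" where
  "bump r = (max 0 ((r - 1) * (2 - r)))\<^sup>2"

definition bump_deriv :: "real \<Rightarrow> real" where
  "bump_deriv r = 2 * max 0 ((r - 1) * (2 - r)) * (3 - 2 * r)"

lemma pos_part_square_derivative: "((\<lambda>y. (max 0 y)\<^sup>2) has_real_derivative 2 * max 0 y) (at (y::real))"
proof (cases y "0::real" rule: linorder_cases)
  case less
  have "((\<lambda>y. (max 0 y)\<^sup>2) has_real_derivative 0) (at y)"
  proof (rule has_field_derivative_transform_within_open[OF DERIV_const])
    show "open {..<0::real}" "y \<in> {..<0}" using less by auto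
    show "0 = (max 0 z)\<^sup>2" if "z \<in> {..<0}" for z :: real using that by simp
  qed
  then show ?thesis using less by simp
next
  case greater
  have "((\<lambda>y. (max 0 y)\<^sup>2) has_real_derivative 2 * y) (at y)"
  proof (rule has_field_derivative_transform_within_open)
    show "((\<lambda>y. y\<^sup>2) has_real_derivative 2 * y) (at y)" by (auto intro!: derivative_eq_intros)
    show "open {0<..<y + 1}" "y \<in> {0<..<y + 1}" using greater by auto
    show "z\<^sup>2 = (max 0 z)\<^sup>2" if "z \<in> {0<..<y + 1}" for z :: real using that by simp
  qed
  then show ?thesis using greater by simp
next
  case equal
  have "(\<lambda>h::real. (max 0 h)\<^sup>2 / h) \<midarrow>0\<rightarrow> 0"
  proof (rule Lim_null_comparison)
    show "\<forall>\<^sub>F h in at 0. norm ((max 0 h)\<^sup>2 / h) \<le> \<bar>h\<bar>"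
      by (rule always_eventually) (auto simp: max_def power2_eq_square)
    show "((\<lambda>h::real. \<bar>h\<bar>) \<longlongrightarrow> 0) (at 0)"
      by (intro tendsto_eq_intros) auto
  qed
  then show ?thesis using equal by (simp add: DERIV_def)
qed

lemma bump_has_derivative: "(bump has_real_derivative bump_deriv r) (at r)"
proof -
  have "((\<lambda>r. (r - 1) * (2 - r)) has_real_derivative (3 - 2 * r)) (at r)"
    by (auto intro!: derivative_eq_intros)
  from DERIV_chain2[OF pos_part_square_derivative this]
  show ?thesis by (simp add: bump_def[abs_def] bump_deriv_def)
qed

lemma bump_outside:
  assumes "r \<notin> {1..2}"
  shows "bump r = 0" "bump_deriv r = 0"
proof -
  have "(r - 1) * (2 - r) \<le> 0" using assms by (auto simp: mult_le_0_iff)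
  then show "bump r = 0" "bump_deriv r = 0" by (auto simp: bump_def bump_deriv_def max_def)
qed

lemma continuous_bump [continuous_intros]:
  "continuous_on S f \<Longrightarrow> continuous_on S (\<lambda>x. bump (f x))"
  "continuous_on S f \<Longrightarrow> continuous_on S (\<lambda>x. bump_deriv (f x))"
  unfolding bump_def bump_deriv_def by (intro continuous_intros; assumption)+

lemma
  fixes m :: nat
  shows bump_integrable: "integrable lborel (\<lambda>r. indicator {0<..} r * r ^ m * (bump r / r))"
      "integrable lborel (\<lambda>r. indicator {0<..} r * r ^ m * bump_deriv r)"
    and bump_integral: "(LINT r|lborel. indicator {0<..} r * r ^ m * bump_deriv r) =
       - real m * (LINT r|lborel. indicator {0<..} r * r ^ m * (bump r / r))"
    and bump_integral_pos: "(LINT r|lborel. indicator {0<..} r * r ^ m * (bump r / r)) > 0"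
proof -
  let ?a = "\<lambda>r. indicator {0<..} r * r ^ m * (bump r / r)"
  let ?b = "\<lambda>r. indicator {0<..} r * r ^ m * bump_deriv r"
  have eq: "?a = (\<lambda>r. indicator {1..2} r *\<^sub>R (r ^ m * (bump r / r)))"
    "?b = (\<lambda>r. indicator {1..2} r *\<^sub>R (r ^ m * bump_deriv r))"
    using bump_outside by (auto simp: indicator_def fun_eq_iff)
  show ia: "integrable lborel ?a" unfolding eq
    by (intro borel_integrable_compact continuous_intros) auto
  show ib: "integrable lborel ?b" unfolding eq
    by (intro borel_integrable_compact continuous_intros) auto
  have "(LINT r|lborel. ?b r + real m * ?a r) =
     (LINT r|lborel. (r ^ m * bump_deriv r + real m * r ^ (m - 1) * bump r) * indicator {1..2} r)"
  proof (rule Bochner_Integration.integral_cong[OF refl])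
    fix r :: real
    have "real m * (r ^ m * (bump r / r)) = real m * r ^ (m - 1) * bump r" if "r \<in> {1..2}"
      using that by (cases m) auto
    moreover have "?b r = indicator {1..2} r *\<^sub>R (r ^ m * bump_deriv r)"
      "?a r = indicator {1..2} r *\<^sub>R (r ^ m * (bump r / r))"
      using eq by meson+
    ultimately show "?b r + real m * ?a r =
        (r ^ m * bump_deriv r + real m * r ^ (m - 1) * bump r) * indicator {1..2} r"
      by (simp only:) (cases "r \<in> {1..2}"; simp)
  qed
  also have "\<dots> = 2 ^ m * bump 2 - 1 ^ m * bump 1"
  proof (rule integral_FTC_Icc_real)
    fix r :: real
    show "((\<lambda>r. r ^ m * bump r) has_real_derivative r ^ m * bump_deriv r + real m * r ^ (m - 1) * bump r) (at r)"
      by (auto intro!: derivative_eq_intros bump_has_derivative simp: algebra_simps)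
    have "continuous_on UNIV (\<lambda>r. r ^ m * bump_deriv r + real m * r ^ (m - 1) * bump r)"
      by (intro continuous_intros)
    then show "isCont (\<lambda>r. r ^ m * bump_deriv r + real m * r ^ (m - 1) * bump r) r"
      by (simp add: continuous_on_eq_continuous_at)
  qed auto
  also have "\<dots> = 0" by (simp add: bump_def)
  finally have "(LINT r|lborel. ?b r + real m * ?a r) = 0" .
  moreover have "(LINT r|lborel. b r + c * a r) = (LINT r|lborel. b r) + c * (LINT r|lborel. a r)"
    if "integrable lborel a" "integrable lborel b" for a b :: "real \<Rightarrow> real" and c
    using that by simp
  note this[OF ia ib, of "real m"]
  ultimately show "(LINT r|lborel. ?b r) = - real m * (LINT r|lborel. ?a r)"
    by linarith
  have nn: "?a r \<ge> 0" for r by (auto simp: indicator_def bump_def)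
  then have "(LINT r|lborel. ?a r) \<ge> 0" by (intro Bochner_Integration.integral_nonneg)
  moreover have "(LINT r|lborel. ?a r) \<noteq> 0"
  proof
    assume "(LINT r|lborel. ?a r) = 0"
    then have "AE r in lborel. ?a r = 0"
      using integral_nonneg_eq_0_iff_AE[OF ia] nn by simp
    then have "AE r in lborel. r \<notin> {1<..<2::real}"
      by eventually_elim (auto simp: indicator_def bump_def max_def split: if_splits)
    then have "emeasure lborel {1<..<2::real} = 0"
      by (subst (asm) AE_iff_measurable[of "{1<..<2}"]) auto
    then show False by simp
  qed
  ultimately show "(LINT r|lborel. ?a r) > 0" by simp
qed

text \<open>Integration by parts on the sphere. The test function \<open>bump \<bar>x\<bar> \<cdot> q (x / \<bar>x\<bar>)\<close> separates the variables in polar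
  coordinates, and the radial integrals of \<open>bump' r\<^bsup>d-1\<^esup>\<close> and \<open>bump r\<^bsup>d-2\<^esup>\<close> have the ratio \<open>-(d - 1)\<close>. This is the source
  of the curvature term \<open>(d - 1) x\<^sub>i q\<close>.\<close>

lemma weak_gradient_integral_sphere:
  fixes u :: "real^'n \<Rightarrow> real"
  assumes w: "weak_gradient u g" and u: "integrable \<sigma> u" and g: "integrable \<sigma> (\<lambda>x. g x $ i)"
    and q: "has_gradient q D"
  shows "(LINT x|\<sigma>. q x * g x $ i) =
     (LINT x|\<sigma>. ((real CARD('n) - 1) * x $ i * q x - tangential x (D x) $ i) * u x)"
proof -
  define K where "K = cball (0::real^'n) 2 - ball 0 1"
  have K: "compact K" "0 \<notin> K" "x \<notin> K \<Longrightarrow> norm x \<notin> {1..2}" for x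
    by (auto simp: K_def compact_diff)
  define T where "T x = tangential x (D x)" for x
  define \<phi> where "\<phi> x = bump (norm x) * q (sgn x)" for x
  define E where "E x = (bump_deriv (norm x) * q (sgn x)) *\<^sub>R sgn x + (bump (norm x) / norm x) *\<^sub>R T (sgn x)" for x
  have Dc: "continuous_on UNIV D" using q by (auto simp: has_gradient_def)
  have c1: "continuous_on (-{0}) (\<lambda>x. q (sgn x))"
    by (rule continuous_on_compose2[OF has_gradient_continuous[OF q, of UNIV] continuous_on_sgn_punctured]) auto
  have c2: "continuous_on (-{0}) (\<lambda>x. T (sgn x))"
    unfolding T_def tangential_def
    by (intro continuous_intros continuous_on_sgn_punctured
        continuous_on_compose2[OF Dc continuous_on_sgn_punctured]) auto
  have Tc: "continuous_on S T" for S
    unfolding T_def tangential_def using continuous_on_subset[OF Dc] by (intro continuous_intros) auto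
  have qc: "continuous_on S q" for S by (rule has_gradient_continuous[OF q])
  have \<phi>E: "has_gradient \<phi> E"
  proof (rule has_gradient_punctured[OF K(1,2)])
    fix x :: "real^'n" assume x: "x \<noteq> 0"
    have "((\<lambda>x. bump (norm x)) has_derivative (\<lambda>h. bump_deriv (norm x) * (sgn x \<bullet> h))) (at x)"
      using has_derivative_compose[OF has_derivative_norm[OF x] bump_has_derivative[unfolded has_field_derivative_def]]
      by (simp add: inner_commute)
    then show "(\<phi> has_derivative (\<lambda>h. E x \<bullet> h)) (at x)"
      unfolding \<phi>_def[abs_def] using has_derivative_sgn_compose[OF q x]
      by (auto simp: E_def T_def inner_add_left algebra_simps intro!: derivative_eq_intros)
  next
    show "continuous_on (-{0}) E"
      unfolding E_def by (intro continuous_intros c1 c2 continuous_on_sgn_punctured) auto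
  qed (use bump_outside K(3) in \<open>auto simp: \<phi>_def E_def\<close>)
  have "(LINT x|lborel. E x $ i * u (sgn x)) = - (LINT x|lborel. \<phi> x / norm x * g (sgn x) $ i)"
  proof -
    have "\<exists>K. compact K \<and> 0 \<notin> K \<and> (\<forall>x. x \<notin> K \<longrightarrow> \<phi> x = 0)"
      using K bump_outside(1) by (intro exI[of _ K]) (simp add: \<phi>_def)
    with w \<phi>E show ?thesis unfolding weak_gradient_def by blast
  qed
  moreover let ?A = "LINT r|lborel. indicator {0<..} r * r ^ (CARD('n) - 1) * (bump r / r)"
  let ?B = "LINT r|lborel. indicator {0<..} r * r ^ (CARD('n) - 1) * bump_deriv r"
  have b1: "(\<lambda>r. bump r / r) \<in> borel_measurable borel" "bump 0 / 0 = 0"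
    and b2: "bump_deriv \<in> borel_measurable borel" "bump_deriv 0 = 0"
    using borel_measurable_continuous_onI[of bump] borel_measurable_continuous_onI[of bump_deriv]
      continuous_bump[of UNIV "\<lambda>x. x"] bump_outside[of 0] by auto
  note P1 = polar_integrable[where 'n='n, OF b1 bump_integrable(1)] polar_integral[where 'n='n, OF b1 bump_integrable(1)]
  note P2 = polar_integrable[where 'n='n, OF b2 bump_integrable(2)] polar_integral[where 'n='n, OF b2 bump_integrable(2)]
  have i1: "integrable \<sigma> (\<lambda>x. (q x * x $ i) * u x)" "integrable \<sigma> (\<lambda>x. T x $ i * u x)"
    "integrable \<sigma> (\<lambda>x. q x * g x $ i)"
    by (intro integrable_mult_continuous_sphere u g continuous_intros qc Tc)+
  have "(LINT x|lborel. E x $ i * u (sgn x)) =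
      (LINT x|lborel. bump_deriv (norm x) * ((q (sgn x) * sgn x $ i) * u (sgn x)) +
         bump (norm x) / norm x * (T (sgn x) $ i * u (sgn x)))"
    by (simp add: E_def algebra_simps)
  also have "\<dots> = ?B * (LINT x|\<sigma>. (q x * x $ i) * u x) + ?A * (LINT x|\<sigma>. T x $ i * u x)"
    using P1[OF i1(2)] P2[OF i1(1)] by simp
  also have "?B = - real (CARD('n) - 1) * ?A" by (rule bump_integral)
  also have "real (CARD('n) - 1) = real CARD('n) - 1"
    by (simp add: of_nat_diff Suc_leI)
  moreover have "(LINT x|lborel. \<phi> x / norm x * g (sgn x) $ i) = ?A * (LINT x|\<sigma>. q x * g x $ i)"
    using P1(2)[OF i1(3)] by (simp add: \<phi>_def algebra_simps)
  ultimately have "?A * (- (real CARD('n) - 1) * (LINT x|\<sigma>. (q x * x $ i) * u x) + (LINT x|\<sigma>. T x $ i * u x))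
    = ?A * (- (LINT x|\<sigma>. q x * g x $ i))"
    by (simp add: algebra_simps)
  then have "- (real CARD('n) - 1) * (LINT x|\<sigma>. (q x * x $ i) * u x) + (LINT x|\<sigma>. T x $ i * u x)
    = - (LINT x|\<sigma>. q x * g x $ i)"
    using bump_integral_pos[of "CARD('n) - 1"] by (simp only: mult_cancel_left) auto
  then have "(LINT x|\<sigma>. q x * g x $ i) =
     (real CARD('n) - 1) * (LINT x|\<sigma>. (q x * x $ i) * u x) - (LINT x|\<sigma>. T x $ i * u x)"
    by linarith
  also have "\<dots> = (LINT x|\<sigma>. (real CARD('n) - 1) * ((q x * x $ i) * u x) - T x $ i * u x)"
    using i1 by simp
  finally show ?thesis by (simp add: T_def algebra_simps)
qed

text \<open>Continuity in \<open>L\<^sup>1(\<sigma>)\<close> of the two sides of the weak gradient identity, which lets weak gradients pass to limits.\<close>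

lemma test_function_bound:
  fixes w :: "real^'n \<Rightarrow> real"
  assumes w: "continuous_on UNIV w" and K: "compact K" "0 \<notin> K" "\<And>x. x \<notin> K \<Longrightarrow> w x = 0"
  shows "\<exists>C. \<forall>v. integrable \<sigma> v \<longrightarrow> integrable lborel (\<lambda>x. w x * v (sgn x)) \<and>
     \<bar>LINT x|lborel. w x * v (sgn x)\<bar> \<le> C * (LINT x|\<sigma>. \<bar>v x\<bar>)"
proof -
  have "compact (w ` K)" using w K(1) by (intro compact_continuous_image) (auto intro: continuous_on_subset)
  from compact_imp_bounded[OF this] obtain B where B: "\<And>x. x \<in> K \<Longrightarrow> \<bar>w x\<bar> \<le> B"
    unfolding bounded_iff by auto
  obtain R where R: "\<And>x. x \<in> K \<Longrightarrow> norm x \<le> R"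
    using compact_imp_bounded[OF K(1)] unfolding bounded_iff by auto
  define B' where "B' = max B 0"
  \<comment> \<open>A radial majorant of \<open>w\<close>.\<close>
  define \<alpha> where "\<alpha> r = B' * indicator {0<..R} r" for r :: real
  let ?I = "LINT r|lborel. indicator {0<..} r * r ^ (CARD('n) - 1) * \<alpha> r"
  have a: "\<alpha> \<in> borel_measurable borel" "\<alpha> 0 = 0"
    by (auto simp: \<alpha>_def[abs_def] intro!: borel_measurable_times borel_measurable_indicator)
  have ai: "integrable lborel (\<lambda>r. indicator {0<..} r * r ^ (CARD('n) - 1) * \<alpha> r)"
  proof (rule Bochner_Integration.integrable_bound)
    show "integrable lborel (\<lambda>r. indicator {0..R} r *\<^sub>R (B' * r ^ (CARD('n) - 1)))"
      by (intro borel_integrable_compact continuous_intros) auto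
    show "(\<lambda>r. indicator {0<..} r * r ^ (CARD('n) - 1) * \<alpha> r) \<in> borel_measurable lborel"
      using a(1) by measurable
  qed (auto simp: \<alpha>_def indicator_def mult.commute)
  have le: "\<bar>w x\<bar> \<le> \<alpha> (norm x)" for x
  proof (cases "x \<in> K")
    case True
    then show ?thesis using B[of x] R[of x] K(2) by (auto simp: \<alpha>_def B'_def indicator_def)
  qed (auto simp: K(3) \<alpha>_def B'_def)
  show ?thesis
  proof (intro exI[of _ ?I] allI impI conjI)
    fix v :: "real^'n \<Rightarrow> real" assume v: "integrable \<sigma> v"
    then have v': "integrable \<sigma> (\<lambda>x. \<bar>v x\<bar>)" by auto
    note P = polar_integrable[OF a ai v'] polar_integral[OF a ai v']
    have meas: "(\<lambda>x. w x * v (sgn x)) \<in> borel_measurable lborel"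
    proof -
      have "(\<lambda>x. v (sgn x)) \<in> borel_measurable (restrict_space lborel (-{0}))"
        using measurable_compose[OF sgn_punctured_measurable borel_measurable_integrable[OF v]] .
      then have "(\<lambda>x. indicator (-{0}) x *\<^sub>R v (sgn x)) \<in> borel_measurable lborel"
        by (subst (asm) borel_measurable_restrict_space_iff) auto
      moreover have "w \<in> borel_measurable lborel"
        using borel_measurable_continuous_onI[OF w] by simp
      ultimately have "(\<lambda>x. w x * (indicator (-{0}) x *\<^sub>R v (sgn x))) \<in> borel_measurable lborel"
        by measurable
      moreover have "w x * (indicator (-{0}) x *\<^sub>R v (sgn x)) = w x * v (sgn x)" for x
        using K by (auto simp: indicator_def)
      ultimately show ?thesis by (simp only:)
    qed
    have dom: "\<bar>w x * v (sgn x)\<bar> \<le> \<alpha> (norm x) * \<bar>v (sgn x)\<bar>" for x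
      using le[of x] by (simp add: abs_mult mult_right_mono)
    show int: "integrable lborel (\<lambda>x. w x * v (sgn x))"
      by (rule Bochner_Integration.integrable_bound[OF P(1) meas])
         (use dom order_trans[OF _ abs_ge_self] in auto)
    have "\<bar>LINT x|lborel. w x * v (sgn x)\<bar> \<le> (LINT x|lborel. \<bar>w x * v (sgn x)\<bar>)"
      by (rule integral_abs_bound)
    also have "\<dots> \<le> (LINT x|lborel. \<alpha> (norm x) * \<bar>v (sgn x)\<bar>)"
      using int P(1) dom by (intro integral_mono) auto
    finally show "\<bar>LINT x|lborel. w x * v (sgn x)\<bar> \<le> ?I * (LINT x|\<sigma>. \<bar>v x\<bar>)"
      by (simp add: P(2))
  qed
qed

lemma weak_gradient_limit:
  fixes u :: "nat \<Rightarrow> real^'n \<Rightarrow> real"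
  assumes w: "\<And>k. weak_gradient (u k) (g k)"
    and u: "\<And>k. integrable \<sigma> (u k)" "integrable \<sigma> v"
    and g: "\<And>k i. integrable \<sigma> (\<lambda>x. g k x $ i)" "\<And>i. integrable \<sigma> (\<lambda>x. h x $ i)"
    and lu: "(\<lambda>k. LINT x|\<sigma>. \<bar>u k x - v x\<bar>) \<longlonglongrightarrow> 0"
    and lg: "\<And>i. (\<lambda>k. LINT x|\<sigma>. \<bar>g k x $ i - h x $ i\<bar>) \<longlonglongrightarrow> 0"
  shows "weak_gradient v h"
  unfolding weak_gradient_def
proof safe
  fix \<phi> :: "real^'n \<Rightarrow> real" and D K i
  assume \<phi>: "has_gradient \<phi> D" and K: "compact K" "0 \<notin> K" "\<forall>x. x \<notin> K \<longrightarrow> \<phi> x = 0"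
  have z: "\<phi> x = 0" "D x = 0" if "x \<notin> K" for x
    using has_gradient_outside_support[OF \<phi> K(1) _ that] K(3) that by auto
  have lim: "(\<lambda>k. LINT x|lborel. w x * a k (sgn x)) \<longlonglongrightarrow> (LINT x|lborel. w x * b (sgn x))"
    if wc: "continuous_on UNIV w" "\<And>x. x \<notin> K \<Longrightarrow> w x = 0"
      and a: "\<And>k. integrable \<sigma> (a k)" "integrable \<sigma> b" "(\<lambda>k. LINT x|\<sigma>. \<bar>a k x - b x\<bar>) \<longlonglongrightarrow> 0"
    for w b :: "real^'n \<Rightarrow> real" and a
  proof -
    obtain C where C: "\<And>v. integrable \<sigma> v \<Longrightarrow> integrable lborel (\<lambda>x. w x * v (sgn x))"
     "\<And>v. integrable \<sigma> v \<Longrightarrow> \<bar>LINT x|lborel. w x * v (sgn x)\<bar> \<le> C * (LINT x|\<sigma>. \<bar>v x\<bar>)"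
      using test_function_bound[OF wc(1) K(1,2) wc(2)] by blast
    have "(\<lambda>k. (LINT x|lborel. w x * a k (sgn x)) - (LINT x|lborel. w x * b (sgn x))) \<longlonglongrightarrow> 0"
    proof (rule Lim_null_comparison)
      show "\<forall>\<^sub>F k in sequentially. norm ((LINT x|lborel. w x * a k (sgn x)) - (LINT x|lborel. w x * b (sgn x)))
         \<le> C * (LINT x|\<sigma>. \<bar>a k x - b x\<bar>)"
      proof (rule always_eventually, rule allI)
        fix k
        have "(LINT x|lborel. w x * a k (sgn x)) - (LINT x|lborel. w x * b (sgn x))
           = (LINT x|lborel. w x * (a k (sgn x) - b (sgn x)))"
          using C(1)[OF a(1)] C(1)[OF a(2)] by (simp add: right_diff_distrib)
        then show "norm ((LINT x|lborel. w x * a k (sgn x)) - (LINT x|lborel. w x * b (sgn x)))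
         \<le> C * (LINT x|\<sigma>. \<bar>a k x - b x\<bar>)"
          using C(2)[of "\<lambda>x. a k x - b x"] a by simp
      qed
      show "(\<lambda>k. C * (LINT x|\<sigma>. \<bar>a k x - b x\<bar>)) \<longlonglongrightarrow> 0"
        using tendsto_mult_left[OF a(3), of C] by simp
    qed
    then show ?thesis by (rule LIM_zero_cancel)
  qed
  have c1: "continuous_on UNIV (\<lambda>x. D x $ i)"
    using \<phi> by (intro continuous_intros) (auto simp: has_gradient_def)
  have c2: "continuous_on UNIV (\<lambda>x. \<phi> x / norm x)"
    using z has_gradient_continuous[OF \<phi>]
    by (intro continuous_extend_by_zero[OF _ K(1,2)] continuous_intros) auto
  have "(\<lambda>k. LINT x|lborel. D x $ i * u k (sgn x)) \<longlonglongrightarrow> (LINT x|lborel. D x $ i * v (sgn x))"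
    using z by (intro lim c1 u lu) auto
  moreover have "(\<lambda>k. - (LINT x|lborel. \<phi> x / norm x * g k (sgn x) $ i)) \<longlonglongrightarrow>
      - (LINT x|lborel. \<phi> x / norm x * h (sgn x) $ i)"
    using z by (intro tendsto_minus lim[where a = "\<lambda>k x. g k x $ i" and b = "\<lambda>x. h x $ i"] c2 g lg) auto
  moreover have "(LINT x|lborel. D x $ i * u k (sgn x)) = - (LINT x|lborel. \<phi> x / norm x * g k (sgn x) $ i)" for k
    using w \<phi> K unfolding weak_gradient_def by blast
  ultimately show "(LINT x|lborel. D x $ i * v (sgn x)) = - (LINT x|lborel. \<phi> x / norm x * h (sgn x) $ i)"
    using LIMSEQ_unique by fastforce
qed

section \<open>Square-integrable real functions\<close>

lemma square_integrable_real_iff: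
  fixes u :: "real^'n \<Rightarrow> real"
  shows "square_integrable u \<longleftrightarrow> u \<in> borel_measurable \<sigma> \<and> integrable \<sigma> (\<lambda>x. (u x)\<^sup>2)"
  by (simp add: square_integrable_def)

definition ip :: "(real^'n \<Rightarrow> real) \<Rightarrow> (real^'n \<Rightarrow> real) \<Rightarrow> real" where
  "ip u v = (LINT x|\<sigma>. u x * v x)"

lemma square_integrable_mult:
  fixes u v :: "real^'n \<Rightarrow> real"
  assumes "square_integrable u" "square_integrable v"
  shows "integrable \<sigma> (\<lambda>x. u x * v x)"
proof (rule Bochner_Integration.integrable_bound)
  show "integrable \<sigma> (\<lambda>x. (u x)\<^sup>2 + (v x)\<^sup>2)"
    using assms by (auto simp: square_integrable_real_iff)
  show "(\<lambda>x. u x * v x) \<in> borel_measurable \<sigma>"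
    using assms by (auto simp: square_integrable_real_iff intro: borel_measurable_times)
  have "\<bar>a * b\<bar> \<le> a\<^sup>2 + b\<^sup>2" for a b :: real
  proof -
    have "2 * \<bar>a\<bar> * \<bar>b\<bar> \<le> a\<^sup>2 + b\<^sup>2" using sum_squares_bound[of "\<bar>a\<bar>" "\<bar>b\<bar>"] by simp
    moreover have "0 \<le> \<bar>a\<bar> * \<bar>b\<bar>" by simp
    ultimately show ?thesis unfolding abs_mult by linarith
  qed
  then show "AE x in \<sigma>. norm (u x * v x) \<le> norm ((u x)\<^sup>2 + (v x)\<^sup>2)"
    by (intro AE_I2) (simp add: abs_of_nonneg)
qed

lemma square_integrable_continuous:
  fixes u :: "real^'n \<Rightarrow> real"
  assumes "continuous_on (sphere 0 1) u"
  shows "square_integrable u"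
  unfolding square_integrable_real_iff
  by (intro conjI continuous_sphere_measurable continuous_sphere_integrable continuous_intros assms)

lemma square_integrable_integrable:
  fixes u :: "real^'n \<Rightarrow> real"
  shows "square_integrable u \<Longrightarrow> integrable \<sigma> u"
  using square_integrable_mult[of u "\<lambda>x. 1"] square_integrable_continuous[of "\<lambda>x::real^'n. 1"] by auto

lemma square_integrable_scale:
  fixes u :: "real^'n \<Rightarrow> real"
  shows "square_integrable u \<Longrightarrow> square_integrable (\<lambda>x. c * u x)"
  by (auto simp: square_integrable_real_iff power_mult_distrib)

lemma square_integrable_add:
  fixes u v :: "real^'n \<Rightarrow> real"
  assumes "square_integrable u" "square_integrable v"
  shows "square_integrable (\<lambda>x. u x + v x)"
proof -
  have "integrable \<sigma> (\<lambda>x. (u x)\<^sup>2 + (v x)\<^sup>2 + 2 * (u x * v x))"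
    using assms square_integrable_mult[OF assms]
    by (intro Bochner_Integration.integrable_add integrable_mult_right) (auto simp: square_integrable_real_iff)
  moreover have "(u x)\<^sup>2 + (v x)\<^sup>2 + 2 * (u x * v x) = (u x + v x)\<^sup>2" for x
    by (simp add: power2_sum)
  ultimately show ?thesis
    using assms by (auto simp: square_integrable_real_iff intro: borel_measurable_add)
qed

lemma square_integrable_diff:
  fixes u v :: "real^'n \<Rightarrow> real"
  shows "square_integrable u \<Longrightarrow> square_integrable v \<Longrightarrow> square_integrable (\<lambda>x. u x - v x)"
  using square_integrable_add[of u "\<lambda>x. (-1) * v x"] square_integrable_scale[of v "-1"] by simp

lemma square_integrable_sum:
  fixes u :: "'i \<Rightarrow> real^'n \<Rightarrow> real"
  shows "finite I \<Longrightarrow> (\<And>i. i \<in> I \<Longrightarrow> square_integrable (u i)) \<Longrightarrow> square_integrable (\<lambda>x. \<Sum>i\<in>I. u i x)"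
  by (induction I rule: finite_induct)
     (auto intro: square_integrable_add square_integrable_continuous[of "\<lambda>x. 0"])

lemma square_integrable_hpoly: "p \<in> hpoly n \<Longrightarrow> square_integrable p"
  by (intro square_integrable_continuous hpoly_continuous)

lemma square_integrable_harmonics: "p \<in> harmonics n \<Longrightarrow> square_integrable p"
  using square_integrable_hpoly harmonics_hpoly by blast

lemma ip_commute: "ip u v = ip v u"
  by (simp add: ip_def mult.commute)

lemma ip_add_left:
  "square_integrable u \<Longrightarrow> square_integrable v \<Longrightarrow> square_integrable w \<Longrightarrow>
    ip (\<lambda>x. u x + v x) w = ip u w + ip v w"
  by (simp add: ip_def distrib_right square_integrable_mult)

lemma ip_diff_left:
  "square_integrable u \<Longrightarrow> square_integrable v \<Longrightarrow> square_integrable w \<Longrightarrow>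
    ip (\<lambda>x. u x - v x) w = ip u w - ip v w"
  by (simp add: ip_def left_diff_distrib square_integrable_mult)

lemma ip_scale_left: "ip (\<lambda>x. c * u x) w = c * ip u w"
  by (simp add: ip_def mult.assoc)

lemma ip_scale_both: "ip (\<lambda>x. c * u x) (\<lambda>x. d * v x) = c * d * ip u v"
proof -
  have "(c * u x) * (d * v x) = (c * d) * (u x * v x)" for x by simp
  then show ?thesis unfolding ip_def by (simp only: integral_mult_right_zero)
qed

lemma ip_sum_left:
  "finite I \<Longrightarrow> (\<And>i. i \<in> I \<Longrightarrow> square_integrable (u i)) \<Longrightarrow> square_integrable w \<Longrightarrow>
     ip (\<lambda>x. \<Sum>i\<in>I. u i x) w = (\<Sum>i\<in>I. ip (u i) w)"
  by (simp add: ip_def sum_distrib_right square_integrable_mult)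

lemma ip_sum_right:
  "finite I \<Longrightarrow> (\<And>i. i \<in> I \<Longrightarrow> square_integrable (u i)) \<Longrightarrow> square_integrable w \<Longrightarrow>
     ip w (\<lambda>x. \<Sum>i\<in>I. u i x) = (\<Sum>i\<in>I. ip w (u i))"
  by (subst (1 2) ip_commute) (rule ip_sum_left)

lemma ip_nonneg: "ip u u \<ge> 0"
  by (simp add: ip_def)

lemma ip_self_diff:
  assumes "square_integrable u" "square_integrable v"
  shows "ip (\<lambda>x. u x - v x) (\<lambda>x. u x - v x) = ip u u - 2 * ip u v + ip v v"
proof -
  let ?w = "\<lambda>x. u x - v x"
  have "ip ?w ?w = ip u ?w - ip v ?w"
    by (intro ip_diff_left square_integrable_diff assms)
  moreover have "ip u ?w = ip u u - ip v u" "ip v ?w = ip u v - ip v v"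
    using ip_diff_left[OF assms assms(1)] ip_diff_left[OF assms assms(2)] by (simp_all add: ip_commute)
  ultimately show ?thesis using ip_commute[of v u] by simp
qed

lemma ip_cauchy_schwarz:
  assumes u: "square_integrable u" and v: "square_integrable v"
  shows "(ip u v)\<^sup>2 \<le> ip u u * ip v v"
proof (cases "ip v v = 0")
  case False
  then have pos: "ip v v > 0" using ip_nonneg[of v] by linarith
  let ?w = "\<lambda>x. (ip v v * u x) - (ip u v * v x)"
  have "0 \<le> ip ?w ?w" by (rule ip_nonneg)
  also have "\<dots> = ip v v * (ip u u * ip v v - (ip u v)\<^sup>2)"
    using ip_self_diff[OF square_integrable_scale[OF u, of "ip v v"] square_integrable_scale[OF v, of "ip u v"]]
    unfolding ip_scale_both by (simp add: power2_eq_square algebra_simps)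
  finally show ?thesis using pos by (simp add: zero_le_mult_iff)
next
  case True
  have "ip u v = 0"
  proof (rule ccontr)
    assume n: "ip u v \<noteq> 0"
    \<comment> \<open>\<open>\<parallel>u - t v\<parallel>\<^sup>2\<close> is affine in \<open>t\<close> when \<open>\<parallel>v\<parallel> = 0\<close>, and equals \<open>-1\<close> for this \<open>t\<close>.\<close>
    define t where "t = (ip u u + 1) / (2 * ip u v)"
    have "0 \<le> ip (\<lambda>x. u x - t * v x) (\<lambda>x. u x - t * v x)" by (rule ip_nonneg)
    also have "\<dots> = ip u u - 2 * t * ip u v + t\<^sup>2 * ip v v"
      using ip_self_diff[OF u square_integrable_scale[OF v, of t]]
      by (simp add: ip_scale_left ip_commute[of _ "\<lambda>x. _ * v x"] ip_commute[of v u] power2_eq_square)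
    also have "\<dots> = -1" using n True by (simp add: t_def add_divide_distrib distrib_right)
    finally show False by simp
  qed
  then show ?thesis using True by simp
qed

lemma integral_abs_le_ip:
  assumes "square_integrable u"
  shows "(LINT x|(\<sigma> :: (real^'n) measure). \<bar>u x\<bar>) \<le> sqrt (\<omega> CARD('n)) * sqrt (ip u u)"
proof -
  have a: "square_integrable (\<lambda>x. \<bar>u x\<bar>)" using assms by (auto simp: square_integrable_real_iff)
  have 1: "square_integrable (\<lambda>x::real^'n. 1::real)" by (intro square_integrable_continuous continuous_intros)
  have "(ip (\<lambda>x. \<bar>u x\<bar>) (\<lambda>x. 1))\<^sup>2 \<le> ip (\<lambda>x. \<bar>u x\<bar>) (\<lambda>x. \<bar>u x\<bar>) * ip (\<lambda>x::real^'n. 1) (\<lambda>x. 1)"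
    by (rule ip_cauchy_schwarz[OF a 1])
  then have "(LINT x|\<sigma>. \<bar>u x\<bar>)\<^sup>2 \<le> ip u u * \<omega> CARD('n)"
    by (simp add: ip_def measure_sphere)
  then have "sqrt ((LINT x|\<sigma>. \<bar>u x\<bar>)\<^sup>2) \<le> sqrt (ip u u * \<omega> CARD('n))" by (rule real_sqrt_le_mono)
  then show ?thesis by (simp add: real_sqrt_mult mult.commute)
qed

text \<open>A subsequence converges almost everywhere, and Fatou's lemma identifies its limit as the limit in \<open>L\<^sup>2\<close>.\<close>

lemma square_integrable_complete:
  fixes s :: "nat \<Rightarrow> real^'n \<Rightarrow> real"
  assumes s: "\<And>k. square_integrable (s k)"
    and cauchy: "\<And>e. e > 0 \<Longrightarrow> \<exists>N. \<forall>i\<ge>N. \<forall>j\<ge>N. ip (\<lambda>x. s i x - s j x) (\<lambda>x. s i x - s j x) < e"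
  shows "\<exists>w. square_integrable w \<and> (\<lambda>k. ip (\<lambda>x. s k x - w x) (\<lambda>x. s k x - w x)) \<longlonglongrightarrow> 0"
proof -
  have m [measurable]: "s k \<in> borel_measurable \<sigma>" for k using s by (simp add: square_integrable_real_iff)
  let ?c = "sqrt (\<omega> CARD('n))"
  have cpos: "?c > 0" using sphere_area_pos[where 'n='n] by simp
  have L1: "\<exists>N. \<forall>i\<ge>N. \<forall>j\<ge>N. (LINT x|\<sigma>. norm (s i x - s j x)) < e" if e: "e > 0" for e
  proof -
    have "(e / ?c)\<^sup>2 > 0" using e cpos by simp
    from cauchy[OF this] obtain N where
      N: "\<And>i j. i \<ge> N \<Longrightarrow> j \<ge> N \<Longrightarrow> ip (\<lambda>x. s i x - s j x) (\<lambda>x. s i x - s j x) < (e / ?c)\<^sup>2" by blast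
    have "(LINT x|\<sigma>. norm (s i x - s j x)) < e" if "i \<ge> N" "j \<ge> N" for i j
    proof -
      have "sqrt (ip (\<lambda>x. s i x - s j x) (\<lambda>x. s i x - s j x)) < sqrt ((e / ?c)\<^sup>2)"
        using N[OF that] by (rule real_sqrt_less_mono)
      also have "\<dots> = e / ?c" using e cpos by simp
      finally have "?c * sqrt (ip (\<lambda>x. s i x - s j x) (\<lambda>x. s i x - s j x)) < e"
        using cpos by (simp add: field_simps)
      then show ?thesis
        using integral_abs_le_ip[OF square_integrable_diff[OF s s], of i j] by simp
    qed
    then show ?thesis by blast
  qed
  obtain r where r: "strict_mono r" "AE x in \<sigma>. Cauchy (\<lambda>i. s (r i) x)"
    using cauchy_L1_AE_cauchy_subseq[of \<sigma> s] s L1 square_integrable_integrable by blast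
  define w where "w x = lim (\<lambda>i. s (r i) x)" for x
  have wm [measurable]: "w \<in> borel_measurable \<sigma>" unfolding w_def[abs_def] by measurable
  have lim: "AE x in \<sigma>. (\<lambda>i. s (r i) x) \<longlonglongrightarrow> w x"
    using r(2) by eventually_elim (auto simp: w_def Cauchy_convergent_iff convergent_LIMSEQ_iff)
  have fatou: "(\<integral>\<^sup>+x. ennreal ((s j x - w x)\<^sup>2) \<partial>\<sigma>) \<le> ennreal e"
    if e: "e > 0" and j: "j \<ge> N" and
      N: "\<forall>i\<ge>N. \<forall>j\<ge>N. ip (\<lambda>x. s i x - s j x) (\<lambda>x. s i x - s j x) < e" for e j N
  proof -
    have "(\<integral>\<^sup>+x. ennreal ((s j x - w x)\<^sup>2) \<partial>\<sigma>) = (\<integral>\<^sup>+x. liminf (\<lambda>i. ennreal ((s j x - s (r i) x)\<^sup>2)) \<partial>\<sigma>)"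
    proof (rule nn_integral_cong_AE)
      show "AE x in \<sigma>. ennreal ((s j x - w x)\<^sup>2) = liminf (\<lambda>i. ennreal ((s j x - s (r i) x)\<^sup>2))"
        using lim
      proof eventually_elim
        case (elim x)
        have "(\<lambda>i. ennreal ((s j x - s (r i) x)\<^sup>2)) \<longlonglongrightarrow> ennreal ((s j x - w x)\<^sup>2)"
          by (intro tendsto_ennrealI tendsto_intros elim)
        then show ?case by (intro lim_imp_Liminf[symmetric]) auto
      qed
    qed
    also have "\<dots> \<le> liminf (\<lambda>i. \<integral>\<^sup>+x. ennreal ((s j x - s (r i) x)\<^sup>2) \<partial>\<sigma>)"
      by (rule nn_integral_liminf) measurable
    also have "\<dots> \<le> liminf (\<lambda>i. ennreal e)"
    proof (rule Liminf_mono)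
      show "\<forall>\<^sub>F i in sequentially. (\<integral>\<^sup>+x. ennreal ((s j x - s (r i) x)\<^sup>2) \<partial>\<sigma>) \<le> ennreal e"
        using eventually_ge_at_top[of N]
      proof eventually_elim
        case (elim i)
        have "N \<le> r i" using elim seq_suble[OF r(1), of i] by linarith
        then have "ip (\<lambda>x. s j x - s (r i) x) (\<lambda>x. s j x - s (r i) x) < e" using N j by blast
        moreover have "integrable \<sigma> (\<lambda>x. (s j x - s (r i) x)\<^sup>2)"
          using square_integrable_diff[OF s s, of j "r i"] by (simp add: square_integrable_real_iff)
        then have "(\<integral>\<^sup>+x. ennreal ((s j x - s (r i) x)\<^sup>2) \<partial>\<sigma>) = ennreal (ip (\<lambda>x. s j x - s (r i) x) (\<lambda>x. s j x - s (r i) x))"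
          unfolding ip_def by (subst nn_integral_eq_integral) (auto simp: power2_eq_square)
        ultimately show ?case by (simp add: ennreal_leI)
      qed
    qed
    also have "\<dots> = ennreal e" by (rule Liminf_const) simp
    finally show ?thesis .
  qed
  have int: "integrable \<sigma> (\<lambda>x. (s j x - w x)\<^sup>2)" "ip (\<lambda>x. s j x - w x) (\<lambda>x. s j x - w x) \<le> e"
    if e: "e > 0" and j: "j \<ge> N" and
      N: "\<forall>i\<ge>N. \<forall>j\<ge>N. ip (\<lambda>x. s i x - s j x) (\<lambda>x. s i x - s j x) < e" for e j N
  proof -
    note f = fatou[OF that]
    show i: "integrable \<sigma> (\<lambda>x. (s j x - w x)\<^sup>2)"
      by (rule integrableI_bounded) (use le_less_trans[OF f ennreal_less_top] in auto)
    have "ennreal (ip (\<lambda>x. s j x - w x) (\<lambda>x. s j x - w x)) = (\<integral>\<^sup>+x. ennreal ((s j x - w x)\<^sup>2) \<partial>\<sigma>)"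
      unfolding ip_def using i by (subst nn_integral_eq_integral) (auto simp: power2_eq_square)
    with f have "ennreal (ip (\<lambda>x. s j x - w x) (\<lambda>x. s j x - w x)) \<le> ennreal e" by simp
    then show "ip (\<lambda>x. s j x - w x) (\<lambda>x. s j x - w x) \<le> e"
      using e by (simp add: ennreal_le_iff)
  qed
  obtain N where N: "\<forall>i\<ge>N. \<forall>j\<ge>N. ip (\<lambda>x. s i x - s j x) (\<lambda>x. s i x - s j x) < 1"
    using cauchy[of 1] by auto
  have "square_integrable (\<lambda>x. s N x - w x)"
    using int(1)[OF _ order_refl N] by (auto simp: square_integrable_real_iff)
  from square_integrable_diff[OF s[of N] this] have w: "square_integrable w" by simp
  moreover have "(\<lambda>k. ip (\<lambda>x. s k x - w x) (\<lambda>x. s k x - w x)) \<longlonglongrightarrow> 0"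
  proof (rule LIMSEQ_I)
    fix e :: real assume e: "e > 0"
    obtain N where N: "\<forall>i\<ge>N. \<forall>j\<ge>N. ip (\<lambda>x. s i x - s j x) (\<lambda>x. s i x - s j x) < e / 2"
      using cauchy[of "e / 2"] e by auto
    have "norm (ip (\<lambda>x. s k x - w x) (\<lambda>x. s k x - w x) - 0) < e" if "k \<ge> N" for k
      using int(2)[OF _ that N] e ip_nonneg[of "\<lambda>x. s k x - w x"] by simp
    then show "\<exists>N. \<forall>k\<ge>N. norm (ip (\<lambda>x. s k x - w x) (\<lambda>x. s k x - w x) - 0) < e" by blast
  qed
  ultimately show ?thesis by blast
qed

lemma ip_tendsto:
  assumes s: "\<And>k. square_integrable (s k)" and w: "square_integrable w" and q: "square_integrable q"
    and lim: "(\<lambda>k. ip (\<lambda>x. s k x - w x) (\<lambda>x. s k x - w x)) \<longlonglongrightarrow> 0"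
  shows "(\<lambda>k. ip (s k) q) \<longlonglongrightarrow> ip w q"
proof -
  have "(\<lambda>k. ip (s k) q - ip w q) \<longlonglongrightarrow> 0"
  proof (rule Lim_null_comparison)
    show "\<forall>\<^sub>F k in sequentially. norm (ip (s k) q - ip w q) \<le>
       sqrt (ip (\<lambda>x. s k x - w x) (\<lambda>x. s k x - w x)) * sqrt (ip q q)"
    proof (rule always_eventually, rule allI)
      fix k
      have "sqrt ((ip (\<lambda>x. s k x - w x) q)\<^sup>2) \<le> sqrt (ip (\<lambda>x. s k x - w x) (\<lambda>x. s k x - w x) * ip q q)"
        by (intro real_sqrt_le_mono ip_cauchy_schwarz square_integrable_diff s w q)
      then show "norm (ip (s k) q - ip w q) \<le>
       sqrt (ip (\<lambda>x. s k x - w x) (\<lambda>x. s k x - w x)) * sqrt (ip q q)"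
        by (simp add: real_sqrt_mult ip_diff_left s w q)
    qed
    show "(\<lambda>k. sqrt (ip (\<lambda>x. s k x - w x) (\<lambda>x. s k x - w x)) * sqrt (ip q q)) \<longlonglongrightarrow> 0"
      using tendsto_mult_right[OF tendsto_real_sqrt[OF lim], of "sqrt (ip q q)"] by simp
  qed
  then show ?thesis by (rule LIM_zero_cancel)
qed

lemma weighted_square_tendsto:
  assumes s: "\<And>k. square_integrable (s k)" and w: "square_integrable w"
    and c: "continuous_on (sphere 0 1) c"
    and lim: "(\<lambda>k. ip (\<lambda>x. s k x - w x) (\<lambda>x. s k x - w x)) \<longlonglongrightarrow> 0"
  shows "(\<lambda>k. LINT x|(\<sigma> :: (real^'n) measure). c x * (s k x)\<^sup>2) \<longlonglongrightarrow> (LINT x|\<sigma>. c x * (w x)\<^sup>2)"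
proof -
  obtain B where B: "\<And>x. x \<in> sphere 0 1 \<Longrightarrow> \<bar>c x\<bar> \<le> B"
    using continuous_sphere_bounded[OF c] unfolding real_norm_def by blast
  have sq: "integrable \<sigma> (\<lambda>x. (v x)\<^sup>2)" if "square_integrable v" for v :: "real^'n \<Rightarrow> real"
    using that by (simp add: square_integrable_real_iff)
  have cw: "square_integrable (\<lambda>x. c x * w x)"
  proof -
    have "integrable \<sigma> (\<lambda>x. (c x)\<^sup>2 * (w x)\<^sup>2)"
      by (intro integrable_mult_continuous_sphere sq w continuous_intros c)
    then show ?thesis
      using w continuous_sphere_measurable[OF c]
      by (auto simp: square_integrable_real_iff power_mult_distrib intro: borel_measurable_times)
  qed
  let ?d = "\<lambda>k x. s k x - w x"
  have d: "square_integrable (?d k)" for k by (intro square_integrable_diff s w)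
  \<comment> \<open>\<open>s\<^sup>2 = (s - w)\<^sup>2 + 2 s w - w\<^sup>2\<close>; the first term is \<open>L\<^sup>1\<close>-small, the second converges weakly.\<close>
  have eq: "(LINT x|\<sigma>. c x * (s k x)\<^sup>2) = (LINT x|\<sigma>. c x * (?d k x)\<^sup>2) + 2 * ip (s k) (\<lambda>x. c x * w x)
      - (LINT x|\<sigma>. c x * (w x)\<^sup>2)" for k
  proof -
    have i: "integrable \<sigma> (\<lambda>x. c x * (?d k x)\<^sup>2)" "integrable \<sigma> (\<lambda>x. s k x * (c x * w x))"
      "integrable \<sigma> (\<lambda>x. c x * (w x)\<^sup>2)"
      using square_integrable_mult[OF s cw] by (auto intro!: integrable_mult_continuous_sphere sq d w c)
    have "(LINT x|\<sigma>. c x * (s k x)\<^sup>2) =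
       (LINT x|\<sigma>. c x * (?d k x)\<^sup>2 + 2 * (s k x * (c x * w x)) - c x * (w x)\<^sup>2)"
      by (intro Bochner_Integration.integral_cong) (auto simp: power2_eq_square algebra_simps)
    also have "\<dots> = (LINT x|\<sigma>. c x * (?d k x)\<^sup>2) + 2 * ip (s k) (\<lambda>x. c x * w x) - (LINT x|\<sigma>. c x * (w x)\<^sup>2)"
      using i by (simp add: ip_def)
    finally show ?thesis .
  qed
  have "(\<lambda>k. LINT x|\<sigma>. c x * (?d k x)\<^sup>2) \<longlonglongrightarrow> 0"
  proof (rule Lim_null_comparison)
    show "\<forall>\<^sub>F k in sequentially. norm (LINT x|\<sigma>. c x * (?d k x)\<^sup>2) \<le> B * ip (?d k) (?d k)"
    proof (rule always_eventually, rule allI)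
      fix k
      have "norm (LINT x|\<sigma>. c x * (?d k x)\<^sup>2) \<le> (LINT x|\<sigma>. norm (c x * (?d k x)\<^sup>2))"
        by (rule integral_norm_bound)
      also have "\<dots> \<le> (LINT x|\<sigma>. B * (?d k x)\<^sup>2)"
      proof (rule integral_mono)
        show "integrable \<sigma> (\<lambda>x. norm (c x * (?d k x)\<^sup>2))"
          by (intro integrable_norm integrable_mult_continuous_sphere sq d c)
        show "integrable \<sigma> (\<lambda>x. B * (?d k x)\<^sup>2)" using sq[OF d] by simp
        show "norm (c x * (?d k x)\<^sup>2) \<le> B * (?d k x)\<^sup>2" if "x \<in> space \<sigma>" for x
          using B[of x] that by (auto simp: abs_mult intro!: mult_right_mono)
      qed
      finally show "norm (LINT x|\<sigma>. c x * (?d k x)\<^sup>2) \<le> B * ip (?d k) (?d k)"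
        by (simp add: ip_def power2_eq_square)
    qed
    show "(\<lambda>k. B * ip (?d k) (?d k)) \<longlonglongrightarrow> 0"
      using tendsto_mult_left[OF lim, of B] by simp
  qed
  then have "(\<lambda>k. (LINT x|\<sigma>. c x * (?d k x)\<^sup>2) + 2 * ip (s k) (\<lambda>x. c x * w x) - (LINT x|\<sigma>. c x * (w x)\<^sup>2))
     \<longlonglongrightarrow> 0 + 2 * ip w (\<lambda>x. c x * w x) - (LINT x|\<sigma>. c x * (w x)\<^sup>2)"
    by (intro tendsto_intros ip_tendsto s w cw lim)
  moreover have "ip w (\<lambda>x. c x * w x) = (LINT x|\<sigma>. c x * (w x)\<^sup>2)"
    by (simp add: ip_def power2_eq_square algebra_simps)
  ultimately show ?thesis unfolding eq by simp
qed

section \<open>Green's formula and projections onto harmonics\<close>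

text \<open>The eigenvalues of \<open>-\<Delta>\<^sub>0\<close> on the sphere in \<open>\<real>\<^sup>d\<close>.\<close>

definition eigval :: "nat \<Rightarrow> nat \<Rightarrow> real" where
  "eigval d n = real n * (real n + real d - 2)"

lemma eigval_nonneg: "2 \<le> d \<Longrightarrow> eigval d n \<ge> 0"
  by (simp add: eigval_def)

lemma eigval_strict_mono: "2 \<le> d \<Longrightarrow> m < n \<Longrightarrow> eigval d m < eigval d n"
  unfolding eigval_def by (intro mult_strict_mono) auto

lemma eigval_ge: "2 \<le> d \<Longrightarrow> 1 \<le> n \<Longrightarrow> eigval d n \<ge> real d - 1"
  using eigval_strict_mono[of d 1 n] by (cases "n = 1") (auto simp: eigval_def)

definition tgrad :: "(real^'n \<Rightarrow> real) \<Rightarrow> 'n \<Rightarrow> real^'n \<Rightarrow> real" where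
  "tgrad p i x = tangential x (grad p x) $ i"

lemma tgrad_continuous: "has_gradient p D \<Longrightarrow> continuous_on S (tgrad p i)"
  unfolding tgrad_def[abs_def] tangential_def
  using continuous_on_subset[OF has_gradientD(2)] by (intro continuous_intros) auto

lemma square_integrable_tgrad: "p \<in> hpoly n \<Longrightarrow> square_integrable (tgrad p i)"
  by (intro square_integrable_continuous tgrad_continuous[OF hpoly_gradient])

text \<open>On the sphere the components of \<open>\<nabla>\<^sub>0 Q = \<nabla>Q - n Q x\<close> are polynomials \<open>q\<^sub>i\<close>. Integrate \<open>q\<^sub>i g\<^sub>i\<close> by parts and sum over
  \<open>i\<close>: the curvature terms cancel because \<open>\<nabla>\<^sub>0 Q\<close> is tangential, and Euler's identity together with \<open>\<Delta>Q = 0\<close> turns the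
  divergence of \<open>\<nabla>\<^sub>0 Q\<close> into \<open>-\<lambda>\<^sub>n Q\<close>.\<close>

lemma harmonics_green:
  fixes u :: "real^'n \<Rightarrow> real"
  assumes Q: "Q \<in> harmonics n" and w: "weak_gradient u g"
    and u: "square_integrable u" and g: "\<And>i. square_integrable (\<lambda>x. g x $ i)"
  shows "(\<Sum>i\<in>UNIV. ip (tgrad Q i) (\<lambda>x. g x $ i)) = eigval CARD('n) n * ip u Q"
proof -
  have Qh: "Q \<in> hpoly n" using Q by (rule harmonics_hpoly)
  \<comment> \<open>The components of \<open>\<nabla>\<^sub>0 Q\<close> and their gradients, as polynomials on the whole space.\<close>
  define q where "q i x = grad Q x $ i + (- real n) * (Q x * x $ i)" for i and x :: "real^'n"
  define D where "D i x = grad (\<lambda>y. grad Q y $ i) x +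
      (- real n) *\<^sub>R (x $ i *\<^sub>R grad Q x + Q x *\<^sub>R axis i 1)" for i and x :: "real^'n"
  have qD: "has_gradient (q i) (D i)" for i
    unfolding q_def[abs_def] D_def[abs_def]
    by (intro has_gradient_add has_gradient_scale has_gradient_mult has_gradient_coord hpoly_gradient[OF Qh]
        hpoly_gradient[OF hpoly_grad[OF Qh]])
  have on_sphere: "x \<bullet> x = 1" if "x \<in> sphere 0 1" for x :: "real^'n"
    using that by (simp add: norm_eq_1)
  have tq: "tgrad Q i x = q i x" for i x
    by (simp add: tgrad_def tangential_def q_def hpoly_euler[OF Qh])
  have Dx: "D i x \<bullet> x = (real n - 1) * grad Q x $ i - real n * (real n + 1) * (Q x * x $ i)" for i x
  proof -
    have "grad (\<lambda>y. grad Q y $ i) x \<bullet> x = (real n - 1) * grad Q x $ i"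
    proof (cases n)
      case 0
      then obtain c where "Q = (\<lambda>x. c)" using Qh by auto
      then have "grad Q = (\<lambda>x. 0)" by (simp add: grad_const)
      then show ?thesis by (simp add: grad_const)
    next
      case (Suc m)
      then show ?thesis using hpoly_euler[OF hpoly_grad[OF Qh, of i], of x] by simp
    qed
    then show ?thesis
      by (simp add: D_def inner_add_left inner_diff_left hpoly_euler[OF Qh] inner_axis' algebra_simps)
  qed
  have key: "(\<Sum>i\<in>UNIV. (real CARD('n) - 1) * x $ i * q i x - tangential x (D i x) $ i) = eigval CARD('n) n * Q x"
    if x: "x \<in> sphere 0 1" for x
  proof -
    note xx = on_sphere[OF x]
    have s1: "(\<Sum>i\<in>UNIV. x $ i * grad Q x $ i) = real n * Q x"
      using hpoly_euler[OF Qh, of x] by (simp add: inner_vec_def mult.commute)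
    have s2: "(\<Sum>i\<in>UNIV. x $ i * x $ i) = 1" using xx by (simp add: inner_vec_def)
    have "(\<Sum>i\<in>UNIV. x $ i * q i x) = 0"
      using s1 s2 by (simp add: q_def algebra_simps sum.distrib sum_subtractf sum_distrib_left[symmetric])
    then have a: "(\<Sum>i\<in>UNIV. (real CARD('n) - 1) * x $ i * q i x) = 0"
      by (simp add: mult.assoc sum_distrib_left[symmetric])
    have "(\<Sum>i\<in>UNIV. D i x $ i) = (\<Sum>i\<in>UNIV. grad (\<lambda>y. grad Q y $ i) x $ i
         - real n * (x $ i * grad Q x $ i) - real n * Q x)"
      by (intro sum.cong) (auto simp: D_def axis_def algebra_simps)
    also have "\<dots> = lap Q x - real n * (real n * Q x) - real CARD('n) * (real n * Q x)"
      by (simp add: sum_subtractf sum_distrib_left[symmetric] s1 lap_def)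
    also have "lap Q x = 0" using Q by (simp add: harmonics_def)
    finally have b: "(\<Sum>i\<in>UNIV. D i x $ i) = - real n * (real n + real CARD('n)) * Q x"
      by (simp add: algebra_simps)
    have "(\<Sum>i\<in>UNIV. (D i x \<bullet> x) * x $ i) =
        (\<Sum>i\<in>UNIV. (real n - 1) * (x $ i * grad Q x $ i) - real n * (real n + 1) * Q x * (x $ i * x $ i))"
      unfolding Dx by (intro sum.cong) (auto simp: algebra_simps)
    also have "\<dots> = (real n - 1) * (real n * Q x) - real n * (real n + 1) * Q x"
      by (simp only: sum_subtractf sum_distrib_left[symmetric] s1 s2)
    finally have c: "(\<Sum>i\<in>UNIV. (D i x \<bullet> x) * x $ i) = - 2 * real n * Q x"
      by (simp add: algebra_simps)
    have "(\<Sum>i\<in>UNIV. (real CARD('n) - 1) * x $ i * q i x - tangential x (D i x) $ i) =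
       (\<Sum>i\<in>UNIV. (real CARD('n) - 1) * x $ i * q i x) - ((\<Sum>i\<in>UNIV. D i x $ i) - (\<Sum>i\<in>UNIV. (D i x \<bullet> x) * x $ i))"
      by (simp add: tangential_def sum_subtractf)
    then show ?thesis
      unfolding a b c by (simp add: eigval_def algebra_simps)
  qed
  have cont: "continuous_on (sphere 0 1) (\<lambda>x. (real CARD('n) - 1) * x $ i * q i x - tangential x (D i x) $ i)" for i
    using has_gradient_continuous[OF qD[of i]] qD[of i] unfolding tangential_def has_gradient_def
    by (intro continuous_intros) (auto intro: continuous_on_subset)
  have "(\<Sum>i\<in>UNIV. ip (tgrad Q i) (\<lambda>x. g x $ i)) =
      (\<Sum>i\<in>UNIV. LINT x|\<sigma>. ((real CARD('n) - 1) * x $ i * q i x - tangential x (D i x) $ i) * u x)"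
    unfolding ip_def tq
    by (intro sum.cong refl weak_gradient_integral_sphere[OF w square_integrable_integrable[OF u]
        square_integrable_integrable[OF g] qD])
  also have "\<dots> = (LINT x|\<sigma>. (\<Sum>i\<in>UNIV. ((real CARD('n) - 1) * x $ i * q i x - tangential x (D i x) $ i) * u x))"
    by (intro Bochner_Integration.integral_sum[symmetric] integrable_mult_continuous_sphere
        square_integrable_integrable u cont)
  also have "\<dots> = (LINT x|\<sigma>. eigval CARD('n) n * (u x * Q x))"
    by (intro Bochner_Integration.integral_cong refl)
       (simp add: sum_distrib_right[symmetric] key del: mem_sphere_0)
  also have "\<dots> = eigval CARD('n) n * ip u Q"
    by (simp add: ip_def)
  finally show ?thesis .
qed

lemma harmonics_green_harmonics:
  fixes P Q :: "real^'n \<Rightarrow> real"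
  assumes "P \<in> harmonics m" "Q \<in> harmonics n"
  shows "(\<Sum>i\<in>UNIV. ip (tgrad Q i) (tgrad P i)) = eigval CARD('n) n * ip P Q"
proof -
  have "weak_gradient P (\<lambda>x. tangential x (grad P x))"
    by (rule weak_gradient_smooth[OF hpoly_gradient[OF harmonics_hpoly[OF assms(1)]]])
  from harmonics_green[OF assms(2) this] square_integrable_tgrad[OF harmonics_hpoly[OF assms(1)]]
    square_integrable_harmonics[OF assms(1)]
  show ?thesis unfolding tgrad_def[abs_def] by simp
qed

text \<open>Green's formula is symmetric in the two harmonics, so \<open>\<lambda>\<^sub>n \<langle>P, Q\<rangle> = \<lambda>\<^sub>m \<langle>P, Q\<rangle>\<close>; for \<open>d \<ge> 2\<close> the eigenvalues of different
  degrees are different.\<close>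

lemma harmonics_orthogonal:
  fixes P Q :: "real^'n \<Rightarrow> real"
  assumes d: "2 \<le> CARD('n)" and P: "P \<in> harmonics m" and Q: "Q \<in> harmonics n" and "m \<noteq> n"
  shows "ip P Q = 0"
proof -
  have "eigval CARD('n) n * ip P Q = eigval CARD('n) m * ip Q P"
    unfolding harmonics_green_harmonics[OF P Q, symmetric] harmonics_green_harmonics[OF Q P, symmetric]
    by (intro sum.cong refl ip_commute)
  then have "(eigval CARD('n) n - eigval CARD('n) m) * ip P Q = 0"
    by (simp add: ip_commute[of Q] left_diff_distrib)
  moreover have "eigval CARD('n) n \<noteq> eigval CARD('n) m"
    using eigval_strict_mono[OF d, of m n] eigval_strict_mono[OF d, of n m] \<open>m \<noteq> n\<close>
    by (cases "m < n") auto
  ultimately show ?thesis by simp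
qed

text \<open>In polar coordinates a weighted integral of \<open>p\<^sup>2\<close> over an annulus vanishes, so \<open>p\<close> vanishes there by continuity, and
  everywhere by homogeneity.\<close>

lemma hpoly_definite:
  fixes p :: "real^'n \<Rightarrow> real"
  assumes p: "p \<in> hpoly n" and z: "ip p p = 0"
  shows "p = (\<lambda>x. 0)"
proof -
  have b: "bump \<in> borel_measurable borel" "bump 0 = 0"
    using borel_measurable_continuous_onI[of bump] continuous_bump[of UNIV "\<lambda>x. x"] bump_outside[of 0] by auto
  have bi: "integrable lborel (\<lambda>r. indicator {0<..} r * r ^ (CARD('n) - 1) * bump r)"
  proof -
    have "integrable lborel (\<lambda>r. indicator {1..2} r *\<^sub>R (r ^ (CARD('n) - 1) * bump r))"
      by (intro borel_integrable_compact continuous_intros) auto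
    also have "(\<lambda>r. indicator {1..2} r *\<^sub>R (r ^ (CARD('n) - 1) * bump r)) =
        (\<lambda>r. indicator {0<..} r * r ^ (CARD('n) - 1) * bump r)"
      using bump_outside by (auto simp: indicator_def fun_eq_iff)
    finally show ?thesis .
  qed
  have ui: "integrable \<sigma> (\<lambda>x. p x * p x)"
    by (intro square_integrable_mult square_integrable_hpoly[OF p])
  have ns: "norm x *\<^sub>R sgn x = x" for x :: "real^'n"
    by (cases "x = 0") (simp_all add: sgn_div_norm)
  note P = polar_integrable[OF b bi ui] polar_integral[OF b bi ui]
  have "(LINT x|lborel. bump (norm x) * (p (sgn x) * p (sgn x))) = 0"
    using P(2) z by (simp add: ip_def)
  then have "AE x in lborel. bump (norm x) * (p (sgn x) * p (sgn x)) = 0"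
    by (subst (asm) integral_nonneg_eq_0_iff_AE[OF P(1)]) (auto simp: bump_def)
  define S where "S = {x. norm x < 2} \<inter> {x. 1 < norm x} \<inter> {x. p x \<noteq> 0}"
  have oS: "open S"
    unfolding S_def
    by (intro open_Int open_Collect_less open_Collect_neq continuous_intros hpoly_continuous[OF p])
  have "AE x in lborel. x \<notin> S"
    using \<open>AE x in lborel. _\<close>
  proof eventually_elim
    case (elim x)
    show ?case
    proof
      assume x: "x \<in> S"
      then have "bump (norm x) > 0" by (auto simp: S_def bump_def max_def mult_le_0_iff)
      with elim have "p (sgn x) = 0" by auto
      then have "p (norm x *\<^sub>R sgn x) = 0" unfolding hpoly_homogeneous[OF p] by simp
      then show False using x by (simp add: S_def ns)
    qed
  qed
  then have "emeasure lborel S = 0"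
    using oS by (subst (asm) AE_iff_measurable[of S]) auto
  moreover have "emeasure lborel S \<noteq> 0" if "x \<in> S" for x
  proof -
    obtain e where e: "e > 0" "ball x e \<subseteq> S" using oS \<open>x \<in> S\<close> open_contains_ball by blast
    have "emeasure lborel (ball x e) \<le> emeasure lborel S" using e oS by (intro emeasure_mono) auto
    moreover have "emeasure lborel (ball x e) \<noteq> 0"
      using content_ball_pos[OF e(1), of x] by (auto simp: measure_def)
    ultimately show ?thesis by auto
  qed
  ultimately have S: "x \<notin> S" for x by blast
  have "p x = 0" for x
  proof (cases "x = 0")
    case False
    have "p ((3/2) *\<^sub>R sgn x) = 0"
      using S[of "(3/2) *\<^sub>R sgn x"] False by (auto simp: S_def norm_sgn)
    then have "p (sgn x) = 0" by (simp add: hpoly_homogeneous[OF p])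
    then have "p (norm x *\<^sub>R sgn x) = 0" unfolding hpoly_homogeneous[OF p] by simp
    then show ?thesis by (simp add: ns)
  next
    case True
    have "p (axis undefined 1) = 0"
      using S[of "(3/2) *\<^sub>R axis undefined 1"] by (auto simp: S_def hpoly_homogeneous[OF p])
    then show ?thesis using hpoly_homogeneous[OF p, of 0 "axis undefined 1"] True by simp
  qed
  then show ?thesis by auto
qed

text \<open>Gram--Schmidt, one spanning function at a time. The inner product is only semidefinite on functions; a new direction
  \<open>v\<close> of norm \<open>0\<close> is orthogonal to everything by Cauchy--Schwarz and gets the coefficient \<open>0\<close>, as \<open>x / 0 = 0\<close>.\<close>

lemma finite_span_projection:
  fixes W B :: "(real^'n \<Rightarrow> real) set"
  assumes "finite B" "\<And>b. b \<in> B \<Longrightarrow> square_integrable b"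
    and "\<And>w. w \<in> W \<Longrightarrow> \<exists>c. w = (\<lambda>x. \<Sum>b\<in>B. c b * b x)"
    and "(\<lambda>x. 0) \<in> W" "\<And>v w. v \<in> W \<Longrightarrow> w \<in> W \<Longrightarrow> (\<lambda>x. v x + w x) \<in> W"
    and "\<And>c w. w \<in> W \<Longrightarrow> (\<lambda>x. c * w x) \<in> W"
    and "square_integrable u"
  shows "\<exists>p\<in>W. \<forall>w\<in>W. ip u w = ip p w"
  using assms
proof (induction B arbitrary: W u rule: finite_induct)
  case empty
  then have z: "w = (\<lambda>x. 0)" if "w \<in> W" for w using that by fastforce
  have "\<forall>w\<in>W. ip u w = ip (\<lambda>x. 0) w"
  proof (intro ballI)
    fix w assume "w \<in> W"
    then have "w = (\<lambda>x. 0)" by (rule z)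
    then show "ip u w = ip (\<lambda>x. 0) w" by (simp add: ip_def)
  qed
  then show ?case using empty.prems(3) by blast
next
  case (insert b B)
  note W0 = insert.prems(3) and Wa = insert.prems(4) and Ws = insert.prems(5)
  have Wd: "(\<lambda>x. v x - w x) \<in> W" if "v \<in> W" "w \<in> W" for v w
    using Wa[OF that(1) Ws[OF that(2), of "-1"]] by simp
  have sW: "square_integrable w" if "w \<in> W" for w
  proof -
    obtain c where c: "w = (\<lambda>x. \<Sum>b\<in>insert b B. c b * b x)" using insert.prems(2)[OF \<open>w \<in> W\<close>] by blast
    show ?thesis unfolding c using insert.hyps insert.prems(1)
      by (intro square_integrable_sum square_integrable_scale) auto
  qed
  define W' where "W' = {w \<in> W. \<exists>c. w = (\<lambda>x. \<Sum>b\<in>B. c b * b x)}"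
  have W'I: "w \<in> W'" if "w \<in> W" "w = (\<lambda>x. \<Sum>b\<in>B. c b * b x)" for w c
    unfolding W'_def using that by blast
  have W'E: "\<exists>c. w = (\<lambda>x. \<Sum>b\<in>B. c b * b x)" if "w \<in> W'" for w
    using that unfolding W'_def by blast
  have W'W: "W' \<subseteq> W" by (auto simp: W'_def)
  have IH: "\<exists>p\<in>W'. \<forall>w\<in>W'. ip v w = ip p w" if "square_integrable v" for v
  proof (rule insert.IH)
    show "square_integrable c" if "c \<in> B" for c using insert.prems(1) that by simp
    show "\<exists>c. w = (\<lambda>x. \<Sum>b\<in>B. c b * b x)" if "w \<in> W'" for w using that by (rule W'E)
    show "(\<lambda>x. 0) \<in> W'" by (rule W'I[OF W0, of "\<lambda>_. 0"]) simp
    show "(\<lambda>x. v x + w x) \<in> W'" if vw: "v \<in> W'" "w \<in> W'" for v w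
    proof -
      from W'E[OF vw(1)] obtain c where c: "v = (\<lambda>x. \<Sum>b\<in>B. c b * b x)" ..
      from W'E[OF vw(2)] obtain e where e: "w = (\<lambda>x. \<Sum>b\<in>B. e b * b x)" ..
      have eq: "(\<lambda>x. v x + w x) = (\<lambda>x. \<Sum>b\<in>B. (c b + e b) * b x)"
        unfolding c e by (simp add: sum.distrib distrib_right)
      show ?thesis by (rule W'I[OF Wa eq]) (use vw W'W in blast)+
    qed
    show "(\<lambda>x. t * w x) \<in> W'" if w: "w \<in> W'" for t w
    proof -
      from W'E[OF w] obtain c where c: "w = (\<lambda>x. \<Sum>b\<in>B. c b * b x)" ..
      have eq: "(\<lambda>x. t * w x) = (\<lambda>x. \<Sum>b\<in>B. (t * c b) * b x)"
        unfolding c by (simp add: sum_distrib_left mult.assoc)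
      show ?thesis by (rule W'I[OF Ws eq]) (use w W'W in blast)
    qed
  qed (use that in auto)
  show ?case
  proof (cases "W \<subseteq> W'")
    case True
    then show ?thesis using IH[OF insert.prems(6)] W'W by blast
  next
    case False
    then obtain w0 where w0: "w0 \<in> W" "w0 \<notin> W'" by blast
    from insert.prems(2)[OF w0(1)] obtain c0 where
      "w0 = (\<lambda>x. \<Sum>b\<in>insert b B. c0 b * b x)" ..
    then have c0: "w0 = (\<lambda>x. c0 b * b x + (\<Sum>b\<in>B. c0 b * b x))"
      using insert.hyps by simp
    have c0b: "c0 b \<noteq> 0"
    proof
      assume "c0 b = 0"
      then have "w0 = (\<lambda>x. \<Sum>b\<in>B. c0 b * b x)" using c0 by simp
      from W'I[OF w0(1) this] w0(2) show False by simp
    qed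
    obtain p0 where p0: "p0 \<in> W'" "\<And>w. w \<in> W' \<Longrightarrow> ip w0 w = ip p0 w" using IH[OF sW[OF w0(1)]] by blast
    obtain p' where p': "p' \<in> W'" "\<And>w. w \<in> W' \<Longrightarrow> ip u w = ip p' w" using IH[OF insert.prems(6)] by blast
    define v where "v = (\<lambda>x. w0 x - p0 x)"
    have vW: "v \<in> W" unfolding v_def using Wd[OF w0(1)] p0(1) W'W by blast
    note sq = sW[OF vW] sW[OF w0(1)] insert.prems(6)
    have sq': "square_integrable w" if "w \<in> W'" for w using that W'W sW by blast
    have orth: "ip v w = 0" if "w \<in> W'" for w
      unfolding v_def using p0(2)[OF that] by (simp add: ip_diff_left sq sq' p0(1) that)
    have split: "\<exists>t. \<exists>w'\<in>W'. w = (\<lambda>x. t * v x + w' x)" if w: "w \<in> W" for w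
    proof -
      from insert.prems(2)[OF w] obtain c where
        "w = (\<lambda>x. \<Sum>b\<in>insert b B. c b * b x)" ..
      then have c: "w = (\<lambda>x. c b * b x + (\<Sum>b\<in>B. c b * b x))"
        using insert.hyps by simp
      define t where "t = c b / c0 b"
      define w1 where "w1 = (\<lambda>x. w x - t * w0 x)"
      have "w1 = (\<lambda>x. \<Sum>b\<in>B. (c b - t * c0 b) * b x)"
        unfolding w1_def c c0 using c0b
        by (simp add: t_def sum_subtractf sum_distrib_left algebra_simps)
      moreover have "w1 \<in> W" unfolding w1_def by (intro Wd w Ws w0)
      ultimately have w1: "w1 \<in> W'" by (rule W'I[rotated])
      from W'E[OF w1] obtain e1 where e1: "w1 = (\<lambda>x. \<Sum>b\<in>B. e1 b * b x)" ..
      from W'E[OF p0(1)] obtain e2 where e2: "p0 = (\<lambda>x. \<Sum>b\<in>B. e2 b * b x)" ..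
      have "(\<lambda>x. w1 x + t * p0 x) = (\<lambda>x. \<Sum>b\<in>B. (e1 b + t * e2 b) * b x)"
        unfolding e1 e2 by (simp add: sum.distrib sum_distrib_left algebra_simps)
      moreover have "(\<lambda>x. w1 x + t * p0 x) \<in> W"
        using w1 p0(1) W'W by (intro Wa Ws) auto
      ultimately have "(\<lambda>x. w1 x + t * p0 x) \<in> W'" by (rule W'I[rotated])
      moreover have "w = (\<lambda>x. t * v x + (w1 x + t * p0 x))"
        by (simp add: v_def w1_def algebra_simps)
      ultimately show ?thesis by (intro exI[of _ t] bexI[of _ "\<lambda>x. w1 x + t * p0 x"])
    qed
    \<comment> \<open>\<open>v\<close> spans the orthogonal complement of \<open>W'\<close> in \<open>W\<close>.\<close>
    define a where "a = ip u v / ip v v"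
    define p where "p = (\<lambda>x. p' x + a * v x)"
    have pW: "p \<in> W" unfolding p_def using p'(1) W'W by (intro Wa Ws vW) auto
    have uv: "ip u v = a * ip v v"
    proof (cases "ip v v = 0")
      case True
      then have "(ip u v)\<^sup>2 \<le> 0" using ip_cauchy_schwarz[OF sq(3) sq(1)] by simp
      then show ?thesis using True by simp
    qed (simp add: a_def)
    have "ip u w = ip p w" if "w \<in> W" for w
    proof -
      from split[OF that] obtain t where "\<exists>w'\<in>W'. w = (\<lambda>x. t * v x + w' x)" ..
      then obtain w' where w': "w' \<in> W'" "w = (\<lambda>x. t * v x + w' x)" ..
      have ex: "ip z w = t * ip z v + ip z w'" if "square_integrable z" for z
        unfolding w'(2) ip_commute[of z]
        by (simp add: ip_add_left ip_scale_left square_integrable_scale sq sq' w' that)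
      have "ip p v = ip u v" "ip p w' = ip u w'"
        unfolding p_def using orth[OF w'(1)] orth[OF p'(1)] p'(2)[OF w'(1)] uv
        by (simp_all add: ip_add_left ip_scale_left square_integrable_scale sq sq' w' p'(1) ip_commute[of p' v])
      then show ?thesis using ex[OF sq(3)] ex[OF sW[OF pW]] by simp
    qed
    then show ?thesis using pW by blast
  qed
qed

text \<open>The counterpart of \<open>proj\<close> for real functions, with values in polynomials on all of \<open>\<real>\<^sup>d\<close> instead of functions on the
  sphere.\<close>

definition rproj :: "nat \<Rightarrow> (real^'n \<Rightarrow> real) \<Rightarrow> real^'n \<Rightarrow> real" where
  "rproj n u = (THE p. p \<in> harmonics n \<and> (\<forall>q\<in>harmonics n. ip u q = ip p q))"

lemma rproj_unique:
  assumes "p \<in> harmonics n" "p' \<in> harmonics n" "\<And>q. q \<in> harmonics n \<Longrightarrow> ip p q = ip p' q"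
  shows "p = p'"
proof -
  have "(\<lambda>x. p x + (-1) * p' x) \<in> harmonics n"
    by (intro harmonics_add harmonics_scale assms)
  then have d: "(\<lambda>x. p x - p' x) \<in> harmonics n" by simp
  have "ip (\<lambda>x. p x - p' x) (\<lambda>x. p x - p' x) = 0"
    using assms(3)[OF d] by (simp add: ip_diff_left square_integrable_harmonics[OF assms(1)]
      square_integrable_harmonics[OF assms(2)] square_integrable_harmonics[OF d])
  from hpoly_definite[OF harmonics_hpoly[OF d] this] show ?thesis
    by (auto simp: fun_eq_iff)
qed

lemma
  fixes u :: "real^'n \<Rightarrow> real"
  assumes u: "square_integrable u"
  shows rproj_harmonics: "rproj n u \<in> harmonics n"
    and rproj_ip: "q \<in> harmonics n \<Longrightarrow> ip u q = ip (rproj n u) q"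
proof -
  from hpoly_finite_spanning[where 'n='n, of n] obtain B :: "(real^'n \<Rightarrow> real) set" where B':
    "finite B \<and> B \<subseteq> hpoly n \<and> (\<forall>p\<in>hpoly n. \<exists>c. p = (\<lambda>x. \<Sum>b\<in>B. c b * b x))" ..
  then have B: "finite B" "B \<subseteq> hpoly n" "\<forall>p\<in>hpoly n. \<exists>c. p = (\<lambda>x. \<Sum>b\<in>B. c b * b x)"
    by simp_all
  define P where "P p \<longleftrightarrow> p \<in> harmonics n \<and> (\<forall>q\<in>harmonics n. ip u q = ip p q)" for p
  have "\<exists>p\<in>harmonics n. \<forall>q\<in>harmonics n. ip u q = ip p q"
  proof (rule finite_span_projection[OF B(1)])
    show "square_integrable b" if "b \<in> B" for b using that B(2) square_integrable_hpoly by blast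
    show "\<exists>c. w = (\<lambda>x. \<Sum>b\<in>B. c b * b x)" if "w \<in> harmonics n" for w
      using B(3) harmonics_hpoly[OF that] by (rule bspec)
  qed (auto intro: harmonics_zero harmonics_add harmonics_scale u)
  then obtain p where p: "P p" unfolding P_def by blast
  have "\<exists>!p. P p"
  proof (rule ex1I[of P p, OF p])
    fix p' assume "P p'"
    with p show "p' = p" unfolding P_def by (intro rproj_unique[of p' n p]) auto
  qed
  then have "P (THE p. P p)" by (rule theI')
  moreover have "rproj n u = (THE p. P p)" by (simp add: rproj_def P_def)
  ultimately have "P (rproj n u)" by simp
  then show "rproj n u \<in> harmonics n" "q \<in> harmonics n \<Longrightarrow> ip u q = ip (rproj n u) q"
    by (auto simp: P_def)
qed

lemma rproj_eqI:
  assumes "square_integrable u" "p \<in> harmonics n" "\<And>q. q \<in> harmonics n \<Longrightarrow> ip u q = ip p q"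
  shows "rproj n u = p"
  by (rule rproj_unique[OF rproj_harmonics[OF assms(1)] assms(2)])
     (use rproj_ip[OF assms(1)] assms(3) in auto)

text \<open>The index \<open>i\<close> stands for the components of a vector field. Only the sum over \<open>i\<close> of the inner products is assumed to
  vanish, because this is all that Green's formula gives for gradients of harmonics.\<close>

lemma orthogonal_series_converges:
  fixes v :: "nat \<Rightarrow> 'i::finite \<Rightarrow> real^'n \<Rightarrow> real"
  assumes sq: "\<And>n i. square_integrable (v n i)"
    and orth: "\<And>m n. m \<noteq> n \<Longrightarrow> (\<Sum>i\<in>UNIV. ip (v m i) (v n i)) = 0"
    and sm: "summable (\<lambda>n. \<Sum>i\<in>UNIV. ip (v n i) (v n i))"
  shows "\<exists>w. \<forall>i. square_integrable (w i) \<and>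
     (\<lambda>k. ip (\<lambda>x. (\<Sum>n<k. v n i x) - w i x) (\<lambda>x. (\<Sum>n<k. v n i x) - w i x)) \<longlonglongrightarrow> 0"
proof -
  let ?S = "\<lambda>k i x. \<Sum>n<k. v n i x"
  let ?e = "\<lambda>n. \<Sum>i\<in>UNIV. ip (v n i) (v n i)"
  have sS: "square_integrable (?S k i)" for k i by (intro square_integrable_sum sq) auto
  have tail: "ip (\<lambda>x. ?S k i x - ?S j i x) (\<lambda>x. ?S k i x - ?S j i x) \<le> sum ?e {j..<k}"
    if "j \<le> k" for j k i
  proof -
    have eq: "(\<lambda>x. ?S k i x - ?S j i x) = (\<lambda>x. \<Sum>n\<in>{j..<k}. v n i x)" for i
    proof
      fix x
      have "{..<k} - {..<j} = {j..<k}" by auto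
      then show "?S k i x - ?S j i x = (\<Sum>n\<in>{j..<k}. v n i x)"
        using sum_diff[of "{..<k}" "{..<j}" "\<lambda>n. v n i x"] that by auto
    qed
    have "ip (\<lambda>x. ?S k i x - ?S j i x) (\<lambda>x. ?S k i x - ?S j i x) \<le>
       (\<Sum>i\<in>UNIV. ip (\<lambda>x. \<Sum>n\<in>{j..<k}. v n i x) (\<lambda>x. \<Sum>n\<in>{j..<k}. v n i x))"
      unfolding eq by (rule member_le_sum[of i UNIV]) (auto simp: ip_nonneg)
    also have "\<dots> = (\<Sum>i\<in>UNIV. \<Sum>m\<in>{j..<k}. \<Sum>n\<in>{j..<k}. ip (v m i) (v n i))"
      by (simp add: ip_sum_left ip_sum_right sq square_integrable_sum)
    also have "\<dots> = (\<Sum>m\<in>{j..<k}. \<Sum>n\<in>{j..<k}. \<Sum>i\<in>UNIV. ip (v m i) (v n i))"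
      by (subst sum.swap, intro sum.cong refl, rule sum.swap)
    also have "\<dots> = (\<Sum>m\<in>{j..<k}. \<Sum>n\<in>{j..<k}. if n = m then ?e m else 0)"
      by (intro sum.cong refl) (auto simp: orth)
    also have "\<dots> = sum ?e {j..<k}" by simp
    finally show ?thesis .
  qed
  have cauchy: "\<exists>N. \<forall>k\<ge>N. \<forall>j\<ge>N. ip (\<lambda>x. ?S k i x - ?S j i x) (\<lambda>x. ?S k i x - ?S j i x) < e"
    if e: "e > 0" for e i
  proof -
    obtain N where N: "\<And>j k. j \<ge> N \<Longrightarrow> norm (sum ?e {j..<k}) < e"
      using sm e unfolding summable_Cauchy by blast
    have *: "ip (\<lambda>x. ?S k i x - ?S j i x) (\<lambda>x. ?S k i x - ?S j i x) < e" if "j \<le> k" "j \<ge> N" for j k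
      using tail[OF that(1), of i] N[OF that(2), of k] by simp
    have sym: "ip (\<lambda>x. ?S k i x - ?S j i x) (\<lambda>x. ?S k i x - ?S j i x) =
      ip (\<lambda>x. ?S j i x - ?S k i x) (\<lambda>x. ?S j i x - ?S k i x)" for j k
      unfolding ip_def by (intro Bochner_Integration.integral_cong) (auto simp: algebra_simps)
    show ?thesis
    proof (intro exI[of _ N] allI impI)
      fix k j assume "k \<ge> N" "j \<ge> N"
      then show "ip (\<lambda>x. ?S k i x - ?S j i x) (\<lambda>x. ?S k i x - ?S j i x) < e"
        using *[of j k] *[of k j] sym[of k j] by (cases "j \<le> k") auto
    qed
  qed
  have "\<forall>i. \<exists>w. square_integrable w \<and> (\<lambda>k. ip (\<lambda>x. ?S k i x - w x) (\<lambda>x. ?S k i x - w x)) \<longlonglongrightarrow> 0"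
    by (intro allI square_integrable_complete[OF sS cauchy])
  then show ?thesis by (rule choice)
qed

section \<open>Expansion into harmonics\<close>

lemma square_integrable_rproj_sum:
  "square_integrable u \<Longrightarrow> square_integrable (\<lambda>x. \<Sum>n<k. rproj n u x)"
  by (intro square_integrable_sum square_integrable_harmonics[OF rproj_harmonics]) auto

lemma harmonics_complete:
  fixes u :: "real^'n \<Rightarrow> real"
  assumes u: "square_integrable u" and orth: "\<And>n q. q \<in> harmonics n \<Longrightarrow> ip u q = 0"
  shows "AE x in \<sigma>. u x = 0"
proof (rule polynomials_complete)
  show ui: "integrable \<sigma> u" using u by (rule square_integrable_integrable)
  fix p :: "real^'n \<Rightarrow> real" assume "real_polynomial_function p"
  from real_polynomial_sum_hpoly[OF this] obtain N P where
    P: "\<And>k. P k \<in> hpoly k" "p = (\<lambda>x. \<Sum>k\<le>N. P k x)" by blast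
  have "(LINT x|\<sigma>. P k x * u x) = 0" for k
  proof -
    obtain h where h: "\<And>j. h j \<in> harmonics j" "\<And>x. x \<in> sphere 0 1 \<Longrightarrow> P k x = (\<Sum>j\<le>k. h j x)"
      using hpoly_sphere_sum_harmonics[OF P(1)[of k]] by blast
    have "(LINT x|\<sigma>. P k x * u x) = (LINT x|\<sigma>. (\<Sum>j\<le>k. h j x) * u x)"
      by (intro Bochner_Integration.integral_cong) (auto simp: h(2) simp del: mem_sphere_0)
    also have "\<dots> = ip (\<lambda>x. \<Sum>j\<le>k. h j x) u" by (simp add: ip_def)
    also have "\<dots> = (\<Sum>j\<le>k. ip (h j) u)"
      by (intro ip_sum_left square_integrable_harmonics[OF h(1)] u) auto
    also have "\<dots> = 0" using orth[OF h(1)] by (simp add: ip_commute[of _ u])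
    finally show ?thesis .
  qed
  moreover have "(LINT x|\<sigma>. p x * u x) = (\<Sum>k\<le>N. LINT x|\<sigma>. P k x * u x)"
    unfolding P(2) sum_distrib_right
    by (intro Bochner_Integration.integral_sum integrable_mult_continuous_sphere ui hpoly_continuous[OF P(1)])
  ultimately show "(LINT x|\<sigma>. p x * u x) = 0" by simp
qed

lemma harmonic_sum_ip:
  fixes P :: "nat \<Rightarrow> real^'n \<Rightarrow> real"
  assumes d: "2 \<le> CARD('n)" and P: "\<And>n. P n \<in> harmonics n"
    and q: "q \<in> harmonics m" and "m < k"
  shows "ip (\<lambda>x. \<Sum>n<k. P n x) q = ip (P m) q"
proof -
  have "ip (\<lambda>x. \<Sum>n<k. P n x) q = (\<Sum>n<k. ip (P n) q)"
    by (intro ip_sum_left square_integrable_harmonics[OF P] square_integrable_harmonics[OF q]) auto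
  also have "\<dots> = (\<Sum>n<k. if n = m then ip (P m) q else 0)"
    using harmonics_orthogonal[OF d P q] by (intro sum.cong) auto
  finally show ?thesis using \<open>m < k\<close> by simp
qed

text \<open>Inner products with a fixed harmonic of degree \<open>m\<close> are constant along the partial sums beyond \<open>m\<close>.\<close>

lemma riesz_fischer:
  fixes P :: "nat \<Rightarrow> real^'n \<Rightarrow> real"
  assumes d: "2 \<le> CARD('n)" and P: "\<And>n. P n \<in> harmonics n"
    and sm: "summable (\<lambda>n. ip (P n) (P n))"
  shows "\<exists>w. square_integrable w \<and> (\<forall>n. rproj n w = P n) \<and>
    (\<lambda>k. ip (\<lambda>x. (\<Sum>n<k. P n x) - w x) (\<lambda>x. (\<Sum>n<k. P n x) - w x)) \<longlonglongrightarrow> 0"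
proof -
  have "\<exists>w. \<forall>i::unit. square_integrable (w i) \<and>
     (\<lambda>k. ip (\<lambda>x. (\<Sum>n<k. P n x) - w i x) (\<lambda>x. (\<Sum>n<k. P n x) - w i x)) \<longlonglongrightarrow> 0"
    by (rule orthogonal_series_converges[where v = "\<lambda>n i. P n"])
       (use square_integrable_harmonics[OF P] harmonics_orthogonal[OF d P P] sm in auto)
  then obtain w where w: "square_integrable w"
    "(\<lambda>k. ip (\<lambda>x. (\<Sum>n<k. P n x) - w x) (\<lambda>x. (\<Sum>n<k. P n x) - w x)) \<longlonglongrightarrow> 0"
    by blast
  have "rproj m w = P m" for m
  proof (rule rproj_eqI[OF w(1) P])
    fix q :: "real^'n \<Rightarrow> real" assume q: "q \<in> harmonics m"
    have "(\<lambda>k. ip (\<lambda>x. \<Sum>n<k. P n x) q) \<longlonglongrightarrow> ip w q"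
      by (rule ip_tendsto[OF _ w(1) square_integrable_harmonics[OF q] w(2)])
         (intro square_integrable_sum square_integrable_harmonics[OF P], simp)
    moreover have "\<forall>\<^sub>F k in sequentially. ip (\<lambda>x. \<Sum>n<k. P n x) q = ip (P m) q"
      using eventually_gt_at_top[of m] by eventually_elim (rule harmonic_sum_ip[OF d P q])
    then have "(\<lambda>k. ip (\<lambda>x. \<Sum>n<k. P n x) q) \<longlonglongrightarrow> ip (P m) q"
      by (rule tendsto_eventually)
    ultimately show "ip w q = ip (P m) q" by (rule LIMSEQ_unique)
  qed
  with w show ?thesis by blast
qed

text \<open>The partial sums converge by Bessel's inequality. Their limit has the same projections as \<open>u\<close>, hence equals \<open>u\<close> almost
  everywhere by completeness.\<close>

lemma
  fixes u :: "real^'n \<Rightarrow> real"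
  assumes d: "2 \<le> CARD('n)" and u: "square_integrable u"
  shows parseval_convergence: "(\<lambda>k. ip (\<lambda>x. (\<Sum>n<k. rproj n u x) - u x) (\<lambda>x. (\<Sum>n<k. rproj n u x) - u x)) \<longlonglongrightarrow> 0"
    and parseval: "(\<lambda>n. ip (rproj n u) (rproj n u)) sums ip u u"
proof -
  let ?S = "\<lambda>k x. \<Sum>n<k. rproj n u x"
  note P = rproj_harmonics[OF u] and sP = square_integrable_harmonics[OF rproj_harmonics[OF u]]
  have sS: "square_integrable (?S k)" for k by (rule square_integrable_rproj_sum[OF u])
  have uS: "ip u (?S k) = (\<Sum>n<k. ip (rproj n u) (rproj n u))" for k
    using rproj_ip[OF u P] by (simp add: ip_sum_right sP u)
  have SS: "ip (?S k) (?S k) = (\<Sum>n<k. ip (rproj n u) (rproj n u))" for k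
  proof -
    have "ip (?S k) (?S k) = (\<Sum>n<k. ip (?S k) (rproj n u))"
      by (intro ip_sum_right sP sS) auto
    also have "\<dots> = (\<Sum>n<k. ip (rproj n u) (rproj n u))"
      by (intro sum.cong refl harmonic_sum_ip[OF d P P]) auto
    finally show ?thesis .
  qed
  have dist: "ip (\<lambda>x. ?S k x - u x) (\<lambda>x. ?S k x - u x) = ip u u - (\<Sum>n<k. ip (rproj n u) (rproj n u))" for k
    using ip_self_diff[OF sS u, of k] uS[of k] SS[of k] ip_commute[of u "?S k"] by simp
  have bessel: "(\<Sum>n<k. ip (rproj n u) (rproj n u)) \<le> ip u u" for k
    using dist[of k] ip_nonneg[of "\<lambda>x. ?S k x - u x"] by simp
  have sm: "summable (\<lambda>n. ip (rproj n u) (rproj n u))"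
    by (rule summableI_nonneg_bounded[OF ip_nonneg bessel])
  obtain w where w: "square_integrable w" "\<And>n. rproj n w = rproj n u"
    "(\<lambda>k. ip (\<lambda>x. ?S k x - w x) (\<lambda>x. ?S k x - w x)) \<longlonglongrightarrow> 0"
    using riesz_fischer[OF d P sm] by blast
  have "AE x in \<sigma>. u x - w x = 0"
  proof (rule harmonics_complete[OF square_integrable_diff[OF u w(1)]])
    fix n and q :: "real^'n \<Rightarrow> real" assume q: "q \<in> harmonics n"
    show "ip (\<lambda>x. u x - w x) q = 0"
      using rproj_ip[OF u q] rproj_ip[OF w(1) q] w(2)[of n]
      by (simp add: ip_diff_left u w(1) square_integrable_harmonics[OF q])
  qed
  then have "ip (\<lambda>x. ?S k x - w x) (\<lambda>x. ?S k x - w x) = ip (\<lambda>x. ?S k x - u x) (\<lambda>x. ?S k x - u x)" for k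
    unfolding ip_def using sS[of k] u w(1)
    by (intro integral_cong_AE) (auto simp: square_integrable_real_iff)
  with w(3) show lim: "(\<lambda>k. ip (\<lambda>x. ?S k x - u x) (\<lambda>x. ?S k x - u x)) \<longlonglongrightarrow> 0" by simp
  show "(\<lambda>n. ip (rproj n u) (rproj n u)) sums ip u u"
    unfolding sums_def using tendsto_diff[OF tendsto_const[of "ip u u"] lim] by (simp add: dist)
qed

lemma tgrad_sum:
  fixes P :: "nat \<Rightarrow> real^'n \<Rightarrow> real"
  assumes "\<And>n. P n \<in> harmonics n"
  shows "has_gradient (\<lambda>x. \<Sum>n<k. P n x) (\<lambda>x. \<Sum>n<k. grad (P n) x)"
    and "tgrad (\<lambda>x. \<Sum>n<k. P n x) i x = (\<Sum>n<k. tgrad (P n) i x)"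
proof -
  show g: "has_gradient (\<lambda>x. \<Sum>n<k. P n x) (\<lambda>x. \<Sum>n<k. grad (P n) x)"
    by (intro has_gradient_sum hpoly_gradient[OF harmonics_hpoly[OF assms]]) auto
  show "tgrad (\<lambda>x. \<Sum>n<k. P n x) i x = (\<Sum>n<k. tgrad (P n) i x)"
    unfolding tgrad_def has_gradient_unique[OF g]
    by (simp add: tangential_def inner_sum_left scaleR_sum_left sum_distrib_right sum_subtractf)
qed

lemma tgrad_energy:
  fixes P :: "nat \<Rightarrow> real^'n \<Rightarrow> real"
  assumes d: "2 \<le> CARD('n)" and P: "\<And>n. P n \<in> harmonics n"
  shows "(\<Sum>i\<in>UNIV. ip (\<lambda>x. \<Sum>n<k. tgrad (P n) i x) (\<lambda>x. \<Sum>n<k. tgrad (P n) i x))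
    = (\<Sum>n<k. eigval CARD('n) n * ip (P n) (P n))"
proof -
  note sT = square_integrable_tgrad[OF harmonics_hpoly[OF P]]
  have "(\<Sum>i\<in>UNIV. ip (\<lambda>x. \<Sum>n<k. tgrad (P n) i x) (\<lambda>x. \<Sum>n<k. tgrad (P n) i x)) =
      (\<Sum>i\<in>UNIV. \<Sum>m<k. \<Sum>n<k. ip (tgrad (P m) i) (tgrad (P n) i))"
    by (simp add: ip_sum_left ip_sum_right sT square_integrable_sum)
  also have "\<dots> = (\<Sum>m<k. \<Sum>n<k. \<Sum>i\<in>UNIV. ip (tgrad (P m) i) (tgrad (P n) i))"
    by (subst sum.swap, intro sum.cong refl, rule sum.swap)
  also have "\<dots> = (\<Sum>m<k. \<Sum>n<k. if n = m then eigval CARD('n) m * ip (P m) (P m) else 0)"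
    using harmonics_orthogonal[OF d P P] by (intro sum.cong refl) (auto simp: harmonics_green_harmonics[OF P P])
  finally show ?thesis by simp
qed

text \<open>Bessel's inequality for \<open>g\<close> and the orthogonal family of gradients \<open>\<nabla>\<^sub>0 p\<^sub>n\<close>: Green's formula evaluates both their
  norms and their inner products with \<open>g\<close>.\<close>

lemma weak_gradient_energy:
  fixes u :: "real^'n \<Rightarrow> real"
  assumes d: "2 \<le> CARD('n)" and w: "weak_gradient u g"
    and u: "square_integrable u" and g: "\<And>i. square_integrable (\<lambda>x. g x $ i)"
  shows "(\<Sum>n<k. eigval CARD('n) n * ip (rproj n u) (rproj n u)) \<le> (\<Sum>i\<in>UNIV. ip (\<lambda>x. g x $ i) (\<lambda>x. g x $ i))"
proof -
  note P = rproj_harmonics[OF u]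
  note sT = square_integrable_tgrad[OF harmonics_hpoly[OF P]]
  let ?T = "\<lambda>i x. \<Sum>n<k. tgrad (rproj n u) i x"
  let ?E = "\<Sum>n<k. eigval CARD('n) n * ip (rproj n u) (rproj n u)"
  have sT': "square_integrable (?T i)" for i by (intro square_integrable_sum sT) auto
  have "(\<Sum>i\<in>UNIV. ip (?T i) (\<lambda>x. g x $ i)) = (\<Sum>i\<in>UNIV. \<Sum>n<k. ip (tgrad (rproj n u) i) (\<lambda>x. g x $ i))"
    by (simp add: ip_sum_left sT g)
  also have "\<dots> = (\<Sum>n<k. \<Sum>i\<in>UNIV. ip (tgrad (rproj n u) i) (\<lambda>x. g x $ i))" by (rule sum.swap)
  also have "\<dots> = ?E"
    by (intro sum.cong refl) (simp add: harmonics_green[OF P w u g] rproj_ip[OF u P])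
  finally have c: "(\<Sum>i\<in>UNIV. ip (?T i) (\<lambda>x. g x $ i)) = ?E" .
  have "0 \<le> (\<Sum>i\<in>UNIV. ip (\<lambda>x. ?T i x - g x $ i) (\<lambda>x. ?T i x - g x $ i))"
    by (intro sum_nonneg ip_nonneg)
  also have "\<dots> = (\<Sum>i\<in>UNIV. ip (?T i) (?T i) - 2 * ip (?T i) (\<lambda>x. g x $ i) + ip (\<lambda>x. g x $ i) (\<lambda>x. g x $ i))"
    by (intro sum.cong refl ip_self_diff sT' g)
  also have "\<dots> = (\<Sum>i\<in>UNIV. ip (?T i) (?T i)) - 2 * (\<Sum>i\<in>UNIV. ip (?T i) (\<lambda>x. g x $ i))
      + (\<Sum>i\<in>UNIV. ip (\<lambda>x. g x $ i) (\<lambda>x. g x $ i))"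
    by (simp add: sum.distrib sum_subtractf sum_distrib_left)
  finally show ?thesis unfolding c tgrad_energy[OF d P] by simp
qed

text \<open>The gradients of the partial sums form an orthogonal series whose squared norms are the given summands; its limit is a
  weak gradient because weak gradients are stable under limits.\<close>

lemma weak_gradient_exists:
  fixes u :: "real^'n \<Rightarrow> real"
  assumes d: "2 \<le> CARD('n)" and u: "square_integrable u"
    and sm: "summable (\<lambda>n. eigval CARD('n) n * ip (rproj n u) (rproj n u))"
  shows "\<exists>g. weak_gradient u g \<and> (\<forall>i. square_integrable (\<lambda>x. g x $ i))"
proof -
  note P = rproj_harmonics[OF u]
  note sT = square_integrable_tgrad[OF harmonics_hpoly[OF P]]
  let ?S = "\<lambda>k x. \<Sum>n<k. rproj n u x"
  let ?T = "\<lambda>k i x. \<Sum>n<k. tgrad (rproj n u) i x"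
  have "\<exists>w. \<forall>i. square_integrable (w i) \<and>
     (\<lambda>k. ip (\<lambda>x. ?T k i x - w i x) (\<lambda>x. ?T k i x - w i x)) \<longlonglongrightarrow> 0"
    by (rule orthogonal_series_converges)
       (use sm sT harmonics_orthogonal[OF d P P] in \<open>auto simp: harmonics_green_harmonics[OF P P]\<close>)
  then obtain w where w: "\<And>i. square_integrable (w i)"
    "\<And>i. (\<lambda>k. ip (\<lambda>x. ?T k i x - w i x) (\<lambda>x. ?T k i x - w i x)) \<longlonglongrightarrow> 0" by blast
  define g where "g x = (\<chi> i. w i x)" for x
  have sS: "square_integrable (?S k)" for k by (rule square_integrable_rproj_sum[OF u])
  have sT': "square_integrable (?T k i)" for k i by (intro square_integrable_sum sT) auto
  have L1: "(\<lambda>k. LINT x|\<sigma>. \<bar>a k x - b x\<bar>) \<longlonglongrightarrow> 0"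
    if "\<And>k. square_integrable (a k)" "square_integrable b"
      "(\<lambda>k. ip (\<lambda>x. a k x - b x) (\<lambda>x. a k x - b x)) \<longlonglongrightarrow> 0" for a and b :: "real^'n \<Rightarrow> real"
  proof (rule Lim_null_comparison)
    show "\<forall>\<^sub>F k in sequentially. norm (LINT x|\<sigma>. \<bar>a k x - b x\<bar>) \<le>
       sqrt (\<omega> CARD('n)) * sqrt (ip (\<lambda>x. a k x - b x) (\<lambda>x. a k x - b x))"
      using integral_abs_le_ip[OF square_integrable_diff[OF that(1,2)]] by (intro always_eventually allI) simp
    show "(\<lambda>k. sqrt (\<omega> CARD('n)) * sqrt (ip (\<lambda>x. a k x - b x) (\<lambda>x. a k x - b x))) \<longlonglongrightarrow> 0"
      using tendsto_mult_left[OF tendsto_real_sqrt[OF that(3)], of "sqrt (\<omega> CARD('n))"] by simp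
  qed
  let ?G = "\<lambda>k x. \<chi> i. ?T k i x"
  have "weak_gradient u g"
  proof (rule weak_gradient_limit)
    fix k
    have "weak_gradient (?S k) (\<lambda>x. tangential x (\<Sum>n<k. grad (rproj n u) x))"
      by (rule weak_gradient_smooth[OF tgrad_sum(1)[OF P]])
    also have "(\<lambda>x. tangential x (\<Sum>n<k. grad (rproj n u) x)) = ?G k"
      using tgrad_sum(2)[OF P, of k] has_gradient_unique[OF tgrad_sum(1)[OF P], of k]
      by (simp add: fun_eq_iff vec_eq_iff tgrad_def)
    finally show "weak_gradient (?S k) (?G k)" .
    show "integrable \<sigma> (?S k)" using sS by (rule square_integrable_integrable)
    show "integrable \<sigma> (\<lambda>x. ?G k x $ i)" for i using square_integrable_integrable[OF sT'] by simp
  next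
    show "integrable \<sigma> u" using u by (rule square_integrable_integrable)
    show "integrable \<sigma> (\<lambda>x. g x $ i)" for i using square_integrable_integrable[OF w(1)] by (simp add: g_def)
    show "(\<lambda>k. LINT x|\<sigma>. \<bar>?S k x - u x\<bar>) \<longlonglongrightarrow> 0"
      by (rule L1[OF sS u parseval_convergence[OF d u]])
    show "(\<lambda>k. LINT x|\<sigma>. \<bar>?G k x $ i - g x $ i\<bar>) \<longlonglongrightarrow> 0" for i
      using L1[OF sT' w(1) w(2), of i] by (simp add: g_def)
  qed
  moreover have "square_integrable (\<lambda>x. g x $ i)" for i using w(1) by (simp add: g_def)
  ultimately show ?thesis by blast
qed

text \<open>Integrate the gradient of \<open>p\<^sup>2\<close> in the direction \<open>e\<close>. The right side is the Cauchy--Schwarz bound before optimising over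
  \<open>s\<close>; in this form it is additive in \<open>p\<^sup>2\<close> and the energy, so that real and imaginary parts can be added.\<close>

lemma vector_field_inequality_smooth:
  fixes p :: "real^'n \<Rightarrow> real"
  assumes p: "has_gradient p D" and e: "norm e = 1" and s: "s > 0"
  shows "(real CARD('n) - 1) * (LINT x|\<sigma>. (x \<bullet> e) * (p x)\<^sup>2) \<le>
     s * (LINT x|\<sigma>. (1 - (x \<bullet> e)\<^sup>2) * (p x)\<^sup>2) + (\<Sum>i\<in>UNIV. ip (tgrad p i) (tgrad p i)) / s"
proof -
  have Dg: "grad p = D" using has_gradient_unique[OF p] .
  have pc: "continuous_on S p" for S by (rule has_gradient_continuous[OF p])
  have tc: "continuous_on S (tgrad p i)" for S i by (rule tgrad_continuous[OF p])
  let ?T = "\<lambda>x. tangential x (D x)"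
  have sq: "has_gradient (\<lambda>x. p x * p x) (\<lambda>x. p x *\<^sub>R D x + p x *\<^sub>R D x)"
    by (intro has_gradient_mult p)
  have tq: "tangential x (p x *\<^sub>R D x + p x *\<^sub>R D x) = (2 * p x) *\<^sub>R ?T x" for x
  proof -
    have "p x *\<^sub>R D x + p x *\<^sub>R D x = (2 * p x) *\<^sub>R D x"
      by (simp add: scaleR_left_distrib[symmetric])
    then show ?thesis unfolding tangential_def by (simp add: scaleR_diff_right)
  qed
  have ti: "?T x $ i = tgrad p i x" for x i by (simp add: tgrad_def Dg)
  have i1: "(LINT x|\<sigma>. 2 * p x * tgrad p i x) = (LINT x|\<sigma>. (real CARD('n) - 1) * x $ i * (p x)\<^sup>2)" for i
  proof -
    have "(LINT x|\<sigma>. 1 * tangential x (p x *\<^sub>R D x + p x *\<^sub>R D x) $ i) =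
      (LINT x|\<sigma>. ((real CARD('n) - 1) * x $ i * 1 - tangential x 0 $ i) * (p x * p x))"
      by (rule weak_gradient_integral_sphere[OF weak_gradient_smooth[OF sq] _ _ has_gradient_const])
         (unfold tq, simp_all add: ti, (intro continuous_sphere_integrable continuous_intros pc tc)+)
    moreover have "tangential x 0 = 0" for x :: "real^'n" by (simp add: tangential_def)
    ultimately show ?thesis unfolding tq by (simp add: ti power2_eq_square)
  qed
  have int1: "integrable \<sigma> (\<lambda>x. e $ i * (2 * p x * tgrad p i x))" for i
    by (intro continuous_sphere_integrable continuous_intros pc tc)
  have int2: "integrable \<sigma> (\<lambda>x. e $ i * ((real CARD('n) - 1) * x $ i * (p x)\<^sup>2))" for i
    by (intro continuous_sphere_integrable continuous_intros pc tc)
  have "(real CARD('n) - 1) * (LINT x|\<sigma>. (x \<bullet> e) * (p x)\<^sup>2) =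
      (LINT x|\<sigma>. (\<Sum>i\<in>UNIV. e $ i * ((real CARD('n) - 1) * x $ i * (p x)\<^sup>2)))"
    by (subst integral_mult_right_zero[symmetric])
       (intro Bochner_Integration.integral_cong refl, simp add: inner_vec_def sum_distrib_left sum_distrib_right algebra_simps)
  also have "\<dots> = (\<Sum>i\<in>UNIV. e $ i * (LINT x|\<sigma>. (real CARD('n) - 1) * x $ i * (p x)\<^sup>2))"
    using int2 by (subst Bochner_Integration.integral_sum) auto
  also have "\<dots> = (\<Sum>i\<in>UNIV. e $ i * (LINT x|\<sigma>. 2 * p x * tgrad p i x))"
    by (simp add: i1)
  also have "\<dots> = (LINT x|\<sigma>. (\<Sum>i\<in>UNIV. e $ i * (2 * p x * tgrad p i x)))"
    using int1 by (subst Bochner_Integration.integral_sum) auto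
  also have "\<dots> \<le> (LINT x|\<sigma>. s * ((1 - (x \<bullet> e)\<^sup>2) * (p x)\<^sup>2) + (\<Sum>i\<in>UNIV. tgrad p i x * tgrad p i x) / s)"
  proof (rule integral_mono)
    show "integrable \<sigma> (\<lambda>x. (\<Sum>i\<in>UNIV. e $ i * (2 * p x * tgrad p i x)))"
      by (intro continuous_sphere_integrable continuous_intros pc tc)
    show "integrable \<sigma> (\<lambda>x. s * ((1 - (x \<bullet> e)\<^sup>2) * (p x)\<^sup>2) + (\<Sum>i\<in>UNIV. tgrad p i x * tgrad p i x) / s)"
      using s by (intro continuous_sphere_integrable continuous_intros pc tc) auto
    fix x :: "real^'n" assume "x \<in> space \<sigma>"
    then have xx: "x \<bullet> x = 1" by (simp add: norm_eq_1)
    have ee: "e \<bullet> e = 1" using e by (simp add: norm_eq_1)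
    \<comment> \<open>Only the tangential part \<open>e - (x \<bullet> e) x\<close> of \<open>e\<close>, of squared length \<open>1 - (x \<bullet> e)\<^sup>2\<close>, pairs with \<open>T\<close>.\<close>
    have Tx: "?T x \<bullet> x = 0" by (simp add: tangential_inner xx)
    have "(\<Sum>i\<in>UNIV. e $ i * (2 * p x * tgrad p i x)) = 2 * p x * (?T x \<bullet> e)"
      unfolding inner_vec_def sum_distrib_left by (intro sum.cong) (auto simp: ti)
    also have "\<dots> = 2 * ((p x *\<^sub>R (e - (x \<bullet> e) *\<^sub>R x)) \<bullet> ?T x)"
      using Tx by (simp add: inner_diff_left inner_commute[of x "?T x"] inner_commute[of e "?T x"])
    also have "\<dots> \<le> s * (norm (p x *\<^sub>R (e - (x \<bullet> e) *\<^sub>R x)))\<^sup>2 + (norm (?T x))\<^sup>2 / s"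
    proof -
      let ?a = "p x *\<^sub>R (e - (x \<bullet> e) *\<^sub>R x)"
      have "0 \<le> (norm (s *\<^sub>R ?a - ?T x))\<^sup>2" by simp
      also have "\<dots> = s\<^sup>2 * (norm ?a)\<^sup>2 - 2 * s * (?a \<bullet> ?T x) + (norm (?T x))\<^sup>2"
        by (simp only: power2_norm_eq_inner inner_diff_left inner_diff_right inner_scaleR_left inner_scaleR_right)
           (simp add: inner_commute power2_eq_square algebra_simps)
      finally have "s * (2 * (?a \<bullet> ?T x)) \<le> s * (s * (norm ?a)\<^sup>2 + (norm (?T x))\<^sup>2 / s)"
        using s by (simp add: power2_eq_square algebra_simps)
      then show ?thesis using s by (simp only: mult_le_cancel_left_pos)
    qed
    also have "(norm (p x *\<^sub>R (e - (x \<bullet> e) *\<^sub>R x)))\<^sup>2 = (1 - (x \<bullet> e)\<^sup>2) * (p x)\<^sup>2"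
    proof -
      have "(norm (e - (x \<bullet> e) *\<^sub>R x))\<^sup>2 = 1 - (x \<bullet> e)\<^sup>2"
        unfolding power2_norm_eq_inner
        by (simp add: inner_diff_left inner_diff_right ee xx inner_commute power2_eq_square algebra_simps)
      then show ?thesis by (simp add: power_mult_distrib)
    qed
    also have "(norm (?T x))\<^sup>2 = (\<Sum>i\<in>UNIV. tgrad p i x * tgrad p i x)"
      unfolding power2_norm_eq_inner by (simp add: inner_vec_def ti)
    finally show "(\<Sum>i\<in>UNIV. e $ i * (2 * p x * tgrad p i x)) \<le>
      s * ((1 - (x \<bullet> e)\<^sup>2) * (p x)\<^sup>2) + (\<Sum>i\<in>UNIV. tgrad p i x * tgrad p i x) / s" .
  qed
  also have "\<dots> = s * (LINT x|\<sigma>. (1 - (x \<bullet> e)\<^sup>2) * (p x)\<^sup>2) + (\<Sum>i\<in>UNIV. ip (tgrad p i) (tgrad p i)) / s"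
  proof -
    have a: "integrable \<sigma> (\<lambda>x. (1 - (x \<bullet> e)\<^sup>2) * (p x)\<^sup>2)"
      by (intro continuous_sphere_integrable continuous_intros pc)
    have b: "integrable \<sigma> (\<lambda>x. tgrad p i x * tgrad p i x)" for i
      by (intro continuous_sphere_integrable continuous_intros tc)
    show ?thesis using a b by (simp add: ip_def)
  qed
  finally show ?thesis .
qed

text \<open>Apply the smooth case to the partial sums, whose energies are the partial sums of \<open>\<lambda>\<^sub>n \<parallel>p\<^sub>n\<parallel>\<^sup>2\<close>, and pass to the limit on
  the two weighted integrals.\<close>

lemma vector_field_inequality:
  fixes u :: "real^'n \<Rightarrow> real"
  assumes d: "2 \<le> CARD('n)" and u: "square_integrable u" and e: "norm e = 1" and s: "s > 0"
    and E: "\<And>k. (\<Sum>n<k. eigval CARD('n) n * ip (rproj n u) (rproj n u)) \<le> E"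
  shows "(real CARD('n) - 1) * (LINT x|\<sigma>. (x \<bullet> e) * (u x)\<^sup>2) \<le>
     s * (LINT x|\<sigma>. (1 - (x \<bullet> e)\<^sup>2) * (u x)\<^sup>2) + E / s"
proof -
  let ?S = "\<lambda>k x. \<Sum>n<k. rproj n u x"
  note P = rproj_harmonics[OF u]
  note lim = weighted_square_tendsto[OF square_integrable_rproj_sum[OF u] u _ parseval_convergence[OF d u]]
  have "(real CARD('n) - 1) * (LINT x|\<sigma>. (x \<bullet> e) * (?S k x)\<^sup>2) \<le>
     s * (LINT x|\<sigma>. (1 - (x \<bullet> e)\<^sup>2) * (?S k x)\<^sup>2) + E / s" for k
  proof -
    have t: "tgrad (?S k) i = (\<lambda>x. \<Sum>n<k. tgrad (rproj n u) i x)" for i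
      by (rule ext) (rule tgrad_sum(2)[OF P])
    have "(\<Sum>i\<in>UNIV. ip (tgrad (?S k) i) (tgrad (?S k) i)) = (\<Sum>n<k. eigval CARD('n) n * ip (rproj n u) (rproj n u))"
      unfolding t by (rule tgrad_energy[OF d P])
    also have "\<dots> \<le> E" by (rule E)
    finally have "(\<Sum>i\<in>UNIV. ip (tgrad (?S k) i) (tgrad (?S k) i)) / s \<le> E / s"
      using s by (simp add: divide_right_mono)
    then show ?thesis
      using vector_field_inequality_smooth[OF tgrad_sum(1)[OF P] e s, of k] by linarith
  qed
  moreover have "(\<lambda>k. (real CARD('n) - 1) * (LINT x|\<sigma>. (x \<bullet> e) * (?S k x)\<^sup>2)) \<longlonglongrightarrow>
      (real CARD('n) - 1) * (LINT x|\<sigma>. (x \<bullet> e) * (u x)\<^sup>2)"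
    by (intro tendsto_intros lim continuous_intros)
  moreover have "(\<lambda>k. s * (LINT x|\<sigma>. (1 - (x \<bullet> e)\<^sup>2) * (?S k x)\<^sup>2) + E / s) \<longlonglongrightarrow>
     s * (LINT x|\<sigma>. (1 - (x \<bullet> e)\<^sup>2) * (u x)\<^sup>2) + E / s"
    by (intro tendsto_intros lim continuous_intros)
  ultimately show ?thesis by (intro LIMSEQ_le) auto
qed

section \<open>Real and imaginary parts\<close>

abbreviation re :: "(real^'n \<Rightarrow> complex) \<Rightarrow> real^'n \<Rightarrow> real" where "re f \<equiv> \<lambda>x. Re (f x)"
abbreviation im :: "(real^'n \<Rightarrow> complex) \<Rightarrow> real^'n \<Rightarrow> real" where "im f \<equiv> \<lambda>x. Im (f x)"

lemma harmonics_eqI_sphere: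
  assumes "p \<in> harmonics n" "q \<in> harmonics n" "\<And>x. x \<in> sphere 0 1 \<Longrightarrow> p x = q x"
  shows "p = q"
proof (rule rproj_unique[OF assms(1,2)])
  show "ip p r = ip q r" for r
    unfolding ip_def by (intro Bochner_Integration.integral_cong) (auto simp: assms(3) simp del: mem_sphere_0)
qed

lemma square_integrable_complex_iff:
  fixes f :: "real^'n \<Rightarrow> complex"
  shows "square_integrable f \<longleftrightarrow> square_integrable (re f) \<and> square_integrable (im f)"
proof
  assume f: "square_integrable f"
  then have [measurable]: "f \<in> borel_measurable \<sigma>" by (simp add: square_integrable_def)
  have fi: "integrable \<sigma> (\<lambda>x. (norm (f x))\<^sup>2)" using f by (simp add: square_integrable_def)
  have "integrable \<sigma> (\<lambda>x. (Re (f x))\<^sup>2)" "integrable \<sigma> (\<lambda>x. (Im (f x))\<^sup>2)"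
    by (rule Bochner_Integration.integrable_bound[OF fi]; simp add: cmod_power2)+
  then show "square_integrable (re f) \<and> square_integrable (im f)"
    by (simp add: square_integrable_real_iff)
next
  assume *: "square_integrable (re f) \<and> square_integrable (im f)"
  then have "integrable \<sigma> (\<lambda>x. (Re (f x))\<^sup>2 + (Im (f x))\<^sup>2)"
    by (intro Bochner_Integration.integrable_add) (auto simp: square_integrable_real_iff)
  moreover have "f \<in> borel_measurable \<sigma>"
    using * by (simp add: square_integrable_real_iff borel_measurable_complex_iff)
  ultimately show "square_integrable f" by (simp add: square_integrable_def cmod_power2)
qed

lemma integral_weighted_norm_square:
  fixes f :: "real^'n \<Rightarrow> complex"
  assumes f: "square_integrable f" and c: "continuous_on (sphere 0 1) c"
  shows "(LINT x|\<sigma>. c x * (norm (f x))\<^sup>2) = (LINT x|\<sigma>. c x * (Re (f x))\<^sup>2) + (LINT x|\<sigma>. c x * (Im (f x))\<^sup>2)"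
proof -
  have "integrable \<sigma> (\<lambda>x. (Re (f x))\<^sup>2)" "integrable \<sigma> (\<lambda>x. (Im (f x))\<^sup>2)"
    using f unfolding square_integrable_complex_iff square_integrable_real_iff by auto
  then show ?thesis
    using integrable_mult_continuous_sphere[OF _ c]
    by (simp add: cmod_power2 distrib_left)
qed

lemma sphere_norm2_square:
  fixes f :: "real^'n \<Rightarrow> 'b::real_normed_vector"
  shows "(sphere_norm2 f)\<^sup>2 = (LINT x|\<sigma>. (norm (f x))\<^sup>2) / \<omega> CARD('n)"
  unfolding sphere_norm2_def using sphere_area_pos[where 'n='n] by simp

lemma complex_integrable_iff:
  fixes f :: "'a \<Rightarrow> complex"
  shows "integrable M f \<longleftrightarrow> integrable M (\<lambda>x. Re (f x)) \<and> integrable M (\<lambda>x. Im (f x))"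
proof
  assume "integrable M f"
  then show "integrable M (\<lambda>x. Re (f x)) \<and> integrable M (\<lambda>x. Im (f x))" by auto
next
  assume *: "integrable M (\<lambda>x. Re (f x)) \<and> integrable M (\<lambda>x. Im (f x))"
  then have "integrable M (\<lambda>x. of_real (Re (f x)) + \<i> * of_real (Im (f x)))" by auto
  then show "integrable M f" by (simp add: complex_eq[symmetric])
qed

lemma complex_integral_eq:
  fixes f :: "'a \<Rightarrow> complex"
  assumes "integrable M f"
  shows "(LINT x|M. f x) = Complex (LINT x|M. Re (f x)) (LINT x|M. Im (f x))"
  using assms by (simp add: complex_eq_iff)

section \<open>Complex-valued spherical harmonics\<close>

text \<open>The form in which a pair of real polynomials represents an element of \<open>\<H> n\<close>.\<close>

definition on_sphere :: "(real^'n \<Rightarrow> real) \<Rightarrow> (real^'n \<Rightarrow> real) \<Rightarrow> real^'n \<Rightarrow> complex" where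
  "on_sphere p q x = (if x \<in> sphere 0 1 then Complex (p x) (q x) else 0)"

lemma laplacian_Complex:
  assumes p: "p \<in> hpoly n" and q: "q \<in> hpoly n"
  shows "laplacian (\<lambda>x. Complex (p x) (q x)) x = Complex (lap p x) (lap q x)"
proof -
  have line: "((\<lambda>s. Complex (a (x + s *\<^sub>R axis i 1)) (b (x + s *\<^sub>R axis i 1))) has_vector_derivative
      Complex (grad a (x + t *\<^sub>R axis i 1) $ i) (grad b (x + t *\<^sub>R axis i 1) $ i)) (at t)"
    if "a \<in> hpoly m" "b \<in> hpoly m" for a b :: "real^'n \<Rightarrow> real" and m x i t
  proof -
    have r: "((\<lambda>s. a (x + s *\<^sub>R axis i 1)) has_real_derivative grad a (x + t *\<^sub>R axis i 1) $ i) (at t)"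
      if "a \<in> hpoly m" for a
    proof -
      have "((\<lambda>s. a (x + s *\<^sub>R axis i 1)) has_derivative (\<lambda>h. grad a (x + t *\<^sub>R axis i 1) \<bullet> (h *\<^sub>R axis i 1))) (at t)"
        by (rule has_derivative_compose[OF _ has_gradientD(1)[OF hpoly_gradient[OF that]]])
           (auto intro!: derivative_eq_intros)
      then show ?thesis
        by (simp add: has_field_derivative_def inner_axis mult_commute_abs)
    qed
    show ?thesis
      using r[OF that(1)] r[OF that(2)] by (simp add: has_vector_derivative_complex_iff)
  qed
  have 1: "vector_derivative (\<lambda>s. Complex (p (x + s *\<^sub>R axis i 1)) (q (x + s *\<^sub>R axis i 1))) (at t) =
      Complex (grad p (x + t *\<^sub>R axis i 1) $ i) (grad q (x + t *\<^sub>R axis i 1) $ i)" for i t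
    by (rule vector_derivative_at[OF line[OF p q]])
  have 2: "vector_derivative (\<lambda>t. Complex (grad p (x + t *\<^sub>R axis i 1) $ i) (grad q (x + t *\<^sub>R axis i 1) $ i)) (at 0) =
      Complex (grad (\<lambda>y. grad p y $ i) x $ i) (grad (\<lambda>y. grad q y $ i) x $ i)" for i
  proof -
    have "((\<lambda>t. Complex (grad p (x + t *\<^sub>R axis i 1) $ i) (grad q (x + t *\<^sub>R axis i 1) $ i)) has_vector_derivative
       Complex (grad (\<lambda>y. grad p y $ i) (x + 0 *\<^sub>R axis i 1) $ i) (grad (\<lambda>y. grad q y $ i) (x + 0 *\<^sub>R axis i 1) $ i)) (at 0)"
      by (rule line[OF hpoly_grad[OF p] hpoly_grad[OF q]])
    from vector_derivative_at[OF this] show ?thesis by simp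
  qed
  show ?thesis
    unfolding laplacian_def 1 2 lap_def by (simp add: complex_eq_iff Re_sum Im_sum)
qed

text \<open>For \<open>d \<ge> 3\<close> real values on the sphere mean that \<open>q\<close> vanishes there; a harmonic is determined by its values on the
  sphere, so \<open>q = 0\<close> everywhere.\<close>

lemma spherical_harmonics_iff:
  fixes Y :: "real^'n \<Rightarrow> complex"
  shows "Y \<in> \<H> n \<longleftrightarrow> (\<exists>p\<in>harmonics n. \<exists>q\<in>harmonics n. (3 \<le> CARD('n) \<longrightarrow> q = (\<lambda>x. 0)) \<and> Y = on_sphere p q)"
proof
  assume "Y \<in> \<H> n"
  then obtain P where Y: "scalar_convention Y" and P: "polynomial_function P"
    "\<And>c x. P (c *\<^sub>R x) = c ^ n *\<^sub>R P x" "\<And>x. laplacian P x = 0"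
    "Y = (\<lambda>x. if x \<in> sphere 0 1 then P x else 0)"
    unfolding spherical_harmonics_def by blast
  have rp: "real_polynomial_function (re P)" "real_polynomial_function (im P)"
    using P(1) bounded_linear_Re bounded_linear_Im unfolding polynomial_function_def o_def by auto
  have h: "re P \<in> hpoly n" "im P \<in> hpoly n"
    by (intro homogeneous_polynomial_hpoly rp; simp add: P(2))+
  have "laplacian (\<lambda>x. Complex (Re (P x)) (Im (P x))) x = 0" for x
    using P(3)[of x] by simp
  then have harm: "re P \<in> harmonics n" "im P \<in> harmonics n"
    using h unfolding laplacian_Complex[OF h] by (simp_all add: harmonics_def complex_eq_iff)
  have "im P = (\<lambda>x. 0)" if d: "3 \<le> CARD('n)"
  proof (rule harmonics_eqI_sphere[OF harm(2) harmonics_zero])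
    fix x :: "real^'n" assume x: "x \<in> sphere 0 1"
    then have "Y x \<in> \<real>" using Y d unfolding scalar_convention_def by blast
    then show "Im (P x) = 0" using x by (simp add: P(4) complex_is_Real_iff)
  qed
  moreover have "Y = on_sphere (re P) (im P)"
    unfolding P(4) by (auto simp: on_sphere_def fun_eq_iff complex_eq_iff)
  ultimately show "\<exists>p\<in>harmonics n. \<exists>q\<in>harmonics n. (3 \<le> CARD('n) \<longrightarrow> q = (\<lambda>x. 0)) \<and> Y = on_sphere p q"
    using harm by blast
next
  assume "\<exists>p\<in>harmonics n. \<exists>q\<in>harmonics n. (3 \<le> CARD('n) \<longrightarrow> q = (\<lambda>x. 0)) \<and> Y = on_sphere p q"
  then obtain p q where p: "p \<in> harmonics n" and q: "q \<in> harmonics n"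
    and z: "3 \<le> CARD('n) \<longrightarrow> q = (\<lambda>x. 0)" and Y: "Y = on_sphere p q" by blast
  note h = harmonics_hpoly[OF p] harmonics_hpoly[OF q]
  let ?P = "\<lambda>x. Complex (p x) (q x)"
  have "polynomial_function ?P"
    unfolding polynomial_function_def o_def
  proof (intro allI impI)
    fix f :: "complex \<Rightarrow> real" assume f: "bounded_linear f"
    have "f (?P x) = p x * f 1 + q x * f \<i>" for x
    proof -
      have "?P x = p x *\<^sub>R 1 + q x *\<^sub>R \<i>" by (simp add: complex_eq_iff)
      then have "f (?P x) = f (p x *\<^sub>R 1 + q x *\<^sub>R \<i>)" by simp
      also have "\<dots> = p x * f 1 + q x * f \<i>"
        using bounded_linear.linear[OF f] by (simp add: linear_add linear_cmul)
      finally show ?thesis .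
    qed
    then show "real_polynomial_function (\<lambda>x. f (?P x))"
      using hpoly_real_polynomial[OF h(1)] hpoly_real_polynomial[OF h(2)]
      by (simp add: real_polynomial_function.intros)
  qed
  moreover have "?P (c *\<^sub>R x) = c ^ n *\<^sub>R ?P x" for c x
    by (simp add: hpoly_homogeneous[OF h(1)] hpoly_homogeneous[OF h(2)] complex_eq_iff)
  moreover have "laplacian ?P x = 0" for x
    using p q unfolding laplacian_Complex[OF h] by (simp add: harmonics_def complex_eq_iff)
  moreover have "scalar_convention Y"
    unfolding scalar_convention_def Y using z by (auto simp: on_sphere_def complex_is_Real_iff)
  moreover have "Y = (\<lambda>x. if x \<in> sphere 0 1 then ?P x else 0)"
    unfolding Y by (simp add: on_sphere_def[abs_def])
  ultimately show "Y \<in> \<H> n"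
    unfolding spherical_harmonics_def by blast
qed

lemma rproj_im_zero:
  fixes f :: "real^'n \<Rightarrow> complex"
  assumes f: "f \<in> sphere_L2" and d: "3 \<le> CARD('n)"
  shows "rproj n (im f) = (\<lambda>x. 0)"
proof (rule rproj_eqI)
  show "square_integrable (im f)"
    using f unfolding sphere_L2_def square_integrable_complex_iff by blast
  show "ip (im f) q = ip (\<lambda>x. 0) q" for q
    unfolding ip_def
  proof (intro Bochner_Integration.integral_cong refl)
    fix x :: "real^'n" assume "x \<in> space \<sigma>"
    then have "f x \<in> \<real>" using f d unfolding sphere_L2_def scalar_convention_def by simp
    then show "Im (f x) * q x = 0 * q x" by (simp add: complex_is_Real_iff)
  qed
qed (rule harmonics_zero)

text \<open>Testing against real harmonics separates the real and the imaginary part of the complex orthogonality relation.\<close>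

lemma proj_eq:
  fixes f :: "real^'n \<Rightarrow> complex"
  assumes f: "f \<in> sphere_L2"
  shows "proj n f = on_sphere (rproj n (re f)) (rproj n (im f))"
proof -
  have sq: "square_integrable (re f)" "square_integrable (im f)"
    using f unfolding sphere_L2_def square_integrable_complex_iff by auto
  note h = rproj_harmonics[OF sq(1), of n] rproj_harmonics[OF sq(2), of n]
  have int: "(LINT x|\<sigma>. (f x - on_sphere p q x) * cnj (on_sphere a b x)) =
      Complex (ip (\<lambda>x. Re (f x) - p x) a + ip (\<lambda>x. Im (f x) - q x) b)
        (ip (\<lambda>x. Im (f x) - q x) a - ip (\<lambda>x. Re (f x) - p x) b)"
    if "p \<in> harmonics n" "q \<in> harmonics n" "a \<in> harmonics n" "b \<in> harmonics n" for p q a b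
  proof -
    have s: "square_integrable (\<lambda>x. Re (f x) - p x)" "square_integrable (\<lambda>x. Im (f x) - q x)"
      by (intro square_integrable_diff sq square_integrable_harmonics[OF that(1)] square_integrable_harmonics[OF that(2)])+
    note m = square_integrable_mult[OF s(1) square_integrable_harmonics[OF that(3)]]
      square_integrable_mult[OF s(1) square_integrable_harmonics[OF that(4)]]
      square_integrable_mult[OF s(2) square_integrable_harmonics[OF that(3)]]
      square_integrable_mult[OF s(2) square_integrable_harmonics[OF that(4)]]
    let ?F = "\<lambda>x. Complex ((Re (f x) - p x) * a x + (Im (f x) - q x) * b x)
        ((Im (f x) - q x) * a x - (Re (f x) - p x) * b x)"
    have i: "integrable \<sigma> ?F"
      unfolding complex_integrable_iff using m by simp
    have "(LINT x|\<sigma>. (f x - on_sphere p q x) * cnj (on_sphere a b x)) = (LINT x|\<sigma>. ?F x)"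
      by (intro Bochner_Integration.integral_cong refl) (simp add: on_sphere_def complex_eq_iff algebra_simps)
    also have "\<dots> = Complex (LINT x|\<sigma>. (Re (f x) - p x) * a x + (Im (f x) - q x) * b x)
        (LINT x|\<sigma>. (Im (f x) - q x) * a x - (Re (f x) - p x) * b x)"
      using complex_integral_eq[OF i] by simp
    also have "\<dots> = Complex (ip (\<lambda>x. Re (f x) - p x) a + ip (\<lambda>x. Im (f x) - q x) b)
        (ip (\<lambda>x. Im (f x) - q x) a - ip (\<lambda>x. Re (f x) - p x) b)"
      unfolding ip_def using m by simp
    finally show ?thesis .
  qed
  have ip0: "ip (\<lambda>x. u x - p x) a = ip u a - ip p a"
    if "square_integrable u" "p \<in> harmonics n" "a \<in> harmonics n" for u p a
    by (intro ip_diff_left that square_integrable_harmonics[OF that(2)] square_integrable_harmonics[OF that(3)])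
  show ?thesis
    unfolding proj_def
  proof (rule the_equality)
    have "on_sphere (rproj n (re f)) (rproj n (im f)) \<in> \<H> n"
      unfolding spherical_harmonics_iff using h rproj_im_zero[OF f] by blast
    moreover have "(LINT x|\<sigma>. (f x - on_sphere (rproj n (re f)) (rproj n (im f)) x) * cnj (Y x)) = 0"
      if "Y \<in> \<H> n" for Y
    proof -
      from that obtain a b where ab: "a \<in> harmonics n" "b \<in> harmonics n" "Y = on_sphere a b"
        unfolding spherical_harmonics_iff by blast
      show ?thesis
        unfolding ab(3) int[OF h ab(1,2)]
        using rproj_ip[OF sq(1) ab(1)] rproj_ip[OF sq(1) ab(2)] rproj_ip[OF sq(2) ab(1)] rproj_ip[OF sq(2) ab(2)]
        by (simp add: ip0 sq h ab complex_eq_iff)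
    qed
    ultimately show "on_sphere (rproj n (re f)) (rproj n (im f)) \<in> \<H> n \<and>
      (\<forall>Y\<in>\<H> n. (LINT x|\<sigma>. (f x - on_sphere (rproj n (re f)) (rproj n (im f)) x) * cnj (Y x)) = 0)" by blast
  next
    fix P assume P: "P \<in> \<H> n \<and> (\<forall>Y\<in>\<H> n. (LINT x|\<sigma>. (f x - P x) * cnj (Y x)) = 0)"
    then obtain p q where pq: "p \<in> harmonics n" "q \<in> harmonics n" "P = on_sphere p q"
      unfolding spherical_harmonics_iff by blast
    have *: "ip (re f) a = ip p a" "ip (im f) a = ip q a" if a: "a \<in> harmonics n" for a
    proof -
      have "on_sphere a (\<lambda>x. 0) \<in> \<H> n"
        unfolding spherical_harmonics_iff using a harmonics_zero by blast
      then have "(LINT x|\<sigma>. (f x - on_sphere p q x) * cnj (on_sphere a (\<lambda>x. 0) x)) = 0"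
        using P pq(3) by blast
      then have "ip (\<lambda>x. Re (f x) - p x) a = 0 \<and> ip (\<lambda>x. Im (f x) - q x) a = 0"
        unfolding int[OF pq(1,2) a harmonics_zero] by (simp add: complex_eq_iff ip_def)
      then show "ip (re f) a = ip p a" "ip (im f) a = ip q a"
        by (simp_all add: ip0 sq pq a)
    qed
    show "P = on_sphere (rproj n (re f)) (rproj n (im f))"
      using rproj_eqI[OF sq(1) pq(1) *(1)] rproj_eqI[OF sq(2) pq(2) *(2)] pq(3) by simp
  qed
qed

lemma on_sphere_eq_iff:
  assumes "p \<in> harmonics n" "q \<in> harmonics n" "p' \<in> harmonics n" "q' \<in> harmonics n"
  shows "on_sphere p q = on_sphere p' q' \<longleftrightarrow> p = p' \<and> q = q'"
proof
  assume eq: "on_sphere p q = on_sphere p' q'"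
  have "p x = p' x \<and> q x = q' x" if "x \<in> sphere 0 1" for x
    using fun_cong[OF eq, of x] that by (simp add: on_sphere_def)
  then show "p = p' \<and> q = q'"
    using harmonics_eqI_sphere[OF assms(1,3)] harmonics_eqI_sphere[OF assms(2,4)] by blast
qed simp

lemma is_LB_power_half_iff:
  fixes f h :: "real^'n \<Rightarrow> complex"
  assumes d: "2 \<le> CARD('n)" and f: "f \<in> sphere_L2"
  shows "is_LB_power (1/2) f h \<longleftrightarrow> h \<in> sphere_L2 \<and>
    (\<forall>n. rproj n (re h) = (\<lambda>x. sqrt (eigval CARD('n) n) * rproj n (re f) x) \<and>
         rproj n (im h) = (\<lambda>x. sqrt (eigval CARD('n) n) * rproj n (im f) x))"
proof -
  have *: "(proj 0 h = (\<lambda>_. 0) \<and>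
     (\<forall>n\<ge>1. proj n h = (\<lambda>x. ((real n * (real n + real CARD('n) - 2)) powr (1/2)) *\<^sub>R proj n f x))) \<longleftrightarrow>
    (\<forall>n. rproj n (re h) = (\<lambda>x. sqrt (eigval CARD('n) n) * rproj n (re f) x) \<and>
         rproj n (im h) = (\<lambda>x. sqrt (eigval CARD('n) n) * rproj n (im f) x))" (is "?L \<longleftrightarrow> ?R")
    if h: "h \<in> sphere_L2"
  proof -
    have sq: "square_integrable (re f)" "square_integrable (im f)" "square_integrable (re h)" "square_integrable (im h)"
      using f h unfolding sphere_L2_def square_integrable_complex_iff by auto
    note H = rproj_harmonics[OF sq(1)] rproj_harmonics[OF sq(2)] rproj_harmonics[OF sq(3)] rproj_harmonics[OF sq(4)]
    have p: "((real n * (real n + real CARD('n) - 2)) powr (1/2)) = sqrt (eigval CARD('n) n)" for n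
      using eigval_nonneg[OF d, of n] unfolding eigval_def by (rule powr_half_sqrt)
    have sc: "(\<lambda>x. c *\<^sub>R on_sphere a b x) = on_sphere (\<lambda>x. c * a x) (\<lambda>x. c * b x)" for c and a b :: "real^'n \<Rightarrow> real"
      by (auto simp: on_sphere_def complex_eq_iff fun_eq_iff)
    have z: "(\<lambda>_. 0) = on_sphere (\<lambda>x. sqrt (eigval CARD('n) 0) * rproj 0 (re f) x) (\<lambda>x. sqrt (eigval CARD('n) 0) * rproj 0 (im f) x)"
      by (auto simp: on_sphere_def complex_eq_iff fun_eq_iff eigval_def)
    have "?L \<longleftrightarrow> (\<forall>n. proj n h = on_sphere (\<lambda>x. sqrt (eigval CARD('n) n) * rproj n (re f) x)
        (\<lambda>x. sqrt (eigval CARD('n) n) * rproj n (im f) x))" (is "_ \<longleftrightarrow> (\<forall>n. ?E n)")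
    proof -
      have "(\<forall>n. ?E n) \<longleftrightarrow> ?E 0 \<and> (\<forall>n\<ge>1. ?E n)" by (metis One_nat_def Suc_leI neq0_conv)
      then show ?thesis unfolding p proj_eq[OF f] sc z by simp
    qed
    also have "\<dots> \<longleftrightarrow> ?R"
      unfolding proj_eq[OF h] using on_sphere_eq_iff[OF H(3,4) harmonics_scale[OF H(1)] harmonics_scale[OF H(2)]] by simp
    finally show ?thesis .
  qed
  show ?thesis unfolding is_LB_power_def using * by blast
qed

section \<open>The tangential gradient and the energies of the degrees\<close>

lemma norm_vec_complex_square: "(norm (G :: complex^'n))\<^sup>2 = (\<Sum>i\<in>UNIV. (Re (G $ i))\<^sup>2 + (Im (G $ i))\<^sup>2)"
  unfolding norm_vec_def L2_set_def by (simp add: sum_nonneg cmod_power2)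

lemma vec_complex_measurable_iff:
  fixes G :: "'a \<Rightarrow> complex^'n"
  shows "G \<in> borel_measurable M \<longleftrightarrow> (\<forall>i. (\<lambda>x. G x $ i) \<in> borel_measurable M)"
proof
  assume G: "G \<in> borel_measurable M"
  have "(\<lambda>v::complex^'n. v $ i) \<in> borel_measurable borel" for i
    by (intro borel_measurable_continuous_onI continuous_intros)
  from measurable_compose[OF G this] show "\<forall>i. (\<lambda>x. G x $ i) \<in> borel_measurable M" by blast
next
  assume G: "\<forall>i. (\<lambda>x. G x $ i) \<in> borel_measurable M"
  show "G \<in> borel_measurable M"
  proof (subst borel_measurable_euclidean_space, rule ballI)
    fix b :: "complex^'n" assume "b \<in> Basis"
    then obtain i c where b: "b = axis i c" unfolding Basis_vec_def by blast
    have "(\<lambda>x. G x $ i \<bullet> c) \<in> borel_measurable M"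
      using G by (intro borel_measurable_inner borel_measurable_const) auto
    then show "(\<lambda>x. G x \<bullet> b) \<in> borel_measurable M" by (simp add: b inner_axis)
  qed
qed

lemma square_integrable_vec_complex_iff:
  fixes G :: "real^'n \<Rightarrow> complex^'n"
  shows "square_integrable G \<longleftrightarrow>
    (\<forall>i. square_integrable (\<lambda>x. Re (G x $ i)) \<and> square_integrable (\<lambda>x. Im (G x $ i)))"
proof
  assume G: "square_integrable G"
  then have m: "(\<lambda>x. G x $ i) \<in> borel_measurable \<sigma>" for i
    unfolding square_integrable_def vec_complex_measurable_iff by blast
  show "\<forall>i. square_integrable (\<lambda>x. Re (G x $ i)) \<and> square_integrable (\<lambda>x. Im (G x $ i))"
  proof
    fix i
    have "square_integrable (\<lambda>x. G x $ i)"
      unfolding square_integrable_def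
    proof (intro conjI m)
      show "integrable \<sigma> (\<lambda>x. (norm (G x $ i))\<^sup>2)"
      proof (rule Bochner_Integration.integrable_bound)
        show "integrable \<sigma> (\<lambda>x. (norm (G x))\<^sup>2)" using G by (simp add: square_integrable_def)
        show "(\<lambda>x. (norm (G x $ i))\<^sup>2) \<in> borel_measurable \<sigma>" using m by measurable
      qed (use Finite_Cartesian_Product.norm_nth_le[of _ i] in \<open>auto intro!: AE_I2 power_mono\<close>)
    qed
    then show "square_integrable (\<lambda>x. Re (G x $ i)) \<and> square_integrable (\<lambda>x. Im (G x $ i))"
      unfolding square_integrable_complex_iff .
  qed
next
  assume *: "\<forall>i. square_integrable (\<lambda>x. Re (G x $ i)) \<and> square_integrable (\<lambda>x. Im (G x $ i))"
  then have "square_integrable (\<lambda>x. G x $ i)" for i unfolding square_integrable_complex_iff by blast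
  then have "(\<lambda>x. G x $ i) \<in> borel_measurable \<sigma>" for i by (simp add: square_integrable_def)
  then have "G \<in> borel_measurable \<sigma>" unfolding vec_complex_measurable_iff by blast
  moreover have "integrable \<sigma> (\<lambda>x. \<Sum>i\<in>UNIV. (Re (G x $ i))\<^sup>2 + (Im (G x $ i))\<^sup>2)"
    using * by (intro Bochner_Integration.integrable_sum Bochner_Integration.integrable_add)
       (auto simp: square_integrable_real_iff)
  ultimately show "square_integrable G" by (simp add: square_integrable_def norm_vec_complex_square)
qed

text \<open>The complex identity splits into its real and imaginary parts because all integrands are integrable; for integrands
  that are not, the value \<open>0\<close> of the integral would not be compatible with taking real parts.\<close>

lemma is_tangential_gradient_iff:
  fixes f :: "real^'n \<Rightarrow> complex" and G :: "real^'n \<Rightarrow> complex^'n"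
  assumes f: "square_integrable f"
  shows "is_tangential_gradient f G \<longleftrightarrow> square_integrable G \<and>
    weak_gradient (re f) (\<lambda>x. \<chi> i. Re (G x $ i)) \<and> weak_gradient (im f) (\<lambda>x. \<chi> i. Im (G x $ i))"
proof (cases "square_integrable G")
  case False
  then show ?thesis by (simp add: is_tangential_gradient_def)
next
  case G: True
  have fi: "integrable \<sigma> (re f)" "integrable \<sigma> (im f)"
    using f square_integrable_integrable unfolding square_integrable_complex_iff by auto
  have Gi: "integrable \<sigma> (\<lambda>x. Re (G x $ i))" "integrable \<sigma> (\<lambda>x. Im (G x $ i))" for i
    using G square_integrable_integrable unfolding square_integrable_vec_complex_iff by auto
  have split: "(LINT x|lborel. w x *\<^sub>R h (sgn x)) = Complex (LINT x|lborel. w x * Re (h (sgn x))) (LINT x|lborel. w x * Im (h (sgn x)))"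
    if w: "continuous_on UNIV w" "compact K" "0 \<notin> K" "\<And>x. x \<notin> K \<Longrightarrow> w x = 0"
      and h: "integrable \<sigma> (re h)" "integrable \<sigma> (im h)" for w :: "real^'n \<Rightarrow> real" and K h
  proof -
    have "integrable lborel (\<lambda>x. w x * Re (h (sgn x)))" "integrable lborel (\<lambda>x. w x * Im (h (sgn x)))"
      using test_function_bound[OF w] h by blast+
    then have "integrable lborel (\<lambda>x. w x *\<^sub>R h (sgn x))" by (simp add: complex_integrable_iff)
    from complex_integral_eq[OF this] show ?thesis by simp
  qed
  have key: "((LINT x|lborel. (D x $ i) *\<^sub>R f (sgn x)) = - (LINT x|lborel. (\<phi> x / norm x) *\<^sub>R (G (sgn x) $ i))) \<longleftrightarrow>
     (LINT x|lborel. D x $ i * Re (f (sgn x))) = - (LINT x|lborel. \<phi> x / norm x * Re (G (sgn x) $ i)) \<and>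
     (LINT x|lborel. D x $ i * Im (f (sgn x))) = - (LINT x|lborel. \<phi> x / norm x * Im (G (sgn x) $ i))"
    if \<phi>: "has_gradient \<phi> D" and K: "compact K" "0 \<notin> K" "\<And>x. x \<notin> K \<Longrightarrow> \<phi> x = 0" for \<phi> D K i
  proof -
    have z: "D x = 0" if "x \<notin> K" for x
      using has_gradient_outside_support[OF \<phi> K(1) _ that] K(3) by auto
    have c1: "continuous_on UNIV (\<lambda>x. D x $ i)"
      using \<phi> by (intro continuous_intros) (auto simp: has_gradient_def)
    have c2: "continuous_on UNIV (\<lambda>x. \<phi> x / norm x)"
      using has_gradient_continuous[OF \<phi>] K(3)
      by (intro continuous_extend_by_zero[OF _ K(1,2)] continuous_intros) auto
    show ?thesis
      using split[OF c1 K(1,2) _ fi] split[OF c2 K(1,2) _ Gi[of i]] z K(3) by (simp add: complex_eq_iff)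
  qed
  show ?thesis
    unfolding is_tangential_gradient_def weak_gradient_def
  proof (intro iffI conjI allI impI G)
    fix \<phi> :: "real^'n \<Rightarrow> real" and D i
    assume *: "square_integrable G \<and> (\<forall>\<phi> D. (\<forall>x. (\<phi> has_derivative (\<lambda>h. D x \<bullet> h)) (at x)) \<longrightarrow>
        continuous_on UNIV D \<longrightarrow> (\<exists>K. compact K \<and> 0 \<notin> K \<and> (\<forall>x. x \<notin> K \<longrightarrow> \<phi> x = 0)) \<longrightarrow>
        (\<forall>i. (LINT x|lborel. (D x $ i) *\<^sub>R f (sgn x)) = - (LINT x|lborel. (\<phi> x / norm x) *\<^sub>R (G (sgn x) $ i))))"
      and \<phi>: "has_gradient \<phi> D" and ex: "\<exists>K. compact K \<and> 0 \<notin> K \<and> (\<forall>x. x \<notin> K \<longrightarrow> \<phi> x = 0)"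
    from ex obtain K where K: "compact K" "0 \<notin> K" "\<And>x. x \<notin> K \<Longrightarrow> \<phi> x = 0" by blast
    have "(LINT x|lborel. (D x $ i) *\<^sub>R f (sgn x)) = - (LINT x|lborel. (\<phi> x / norm x) *\<^sub>R (G (sgn x) $ i))"
      using * \<phi> ex unfolding has_gradient_def by blast
    from iffD1[OF key[OF \<phi> K] this]
    show "(LINT x|lborel. D x $ i * Re (f (sgn x))) = - (LINT x|lborel. \<phi> x / norm x * (\<chi> i. Re (G (sgn x) $ i)) $ i)"
      and "(LINT x|lborel. D x $ i * Im (f (sgn x))) = - (LINT x|lborel. \<phi> x / norm x * (\<chi> i. Im (G (sgn x) $ i)) $ i)"
      by simp_all
  next
    fix \<phi> :: "real^'n \<Rightarrow> real" and D i
    assume *: "square_integrable G \<and>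
      (\<forall>\<phi> D. has_gradient \<phi> D \<longrightarrow> (\<exists>K. compact K \<and> 0 \<notin> K \<and> (\<forall>x. x \<notin> K \<longrightarrow> \<phi> x = 0)) \<longrightarrow>
        (\<forall>i. (LINT x|lborel. D x $ i * Re (f (sgn x))) = - (LINT x|lborel. \<phi> x / norm x * (\<chi> i. Re (G (sgn x) $ i)) $ i))) \<and>
      (\<forall>\<phi> D. has_gradient \<phi> D \<longrightarrow> (\<exists>K. compact K \<and> 0 \<notin> K \<and> (\<forall>x. x \<notin> K \<longrightarrow> \<phi> x = 0)) \<longrightarrow>
        (\<forall>i. (LINT x|lborel. D x $ i * Im (f (sgn x))) = - (LINT x|lborel. \<phi> x / norm x * (\<chi> i. Im (G (sgn x) $ i)) $ i)))"
      and g: "\<forall>x. (\<phi> has_derivative (\<lambda>h. D x \<bullet> h)) (at x)" "continuous_on UNIV D"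
      and ex: "\<exists>K. compact K \<and> 0 \<notin> K \<and> (\<forall>x. x \<notin> K \<longrightarrow> \<phi> x = 0)"
    from g have \<phi>: "has_gradient \<phi> D" by (simp add: has_gradient_def)
    from ex obtain K where K: "compact K" "0 \<notin> K" "\<And>x. x \<notin> K \<Longrightarrow> \<phi> x = 0" by blast
    have "(LINT x|lborel. D x $ i * Re (f (sgn x))) = - (LINT x|lborel. \<phi> x / norm x * (\<chi> i. Re (G (sgn x) $ i)) $ i)"
       "(LINT x|lborel. D x $ i * Im (f (sgn x))) = - (LINT x|lborel. \<phi> x / norm x * (\<chi> i. Im (G (sgn x) $ i)) $ i)"
      using * \<phi> ex by blast+
    from this[unfolded vec_lambda_beta]
    show "(LINT x|lborel. (D x $ i) *\<^sub>R f (sgn x)) = - (LINT x|lborel. (\<phi> x / norm x) *\<^sub>R (G (sgn x) $ i))"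
      by (intro iffD2[OF key[OF \<phi> K]] conjI)
  qed
qed

text \<open>The squared norm of \<open>proj n f\<close> with respect to \<open>\<sigma>\<close>, which is not normalised; hence the factors \<open>\<omega> d\<close> below.\<close>

definition degree_energy :: "(real^'n \<Rightarrow> complex) \<Rightarrow> nat \<Rightarrow> real" where
  "degree_energy f n = ip (rproj n (re f)) (rproj n (re f)) + ip (rproj n (im f)) (rproj n (im f))"

lemma degree_energy_nonneg: "degree_energy f n \<ge> 0"
  by (simp add: degree_energy_def ip_nonneg)

lemma norm_square_sphere:
  fixes f :: "real^'n \<Rightarrow> complex"
  assumes "square_integrable f"
  shows "(LINT x|\<sigma>. (norm (f x))\<^sup>2) = ip (re f) (re f) + ip (im f) (im f)"
  using integral_weighted_norm_square[OF assms, of "\<lambda>x. 1"] by (simp add: ip_def power2_eq_square)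

lemma degree_energy_sums:
  fixes f :: "real^'n \<Rightarrow> complex"
  assumes d: "2 \<le> CARD('n)" and f: "square_integrable f"
  shows "degree_energy f sums (\<omega> CARD('n) * (sphere_norm2 f)\<^sup>2)"
proof -
  have sq: "square_integrable (re f)" "square_integrable (im f)"
    using f unfolding square_integrable_complex_iff by auto
  have "degree_energy f sums (ip (re f) (re f) + ip (im f) (im f))"
    unfolding degree_energy_def[abs_def] by (intro sums_add parseval[OF d] sq)
  then show ?thesis
    using sphere_area_pos[where 'n='n] by (simp add: sphere_norm2_square norm_square_sphere[OF f])
qed

lemma harmonics_0_const: "p \<in> harmonics 0 \<Longrightarrow> \<exists>c. p = (\<lambda>x. c)"
  using harmonics_hpoly[of p 0] unfolding hpoly.simps(1) mem_Collect_eq by metis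

lemma const_harmonics_0: "(\<lambda>x. c) \<in> harmonics 0"
  by (simp add: harmonics_def hpoly_const lap_def grad_const del: hpoly.simps)

lemma rproj_0_eq_zero_iff:
  fixes u :: "real^'n \<Rightarrow> real"
  assumes u: "square_integrable u"
  shows "rproj 0 u = (\<lambda>x. 0) \<longleftrightarrow> (LINT x|\<sigma>. u x) = 0"
proof
  assume "rproj 0 u = (\<lambda>x. 0)"
  then show "(LINT x|\<sigma>. u x) = 0"
    using rproj_ip[OF u const_harmonics_0[of 1]] by (simp add: ip_def)
next
  assume z: "(LINT x|\<sigma>. u x) = 0"
  show "rproj 0 u = (\<lambda>x. 0)"
  proof (rule rproj_eqI[OF u harmonics_zero])
    fix q :: "real^'n \<Rightarrow> real" assume "q \<in> harmonics 0"
    then obtain c where "q = (\<lambda>x. c)" using harmonics_0_const by blast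
    then show "ip u q = ip (\<lambda>x. 0) q" using z by (simp add: ip_def)
  qed
qed

lemma mean_zero_iff:
  fixes f :: "real^'n \<Rightarrow> complex"
  assumes f: "square_integrable f"
  shows "mean_zero f \<longleftrightarrow> rproj 0 (re f) = (\<lambda>x. 0) \<and> rproj 0 (im f) = (\<lambda>x. 0)"
proof -
  have sq: "square_integrable (re f)" "square_integrable (im f)"
    using f unfolding square_integrable_complex_iff by auto
  have "integrable \<sigma> f"
    unfolding complex_integrable_iff using sq by (simp add: square_integrable_integrable)
  from complex_integral_eq[OF this] show ?thesis
    unfolding mean_zero_def rproj_0_eq_zero_iff[OF sq(1)] rproj_0_eq_zero_iff[OF sq(2)]
    by (simp add: complex_eq_iff)
qed

text \<open>The operator \<open>(-\<Delta>\<^sub>0)\<^bsup>1/2\<^esup> f\<close> being in \<open>L\<^sup>2\<close> makes the energies summable, so that a weak gradient exists and the choice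
  \<open>\<nabla>\<^sub>0 f\<close> is one. The numbers \<open>E\<close> and \<open>F\<close> are the energies of its real and its imaginary part; they are kept apart since
  the vector field inequality is applied to each part.\<close>

lemma tangential_gradient_energy:
  fixes f :: "real^'n \<Rightarrow> complex"
  assumes d: "2 \<le> CARD('n)" and f: "f \<in> sobolev_W21"
  shows "\<exists>E F. E + F = \<omega> CARD('n) * (sphere_norm2 (\<nabla>\<^sub>0 f))\<^sup>2 \<and>
    (\<forall>k. (\<Sum>n<k. eigval CARD('n) n * ip (rproj n (re f)) (rproj n (re f))) \<le> E) \<and>
    (\<forall>k. (\<Sum>n<k. eigval CARD('n) n * ip (rproj n (im f)) (rproj n (im f))) \<le> F)"
proof -
  have fL: "f \<in> sphere_L2" using f by (simp add: sobolev_W21_def)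
  then have fs: "square_integrable f" by (simp add: sphere_L2_def)
  then have sq: "square_integrable (re f)" "square_integrable (im f)"
    unfolding square_integrable_complex_iff by auto
  obtain h where h: "is_LB_power (1/2) f h" using f by (auto simp: sobolev_W21_def)
  then have hL: "h \<in> sphere_L2" and hr: "\<And>n. rproj n (re h) = (\<lambda>x. sqrt (eigval CARD('n) n) * rproj n (re f) x)"
    and hi: "\<And>n. rproj n (im h) = (\<lambda>x. sqrt (eigval CARD('n) n) * rproj n (im f) x)"
    unfolding is_LB_power_half_iff[OF d fL] by auto
  have hsq: "square_integrable (re h)" "square_integrable (im h)"
    using hL unfolding sphere_L2_def square_integrable_complex_iff by auto
  have eig: "sqrt (eigval CARD('n) n) * sqrt (eigval CARD('n) n) = eigval CARD('n) n" for n
    using eigval_nonneg[OF d] by simp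
  have sm: "summable (\<lambda>n. eigval CARD('n) n * ip (rproj n (re f)) (rproj n (re f)))"
    "summable (\<lambda>n. eigval CARD('n) n * ip (rproj n (im f)) (rproj n (im f)))"
    using sums_summable[OF parseval[OF d hsq(1)]] sums_summable[OF parseval[OF d hsq(2)]]
    unfolding hr hi ip_scale_both eig by auto
  obtain g1 where g1: "weak_gradient (re f) g1" "\<And>i. square_integrable (\<lambda>x. g1 x $ i)"
    using weak_gradient_exists[OF d sq(1) sm(1)] by blast
  obtain g2 where g2: "weak_gradient (im f) g2" "\<And>i. square_integrable (\<lambda>x. g2 x $ i)"
    using weak_gradient_exists[OF d sq(2) sm(2)] by blast
  have "is_tangential_gradient f (\<lambda>x. \<chi> i. Complex (g1 x $ i) (g2 x $ i))"
    unfolding is_tangential_gradient_iff[OF fs] square_integrable_vec_complex_iff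
    using g1 g2 by simp
  then have "is_tangential_gradient f (\<nabla>\<^sub>0 f)"
    unfolding tangential_gradient_def by (rule someI[where P = "is_tangential_gradient f"])
  then have G: "square_integrable (\<nabla>\<^sub>0 f)" "weak_gradient (re f) (\<lambda>x. \<chi> i. Re (\<nabla>\<^sub>0 f x $ i))"
    "weak_gradient (im f) (\<lambda>x. \<chi> i. Im (\<nabla>\<^sub>0 f x $ i))"
    unfolding is_tangential_gradient_iff[OF fs] by auto
  have Gs: "square_integrable (\<lambda>x. Re (\<nabla>\<^sub>0 f x $ i))" "square_integrable (\<lambda>x. Im (\<nabla>\<^sub>0 f x $ i))" for i
    using G(1) unfolding square_integrable_vec_complex_iff by auto
  let ?E = "\<Sum>i\<in>UNIV. ip (\<lambda>x. Re (\<nabla>\<^sub>0 f x $ i)) (\<lambda>x. Re (\<nabla>\<^sub>0 f x $ i))"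
  let ?F = "\<Sum>i\<in>UNIV. ip (\<lambda>x. Im (\<nabla>\<^sub>0 f x $ i)) (\<lambda>x. Im (\<nabla>\<^sub>0 f x $ i))"
  have "(LINT x|\<sigma>. (norm (\<nabla>\<^sub>0 f x))\<^sup>2) = ?E + ?F"
    using Gs unfolding norm_vec_complex_square ip_def
    by (simp add: square_integrable_real_iff sum.distrib power2_eq_square[symmetric])
  then have "?E + ?F = \<omega> CARD('n) * (sphere_norm2 (\<nabla>\<^sub>0 f))\<^sup>2"
    using sphere_area_pos[where 'n='n] by (simp add: sphere_norm2_square)
  moreover have "(\<Sum>n<k. eigval CARD('n) n * ip (rproj n (re f)) (rproj n (re f))) \<le> ?E" for k
    using weak_gradient_energy[OF d G(2) sq(1)] Gs(1) by simp
  moreover have "(\<Sum>n<k. eigval CARD('n) n * ip (rproj n (im f)) (rproj n (im f))) \<le> ?F" for k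
    using weak_gradient_energy[OF d G(3) sq(2)] Gs(2) by simp
  ultimately show ?thesis by blast
qed

lemma degree_energy_gradient:
  fixes f :: "real^'n \<Rightarrow> complex"
  assumes d: "2 \<le> CARD('n)" and f: "f \<in> sobolev_W21"
  shows "(\<Sum>n<k. eigval CARD('n) n * degree_energy f n) \<le> \<omega> CARD('n) * (sphere_norm2 (\<nabla>\<^sub>0 f))\<^sup>2"
proof -
  obtain E F where "E + F = \<omega> CARD('n) * (sphere_norm2 (\<nabla>\<^sub>0 f))\<^sup>2"
    "(\<Sum>n<k. eigval CARD('n) n * ip (rproj n (re f)) (rproj n (re f))) \<le> E"
    "(\<Sum>n<k. eigval CARD('n) n * ip (rproj n (im f)) (rproj n (im f))) \<le> F"
    using tangential_gradient_energy[OF assms] by blast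
  then show ?thesis by (simp add: degree_energy_def distrib_left sum.distrib)
qed

lemma vector_field_inequality_complex:
  fixes f :: "real^'n \<Rightarrow> complex"
  assumes d: "2 \<le> CARD('n)" and f: "f \<in> sobolev_W21" and e: "norm e = 1" and s: "s > 0"
  shows "(real CARD('n) - 1) * (LINT x|\<sigma>. (x \<bullet> e) * (norm (f x))\<^sup>2) \<le>
     s * (LINT x|\<sigma>. (1 - (x \<bullet> e)\<^sup>2) * (norm (f x))\<^sup>2) + \<omega> CARD('n) * (sphere_norm2 (\<nabla>\<^sub>0 f))\<^sup>2 / s"
proof -
  have fs: "square_integrable f" using f by (simp add: sobolev_W21_def sphere_L2_def)
  then have sq: "square_integrable (re f)" "square_integrable (im f)"
    unfolding square_integrable_complex_iff by auto
  obtain E F where EF: "E + F = \<omega> CARD('n) * (sphere_norm2 (\<nabla>\<^sub>0 f))\<^sup>2"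
    "\<And>k. (\<Sum>n<k. eigval CARD('n) n * ip (rproj n (re f)) (rproj n (re f))) \<le> E"
    "\<And>k. (\<Sum>n<k. eigval CARD('n) n * ip (rproj n (im f)) (rproj n (im f))) \<le> F"
    using tangential_gradient_energy[OF d f] by blast
  have c: "continuous_on (sphere 0 1) (\<lambda>x::real^'n. x \<bullet> e)" "continuous_on (sphere 0 1) (\<lambda>x::real^'n. 1 - (x \<bullet> e)\<^sup>2)"
    by (intro continuous_intros)+
  show ?thesis
    using vector_field_inequality[OF d sq(1) e s EF(2)] vector_field_inequality[OF d sq(2) e s EF(3)]
    unfolding integral_weighted_norm_square[OF fs c(1)] integral_weighted_norm_square[OF fs c(2)] EF(1)[symmetric]
    by (simp add: algebra_simps add_divide_distrib)
qed

lemma tau_inner: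
  fixes f :: "real^'n \<Rightarrow> complex"
  assumes f: "square_integrable f"
  shows "(LINT x|\<sigma>. (x \<bullet> e) * (norm (f x))\<^sup>2) = \<omega> CARD('n) * (\<tau> f \<bullet> e)"
proof -
  have "integrable \<sigma> (\<lambda>x. (norm (f x))\<^sup>2 *\<^sub>R x)"
  proof (rule Bochner_Integration.integrable_bound)
    show fi: "integrable \<sigma> (\<lambda>x. (norm (f x))\<^sup>2)" using f by (simp add: square_integrable_def)
    have "(\<lambda>x::real^'n. x) \<in> borel_measurable \<sigma>" by (intro continuous_sphere_measurable continuous_intros)
    then show "(\<lambda>x. (norm (f x))\<^sup>2 *\<^sub>R x) \<in> borel_measurable \<sigma>"
      using borel_measurable_integrable[OF fi] by measurable
    show "AE x in \<sigma>. norm ((norm (f x))\<^sup>2 *\<^sub>R x) \<le> norm ((norm (f x))\<^sup>2)" by (rule AE_I2) simp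
  qed
  then have "(LINT x|\<sigma>. (norm (f x))\<^sup>2 *\<^sub>R x) \<bullet> e = (LINT x|\<sigma>. ((norm (f x))\<^sup>2 *\<^sub>R x) \<bullet> e)"
    by (intro integral_inner_left[symmetric])
  then show ?thesis
    unfolding tau_def using sphere_area_pos[where 'n='n] by (simp add: mult.commute)
qed

text \<open>Cauchy--Schwarz for \<open>a\<^sub>n = (a\<^sub>n / l\<^sub>n)\<^bsup>1/2\<^esup> (l\<^sub>n a\<^sub>n)\<^bsup>1/2\<^esup>\<close>. The factorisation fails at \<open>n = 0\<close>, where the
  eigenvalue of the Laplace--Beltrami operator is \<open>0\<close>, but that term is absent.\<close>

lemma weighted_cauchy_schwarz:
  fixes a l :: "nat \<Rightarrow> real"
  assumes a: "\<And>n. a n \<ge> 0" "a 0 = 0" and l: "\<And>n. 1 \<le> n \<Longrightarrow> l n > 0"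
    and A: "a sums A" and E: "\<And>k. (\<Sum>n<k. l n * a n) \<le> E" and D: "\<And>k. (\<Sum>n<k. a n / l n) \<le> D"
  shows "A\<^sup>2 \<le> D * E"
proof -
  have E0: "E \<ge> 0" "D \<ge> 0" using E[of 0] D[of 0] by auto
  have "(\<Sum>n<k. a n)\<^sup>2 \<le> D * E" for k
  proof -
    have l0: "a n / l n \<ge> 0" "l n * a n \<ge> 0" for n
      using a l[of n] by (cases "n = 0"; simp add: less_imp_le)+
    have "(\<Sum>n<k. a n) = (\<Sum>n<k. sqrt (a n / l n) * sqrt (l n * a n))"
    proof (intro sum.cong refl)
      fix n
      show "a n = sqrt (a n / l n) * sqrt (l n * a n)"
        using a l[of n] by (cases "n = 0") (auto simp: real_sqrt_mult[symmetric])
    qed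
    then have "(\<Sum>n<k. a n)\<^sup>2 \<le> (\<Sum>n<k. (sqrt (a n / l n))\<^sup>2) * (\<Sum>n<k. (sqrt (l n * a n))\<^sup>2)"
      using Cauchy_Schwarz_ineq_sum by metis
    also have "\<dots> = (\<Sum>n<k. a n / l n) * (\<Sum>n<k. l n * a n)"
      using l0 by simp
    also have "\<dots> \<le> D * E"
      using D E E0 l0 by (intro mult_mono sum_nonneg) auto
    finally show ?thesis .
  qed
  moreover have "(\<lambda>k. (\<Sum>n<k. a n)\<^sup>2) \<longlonglongrightarrow> A\<^sup>2"
    using A unfolding sums_def by (intro tendsto_intros)
  ultimately show ?thesis by (intro LIMSEQ_le_const2) auto
qed

text \<open>Apply the Hardy--Rellich inequality to \<open>g = (-\<Delta>\<^sub>0)\<^bsup>-1/2\<^esup> f\<close>, whose squared norm is \<open>B\<close>. Then \<open>(-\<Delta>\<^sub>0)\<^bsup>1/2\<^esup> g\<close> is \<open>f\<close> up to a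
  null set, whichever representative was chosen. The infimum over all directions is \<open>I\<close>.\<close>

lemma hardy_rellich_degree_energy:
  fixes f :: "real^'n \<Rightarrow> complex"
  assumes d: "2 \<le> CARD('n)" and f: "f \<in> sphere_L2" and mz: "mean_zero f"
    and C: "hardy_rellich_constant TYPE('n) C"
  shows "\<exists>B. (\<lambda>n. degree_energy f n / eigval CARD('n) n) sums B \<and>
    (\<exists>I. B \<le> C * I \<and> 0 \<le> I \<and> (\<forall>e. norm e = 1 \<longrightarrow> I \<le> (LINT x|\<sigma>. (1 - x \<bullet> e) * (norm (f x))\<^sup>2)))"
proof -
  have fs: "square_integrable f" using f by (simp add: sphere_L2_def)
  then have sq: "square_integrable (re f)" "square_integrable (im f)"
    unfolding square_integrable_complex_iff by auto
  define c where "c n = 1 / sqrt (eigval CARD('n) n)" for n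
  have c1: "c n \<le> 1" "c n \<ge> 0" "c n * c n = 1 / eigval CARD('n) n" for n
  proof -
    show "c n * c n = 1 / eigval CARD('n) n" using eigval_nonneg[OF d, of n] by (simp add: c_def)
    show "c n \<ge> 0" using eigval_nonneg[OF d, of n] by (simp add: c_def)
    show "c n \<le> 1"
    proof (cases "n = 0")
      case False
      then have "eigval CARD('n) n \<ge> 1" using eigval_ge[OF d, of n] d by simp
      then show ?thesis by (simp add: c_def)
    qed (simp add: c_def eigval_def)
  qed
  have ex: "\<exists>w. square_integrable w \<and> (\<forall>n. rproj n w = (\<lambda>x. c n * rproj n u x))"
    if u: "square_integrable u" for u :: "real^'n \<Rightarrow> real"
  proof -
    have "summable (\<lambda>n. ip (\<lambda>x. c n * rproj n u x) (\<lambda>x. c n * rproj n u x))"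
    proof (rule summable_comparison_test'[OF sums_summable[OF parseval[OF d u]]])
      show "norm (ip (\<lambda>x. c n * rproj n u x) (\<lambda>x. c n * rproj n u x)) \<le> ip (rproj n u) (rproj n u)" for n
      proof -
        have cc: "0 \<le> c n * c n" "c n * c n \<le> 1" using c1(1,2)[of n] by (auto intro: mult_le_one)
        have "0 \<le> c n * c n * ip (rproj n u) (rproj n u)" using cc(1) ip_nonneg by (rule mult_nonneg_nonneg)
        then show ?thesis
          using mult_left_le_one_le[OF ip_nonneg cc, of "rproj n u"]
          by (simp only: ip_scale_both real_norm_def abs_of_nonneg)
      qed
    qed
    from riesz_fischer[OF d harmonics_scale[OF rproj_harmonics[OF u]] this] show ?thesis by blast
  qed
  obtain g1 where g1: "square_integrable g1" "\<And>n. rproj n g1 = (\<lambda>x. c n * rproj n (re f) x)"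
    using ex[OF sq(1)] by blast
  obtain g2 where g2: "square_integrable g2" "\<And>n. rproj n g2 = (\<lambda>x. c n * rproj n (im f) x)"
    "3 \<le> CARD('n) \<Longrightarrow> g2 = (\<lambda>x. 0)"
  proof (cases "3 \<le> CARD('n)")
    case True
    have "rproj n (\<lambda>x::real^'n. 0) = (\<lambda>x. c n * rproj n (im f) x)" for n
      unfolding rproj_im_zero[OF f True]
      by (rule rproj_eqI) (auto intro: square_integrable_continuous harmonics_zero)
    then show ?thesis by (intro that[of "\<lambda>x. 0"]) (auto intro: square_integrable_continuous)
  next
    case False
    then show ?thesis using ex[OF sq(2)] that by blast
  qed
  define g where "g x = Complex (g1 x) (g2 x)" for x
  have gr: "re g = g1" "im g = g2" by (auto simp: g_def)
  have gs: "square_integrable g" unfolding square_integrable_complex_iff gr using g1 g2 by blast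
  have gL: "g \<in> sphere_L2"
    unfolding sphere_L2_def scalar_convention_def using gs g2(3) by (auto simp: g_def complex_is_Real_iff)
  have f0: "rproj 0 (re f) = (\<lambda>x. 0)" "rproj 0 (im f) = (\<lambda>x. 0)"
    using mz unfolding mean_zero_iff[OF fs] by auto
  have sc: "sqrt (eigval CARD('n) n) * c n = 1" if "n \<noteq> 0" for n
  proof -
    have "eigval CARD('n) n > 0" using eigval_ge[OF d, of n] that d by simp
    then show ?thesis by (simp add: c_def)
  qed
  have lbf: "is_LB_power (1/2) g f"
    unfolding is_LB_power_half_iff[OF d gL] gr g1(2) g2(2)
  proof (intro conjI allI f)
    fix n
    show "rproj n (re f) = (\<lambda>x. sqrt (eigval CARD('n) n) * (c n * rproj n (re f) x))"
      using sc[of n] f0 by (cases "n = 0") (simp_all add: mult.assoc[symmetric])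
    show "rproj n (im f) = (\<lambda>x. sqrt (eigval CARD('n) n) * (c n * rproj n (im f) x))"
      using sc[of n] f0 by (cases "n = 0") (simp_all add: mult.assoc[symmetric])
  qed
  then have gW: "g \<in> sobolev_W21" using gL by (auto simp: sobolev_W21_def)
  have gm: "mean_zero g" unfolding mean_zero_iff[OF gs] gr g1(2) g2(2) using f0 by simp
  define h where "h = LB_power (1/2) g"
  have "is_LB_power (1/2) g h" unfolding h_def LB_power_def by (rule someI[where P = "is_LB_power (1/2) g", OF lbf])
  then have h: "h \<in> sphere_L2" "\<And>n. rproj n (re h) = rproj n (re f)" "\<And>n. rproj n (im h) = rproj n (im f)"
    using lbf unfolding is_LB_power_half_iff[OF d gL] by auto
  have hs: "square_integrable (re h)" "square_integrable (im h)"
    using h(1) unfolding sphere_L2_def square_integrable_complex_iff by auto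
  have ae: "AE x in \<sigma>. a x - b x = 0"
    if "square_integrable a" "square_integrable b" "\<And>n. rproj n a = rproj n b" for a b :: "real^'n \<Rightarrow> real"
  proof (rule harmonics_complete[OF square_integrable_diff[OF that(1,2)]])
    fix n and q :: "real^'n \<Rightarrow> real" assume q: "q \<in> harmonics n"
    show "ip (\<lambda>x. a x - b x) q = 0"
      using rproj_ip[OF that(1) q] rproj_ip[OF that(2) q] that(3)[of n]
      by (simp add: ip_diff_left that square_integrable_harmonics[OF q])
  qed
  have hf: "AE x in \<sigma>. h x = f x"
    using ae[OF hs(1) sq(1) h(2)] ae[OF hs(2) sq(2) h(3)]
    by eventually_elim (simp add: complex_eq_iff)
  have heq: "(LINT x|\<sigma>. (1 - x \<bullet> e) * (norm (h x))\<^sup>2) = (LINT x|\<sigma>. (1 - x \<bullet> e) * (norm (f x))\<^sup>2)" for e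
  proof (rule integral_cong_AE)
    have e [measurable]: "(\<lambda>x::real^'n. 1 - x \<bullet> e) \<in> borel_measurable \<sigma>"
      by (intro continuous_sphere_measurable continuous_intros)
    have [measurable]: "f \<in> borel_measurable \<sigma>" "h \<in> borel_measurable \<sigma>"
      using f h(1) by (simp_all add: sphere_L2_def square_integrable_def)
    show "(\<lambda>x. (1 - x \<bullet> e) * (norm (h x))\<^sup>2) \<in> borel_measurable \<sigma>"
      "(\<lambda>x. (1 - x \<bullet> e) * (norm (f x))\<^sup>2) \<in> borel_measurable \<sigma>" by measurable
    show "AE x in \<sigma>. (1 - x \<bullet> e) * (norm (h x))\<^sup>2 = (1 - x \<bullet> e) * (norm (f x))\<^sup>2"
      using hf by eventually_elim simp
  qed
  let ?J = "\<lambda>e. LINT x|\<sigma>. (1 - x \<bullet> e) * (norm (f x))\<^sup>2"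
  have J0: "0 \<le> ?J e" if "norm e = 1" for e
  proof (rule Bochner_Integration.integral_nonneg)
    fix x :: "real^'n" assume "x \<in> space \<sigma>"
    then have "x \<bullet> e \<le> 1" using norm_cauchy_schwarz[of x e] that by simp
    then show "0 \<le> (1 - x \<bullet> e) * (norm (f x))\<^sup>2" by simp
  qed
  let ?I = "INF e\<in>sphere 0 1. ?J e"
  have bdd: "bdd_below (?J ` sphere 0 1)" using J0 by (intro bdd_belowI[of _ 0]) auto
  have ne: "sphere (0::real^'n) 1 \<noteq> {}"
    using norm_axis_1[of undefined] by (metis empty_iff mem_sphere_0)
  have "(LINT x|\<sigma>. (norm (g x))\<^sup>2) \<le> C * ?I"
  proof -
    have "(LINT x|\<sigma>. (norm (g x))\<^sup>2) \<le>
        C * (INF e\<in>sphere 0 1. LINT x|\<sigma>. (1 - x \<bullet> e) * (norm (LB_power (1/2) g x))\<^sup>2)"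
      using C gW gm unfolding hardy_rellich_constant_def by blast
    then show ?thesis unfolding h_def[symmetric] heq .
  qed
  moreover have "0 \<le> ?I" using ne J0 by (intro cINF_greatest) auto
  moreover have "?I \<le> ?J e" if "norm e = 1" for e using that by (intro cINF_lower bdd) auto
  moreover have "(\<lambda>n. degree_energy f n / eigval CARD('n) n) sums (LINT x|\<sigma>. (norm (g x))\<^sup>2)"
  proof -
    have "degree_energy g = (\<lambda>n. degree_energy f n / eigval CARD('n) n)"
      unfolding fun_eq_iff degree_energy_def gr g1(2) g2(2) ip_scale_both c1(3) by (simp add: add_divide_distrib)
    then show ?thesis
      using degree_energy_sums[OF d gs] sphere_area_pos[where 'n='n] by (simp add: sphere_norm2_square)
  qed
  ultimately show ?thesis by blast
qed

section \<open>Harmonics in the plane\<close>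

definition plane_coordinate :: "'n \<Rightarrow> 'n \<Rightarrow> real^'n \<Rightarrow> complex" where
  "plane_coordinate i j x = Complex (x $ i) (x $ j)"

text \<open>A plane with named coordinates, so that points become complex numbers.\<close>

locale plane =
  fixes i j :: "'n::finite"
  assumes ij: "i \<noteq> j" and UNIV_ij: "(UNIV :: 'n set) = {i, j}"
begin

abbreviation z :: "real^'n \<Rightarrow> complex" where "z \<equiv> plane_coordinate i j"

lemma card2: "CARD('n) = 2"
  unfolding UNIV_ij using ij by simp

lemma sum_ij: "(\<Sum>k\<in>UNIV. f k) = f i + f j"
  unfolding UNIV_ij using ij by simp

lemma norm_z: "x \<in> sphere 0 1 \<Longrightarrow> norm (z x) = 1"
proof -
  assume "x \<in> sphere 0 1"
  then have "x \<bullet> x = 1" by (simp add: norm_eq_1)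
  then have "(x $ i)\<^sup>2 + (x $ j)\<^sup>2 = 1" by (simp add: inner_vec_def sum_ij power2_eq_square)
  then show ?thesis by (simp add: plane_coordinate_def cmod_def)
qed

lemma bounded_linear_z: "bounded_linear z"
proof -
  have "z = (\<lambda>x. of_real (x $ i) + \<i> * of_real (x $ j))"
    by (auto simp: plane_coordinate_def complex_eq_iff)
  then show ?thesis
    by (auto intro!: bounded_linear_add bounded_linear_const_mult
        bounded_linear_compose[OF bounded_linear_of_real bounded_linear_vec_nth])
qed

lemma continuous_z [continuous_intros]: "continuous_on S z"
  by (rule linear_continuous_on[OF bounded_linear_z])

lemma re_power_has_gradient:
  "has_gradient (\<lambda>x. Re (c * z x ^ n))
     (\<lambda>x. \<chi> k. if k = i then Re (of_nat n * c * z x ^ (n - 1)) else - Im (of_nat n * c * z x ^ (n - 1)))"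
  unfolding has_gradient_def
proof safe
  fix x
  have "((\<lambda>x. Re (c * z x ^ n)) has_derivative (\<lambda>h. Re (of_nat n * c * z x ^ (n - 1) * z h))) (at x)"
    by (auto intro!: derivative_eq_intros bounded_linear.has_derivative[OF bounded_linear_Re]
        bounded_linear_imp_has_derivative[OF bounded_linear_z] simp: algebra_simps)
  moreover have "Re (w * z h) = (\<chi> k. if k = i then Re w else - Im w) \<bullet> h" for w h
    using ij by (simp add: inner_vec_def sum_ij plane_coordinate_def)
  ultimately show "((\<lambda>x. Re (c * z x ^ n)) has_derivative
      (\<bullet>) (\<chi> k. if k = i then Re (of_nat n * c * z x ^ (n - 1)) else - Im (of_nat n * c * z x ^ (n - 1)))) (at x)"
    by (simp only:)
  show "continuous_on UNIV (\<lambda>x. \<chi> k. if k = i then Re (of_nat n * c * z x ^ (n - 1)) else - Im (of_nat n * c * z x ^ (n - 1)))"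
  proof (rule continuous_on_vec_lambda)
    fix k show "continuous_on UNIV (\<lambda>x. if k = i then Re (of_nat n * c * z x ^ (n - 1)) else - Im (of_nat n * c * z x ^ (n - 1)))"
      by (cases "k = i") (auto intro!: continuous_intros)
  qed
qed

lemma re_power_hpoly: "(\<lambda>x. Re (c * z x ^ n)) \<in> hpoly n"
proof (induction n arbitrary: c)
  case 0
  then show ?case by (simp add: hpoly_const del: hpoly.simps)
next
  case (Suc n)
  have "(\<lambda>x. Re (c * z x ^ Suc n)) = (\<lambda>x. x $ i * Re (c * z x ^ n) + x $ j * Re (\<i> * c * z x ^ n))"
    by (auto simp: plane_coordinate_def algebra_simps)
  then show ?case by (simp only: hpoly_add hpoly_coord_mult Suc)
qed

lemma re_power_harmonics: "(\<lambda>x. Re (c * z x ^ n)) \<in> harmonics n"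
proof -
  let ?D = "\<lambda>c n x. \<chi> k. if k = i then Re (of_nat n * c * z x ^ (n - 1)) else - Im (of_nat n * c * z x ^ (n - 1))"
  have g: "grad (\<lambda>x. Re (c * z x ^ n)) = ?D c n" for c n
    by (rule has_gradient_unique[OF re_power_has_gradient])
  have 1: "(\<lambda>x. ?D c n x $ i) = (\<lambda>x. Re ((of_nat n * c) * z x ^ (n - 1)))" for c n
    by simp
  have 2: "(\<lambda>x. ?D c n x $ j) = (\<lambda>x. Re ((\<i> * (of_nat n * c)) * z x ^ (n - 1)))" for c n
    using ij by (simp add: fun_eq_iff algebra_simps)
  have "lap (\<lambda>x. Re (c * z x ^ n)) x = 0" for x
  proof -
    have "lap (\<lambda>x. Re (c * z x ^ n)) x = grad (\<lambda>x. Re ((of_nat n * c) * z x ^ (n - 1))) x $ i +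
       grad (\<lambda>x. Re ((\<i> * (of_nat n * c)) * z x ^ (n - 1))) x $ j"
      unfolding lap_def sum_ij g[of c n] 1 2 ..
    also have "\<dots> = 0" unfolding g using ij by (simp add: algebra_simps)
    finally show ?thesis .
  qed
  then show ?thesis using re_power_hpoly by (simp add: harmonics_def)
qed

text \<open>Functions that agree on the circle with the real part of a polynomial in \<open>z\<close>.\<close>

definition trig_poly :: "(real^'n \<Rightarrow> real) set" where
  "trig_poly = {u. \<exists>N c. (\<forall>n>N. c n = 0) \<and> (\<forall>x\<in>sphere 0 1. u x = (\<Sum>n\<le>N. Re (c n * z x ^ n)))}"

lemma trig_polyD:
  "u \<in> trig_poly \<Longrightarrow> \<exists>N c. (\<forall>n>N. c n = 0) \<and> (\<forall>x\<in>sphere 0 1. u x = (\<Sum>n\<le>N. Re (c n * z x ^ n)))"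
  by (simp only: trig_poly_def mem_Collect_eq)

lemma trig_poly_power: "(\<lambda>x. Re (c * z x ^ n)) \<in> trig_poly"
proof -
  have "Re (c * z x ^ n) = (\<Sum>k\<le>n. Re ((if k = n then c else 0) * z x ^ k))" for x
    by (simp add: if_distrib[of "\<lambda>a. a * _"] if_distrib[of Re] cong: if_cong)
  then show ?thesis unfolding trig_poly_def
    by (intro CollectI exI[of _ n] exI[of _ "\<lambda>k. if k = n then c else 0"]) auto
qed

lemma trig_poly_cong: "u \<in> trig_poly \<Longrightarrow> (\<And>x. x \<in> sphere 0 1 \<Longrightarrow> v x = u x) \<Longrightarrow> v \<in> trig_poly"
  unfolding trig_poly_def by (simp del: mem_sphere_0)

lemma trig_poly_add: "u \<in> trig_poly \<Longrightarrow> v \<in> trig_poly \<Longrightarrow> (\<lambda>x. u x + v x) \<in> trig_poly"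
proof -
  assume uv: "u \<in> trig_poly" "v \<in> trig_poly"
  from trig_polyD[OF uv(1)] obtain N c where
    u': "(\<forall>n>N. c n = 0) \<and> (\<forall>x\<in>sphere 0 1. u x = (\<Sum>n\<le>N. Re (c n * z x ^ n)))" by (elim exE)
  from trig_polyD[OF uv(2)] obtain M e where
    v': "(\<forall>n>M. e n = 0) \<and> (\<forall>x\<in>sphere 0 1. v x = (\<Sum>n\<le>M. Re (e n * z x ^ n)))" by (elim exE)
  have u: "\<And>n. n > N \<Longrightarrow> c n = 0" "\<And>x. x \<in> sphere 0 1 \<Longrightarrow> u x = (\<Sum>n\<le>N. Re (c n * z x ^ n))"
    and v: "\<And>n. n > M \<Longrightarrow> e n = 0" "\<And>x. x \<in> sphere 0 1 \<Longrightarrow> v x = (\<Sum>n\<le>M. Re (e n * z x ^ n))"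
    using u' v' by blast+
  have "u x + v x = (\<Sum>n\<le>max N M. Re ((c n + e n) * z x ^ n))" if x: "x \<in> sphere 0 1" for x
  proof -
    have "(\<Sum>n\<le>N. Re (c n * z x ^ n)) = (\<Sum>n\<le>max N M. Re (c n * z x ^ n))"
      by (rule sum.mono_neutral_left) (use u(1) in auto)
    moreover have "(\<Sum>n\<le>M. Re (e n * z x ^ n)) = (\<Sum>n\<le>max N M. Re (e n * z x ^ n))"
      by (rule sum.mono_neutral_left) (use v(1) in auto)
    ultimately show ?thesis
      unfolding u(2)[OF x] v(2)[OF x] by (simp add: distrib_right sum.distrib del: times_complex.sel)
  qed
  then show ?thesis unfolding trig_poly_def using u(1) v(1)
    by (intro CollectI exI[of _ "max N M"] exI[of _ "\<lambda>n. c n + e n"]) auto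
qed

lemma trig_poly_sum: "finite I \<Longrightarrow> (\<And>k. k \<in> I \<Longrightarrow> u k \<in> trig_poly) \<Longrightarrow> (\<lambda>x. \<Sum>k\<in>I. u k x) \<in> trig_poly"
proof (induction I rule: finite_induct)
  case empty
  then show ?case using trig_poly_power[of 0 0] by simp
qed (auto intro: trig_poly_add)

text \<open>\<open>Re a \<cdot> Re b = (Re (a b) + Re (cnj a b)) / 2\<close>, and \<open>cnj z \<cdot> z = 1\<close> on the circle.\<close>

lemma trig_poly_mult_power: "(\<lambda>x. Re (b * z x) * Re (c * z x ^ n)) \<in> trig_poly"
proof -
  have eq: "Re (b * z x) * Re (c * z x ^ n) = Re (b * c / 2 * z x ^ Suc n) + Re (cnj (b * z x) * c / 2 * z x ^ n)" for x
    by (simp add: field_simps)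
  show ?thesis
  proof (cases n)
    case 0
    have "Re (b * z x) * Re (c * z x ^ n) = Re (Re c * b * z x ^ 1)" for x by (simp add: 0 algebra_simps)
    then show ?thesis using trig_poly_power[of "Re c * b" 1] by simp
  next
    case (Suc m)
    have "(\<lambda>x. Re (b * c / 2 * z x ^ Suc n) + Re (cnj b * c / 2 * z x ^ m)) \<in> trig_poly"
      by (intro trig_poly_add trig_poly_power)
    then show ?thesis
    proof (rule trig_poly_cong)
      fix x :: "real^'n" assume x: "x \<in> sphere 0 1"
      have "z x * cnj (z x) = 1" using norm_z[OF x] by (simp add: complex_norm_square[symmetric])
      then have "cnj (b * z x) * c / 2 * z x ^ n = cnj b * c / 2 * z x ^ m"
        by (simp add: Suc) (metis (no_types, opaque_lifting) mult.assoc mult.commute mult_1)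
      then show "Re (b * z x) * Re (c * z x ^ n) = Re (b * c / 2 * z x ^ Suc n) + Re (cnj b * c / 2 * z x ^ m)"
        by (simp only: eq)
    qed
  qed
qed

lemma trig_poly_mult: "u \<in> trig_poly \<Longrightarrow> (\<lambda>x. Re (b * z x) * u x) \<in> trig_poly"
proof -
  assume "u \<in> trig_poly"
  from trig_polyD[OF this] obtain N c where
    u': "(\<forall>n>N. c n = 0) \<and> (\<forall>x\<in>sphere 0 1. u x = (\<Sum>n\<le>N. Re (c n * z x ^ n)))" by (elim exE)
  then have u: "\<And>x. x \<in> sphere 0 1 \<Longrightarrow> u x = (\<Sum>n\<le>N. Re (c n * z x ^ n))" by blast
  have "(\<lambda>x. \<Sum>n\<le>N. Re (b * z x) * Re (c n * z x ^ n)) \<in> trig_poly"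
    by (intro trig_poly_sum trig_poly_mult_power) auto
  then show ?thesis
    by (rule trig_poly_cong) (simp add: u sum_distrib_left del: mem_sphere_0 times_complex.sel)
qed

lemma hpoly_trig_poly: "p \<in> hpoly n \<Longrightarrow> p \<in> trig_poly"
proof (induction n arbitrary: p)
  case 0
  then obtain c where "p = (\<lambda>x. c)" by auto
  then show ?case using trig_poly_power[of "of_real c" 0] by simp
next
  case (Suc n)
  then obtain q where q: "p = (\<lambda>x. \<Sum>k\<in>UNIV. x $ k * q k x)" "\<And>k. q k \<in> hpoly n"
    by (auto simp: hpoly_Suc_iff)
  have "(\<lambda>x. Re (1 * z x) * q i x + Re (- \<i> * z x) * q j x) \<in> trig_poly"
    by (intro trig_poly_add trig_poly_mult Suc.IH q)
  then show ?case
    by (rule trig_poly_cong) (simp add: q sum_ij plane_coordinate_def)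
qed

text \<open>On the circle \<open>p\<close> is a sum of the harmonics \<open>Re (c\<^sub>k z\<^sup>k)\<close> of degree \<open>k\<close>; by orthogonality only the term of degree \<open>n\<close>
  contributes to inner products with harmonics of degree \<open>n\<close>.\<close>

lemma harmonics_plane:
  assumes p: "p \<in> harmonics n"
  shows "\<exists>c. p = (\<lambda>x. Re (c * z x ^ n))"
proof -
  have d: "2 \<le> CARD('n)" using card2 by simp
  from trig_polyD[OF hpoly_trig_poly[OF harmonics_hpoly[OF p]]] obtain N c where
    c': "(\<forall>k>N. c k = 0) \<and> (\<forall>x\<in>sphere 0 1. p x = (\<Sum>k\<le>N. Re (c k * z x ^ k)))" by (elim exE)
  then have c: "\<And>k. k > N \<Longrightarrow> c k = 0"
    "\<And>x. x \<in> sphere 0 1 \<Longrightarrow> p x = (\<Sum>k\<le>N. Re (c k * z x ^ k))" by blast+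
  let ?h = "\<lambda>k x. Re (c k * z x ^ k)"
  have "p = ?h n"
  proof (rule rproj_unique[OF p re_power_harmonics])
    fix q :: "real^'n \<Rightarrow> real" assume q: "q \<in> harmonics n"
    have "ip p q = ip (\<lambda>x. \<Sum>k\<le>N. ?h k x) q"
      unfolding ip_def by (intro Bochner_Integration.integral_cong) (auto simp: c(2) simp del: mem_sphere_0)
    also have "\<dots> = (\<Sum>k\<le>N. ip (?h k) q)"
      by (intro ip_sum_left square_integrable_harmonics[OF re_power_harmonics] square_integrable_harmonics[OF q]) auto
    also have "\<dots> = (\<Sum>k\<le>N. if k = n then ip (?h n) q else 0)"
      using harmonics_orthogonal[OF d re_power_harmonics q] by (intro sum.cong) auto
    also have "\<dots> = ip (?h n) q"
      using c(1)[of n] by (cases "n \<le> N") (auto simp: ip_def)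
    finally show "ip p q = ip (?h n) q" .
  qed
  then show ?thesis by blast
qed

lemma integral_power_z: "1 \<le> n \<Longrightarrow> (LINT x|\<sigma>. z x ^ n) = 0"
proof -
  assume n: "1 \<le> n"
  have d: "2 \<le> CARD('n)" using card2 by simp
  have 0: "(LINT x|\<sigma>. Re (c * z x ^ n)) = 0" for c
    using harmonics_orthogonal[OF d re_power_harmonics[of c n] const_harmonics_0[of 1]] n by (simp add: ip_def)
  have "integrable \<sigma> (\<lambda>x. z x ^ n)" by (intro continuous_sphere_integrable continuous_intros)
  from complex_integral_eq[OF this] 0[of 1] 0[of "-\<i>"] show ?thesis
    by (simp add: complex_eq_iff)
qed

text \<open>On the circle a power of \<open>w z\<close> times the conjugate of a lower one is again a positive power, with integral \<open>0\<close>.\<close>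

lemma parseval_circle:
  assumes w: "norm w = 1"
  shows "(LINT x|\<sigma>. (norm (\<Sum>n\<le>N. c n * (w * z x) ^ n))\<^sup>2) = \<omega> 2 * (\<Sum>n\<le>N. (norm (c n))\<^sup>2)"
proof -
  let ?y = "\<lambda>x. w * z x"
  have y1: "?y x * cnj (?y x) = 1" if "x \<in> sphere 0 1" for x
    using norm_z[OF that] w by (simp add: complex_norm_square[symmetric] norm_mult del: complex_cnj_mult)
  have I: "(LINT x|\<sigma>. ?y x ^ m * cnj (?y x) ^ n) = (if m = n then of_real (\<omega> 2) else 0)" for m n
  proof -
    have pos: "(LINT x|\<sigma>. ?y x ^ k) = 0" if "1 \<le> k" for k
      using integral_power_z[OF that] by (simp add: power_mult_distrib)
    have ge: "(LINT x|\<sigma>. ?y x ^ (n + k) * cnj (?y x) ^ n) = (if k = 0 then of_real (\<omega> 2) else 0)" for n k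
    proof -
      have "(LINT x|\<sigma>. ?y x ^ (n + k) * cnj (?y x) ^ n) = (LINT x|\<sigma>. ?y x ^ k)"
      proof (intro Bochner_Integration.integral_cong refl)
        fix x :: "real^'n" assume "x \<in> space \<sigma>"
        then have "?y x * cnj (?y x) = 1" using y1 by simp
        have "?y x ^ (n + k) * cnj (?y x) ^ n = (?y x * cnj (?y x)) ^ n * ?y x ^ k"
          by (simp only: power_add power_mult_distrib mult_ac)
        then show "?y x ^ (n + k) * cnj (?y x) ^ n = ?y x ^ k"
          unfolding \<open>?y x * cnj (?y x) = 1\<close> by simp
      qed
      also have "\<dots> = (if k = 0 then of_real (\<omega> 2) else 0)"
        using pos[of k] measure_sphere[where 'n='n] by (auto simp: card2 scaleR_conv_of_real)
      finally show ?thesis .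
    qed
    show ?thesis
    proof (cases "n \<le> m")
      case True
      then show ?thesis using ge[of n "m - n"] by auto
    next
      case False
      then have "(LINT x|\<sigma>. ?y x ^ n * cnj (?y x) ^ m) = 0" using ge[of m "n - m"] by auto
      moreover have "(LINT x|\<sigma>. ?y x ^ m * cnj (?y x) ^ n) = cnj (LINT x|\<sigma>. ?y x ^ n * cnj (?y x) ^ m)"
      proof -
        have "(LINT x|\<sigma>. ?y x ^ m * cnj (?y x) ^ n) = (LINT x|\<sigma>. cnj (?y x ^ n * cnj (?y x) ^ m))"
          by (intro Bochner_Integration.integral_cong refl) (simp add: mult.commute)
        then show ?thesis by (simp only: Bochner_Integration.integral_cnj)
      qed
      ultimately show ?thesis using False by simp
    qed
  qed
  have cont: "continuous_on (sphere 0 1) (\<lambda>x. ?y x ^ m * cnj (?y x) ^ n)" for m n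
    by (intro continuous_intros)
  have "of_real (LINT x|\<sigma>. (norm (\<Sum>n\<le>N. c n * ?y x ^ n))\<^sup>2) =
      (LINT x|\<sigma>. complex_of_real ((norm (\<Sum>n\<le>N. c n * ?y x ^ n))\<^sup>2))"
    by (intro integral_of_real[symmetric] continuous_sphere_integrable continuous_intros)
  also have "\<dots> = (LINT x|\<sigma>. (\<Sum>m\<le>N. \<Sum>n\<le>N. c m * cnj (c n) * (?y x ^ m * cnj (?y x) ^ n)))"
    by (intro Bochner_Integration.integral_cong refl)
       (simp only: complex_norm_square sum_product cnj_sum complex_cnj_mult complex_cnj_power mult_ac)
  also have "\<dots> = (\<Sum>m\<le>N. \<Sum>n\<le>N. c m * cnj (c n) * (LINT x|\<sigma>. ?y x ^ m * cnj (?y x) ^ n))"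
    using continuous_sphere_integrable[OF cont] by (simp del: complex_cnj_mult)
  also have "\<dots> = (\<Sum>m\<le>N. c m * cnj (c m) * of_real (\<omega> 2))"
    unfolding I by (simp add: if_distrib cong: if_cong)
  also have "\<dots> = of_real (\<omega> 2 * (\<Sum>n\<le>N. (norm (c n))\<^sup>2))"
    by (simp only: of_real_mult of_real_sum complex_norm_square sum_distrib_left mult_ac)
  finally show ?thesis by (simp only: of_real_eq_iff)
qed

end

text \<open>The discrete Hardy inequality with constant \<open>4\<close>. The extra term \<open>2 x\<^sub>N\<^sup>2 / N\<close> makes the
  induction work: given it, the new difference can be minimised over \<open>x\<^sub>N\<close>.\<close>

lemma discrete_hardy:
  fixes x :: "nat \<Rightarrow> real"
  assumes "x 0 = 0"
  shows "(\<Sum>n=1..N. (x n)\<^sup>2 / (real n)\<^sup>2) + 2 * (x N)\<^sup>2 / real N \<le> 4 * (\<Sum>n=1..N. (x n - x (n - 1))\<^sup>2)"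
proof (induction N)
  case (Suc N)
  show ?case
  proof (cases "N = 0")
    case True
    then show ?thesis using assms by simp
  next
    case False
    then have N: "real N > 0" by simp
    let ?a = "x N" and ?b = "x (Suc N)" and ?r = "real N"
    have "?b\<^sup>2 / (?r + 1)\<^sup>2 + 2 * ?b\<^sup>2 / (?r + 1) \<le> 4 * ?b\<^sup>2 / (2 * ?r + 1)"
    proof -
      have "1 / (?r + 1)\<^sup>2 + 2 / (?r + 1) \<le> 4 / (2 * ?r + 1)"
        using N by (simp add: divide_simps power2_eq_square) (simp add: algebra_simps)
      then have "?b\<^sup>2 * (1 / (?r + 1)\<^sup>2 + 2 / (?r + 1)) \<le> ?b\<^sup>2 * (4 / (2 * ?r + 1))"
        by (intro mult_left_mono) auto
      then show ?thesis by (simp add: algebra_simps)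
    qed
    also have "\<dots> \<le> 4 * (?b - ?a)\<^sup>2 + 2 * ?a\<^sup>2 / ?r"
    proof -
      have "4 * (?b - ?a)\<^sup>2 + 2 * ?a\<^sup>2 / ?r - 4 * ?b\<^sup>2 / (2 * ?r + 1) =
        2 * ((2 * ?r + 1) * ?a - 2 * ?r * ?b)\<^sup>2 / (?r * (2 * ?r + 1))"
        using N by (simp add: divide_simps) (simp add: power2_eq_square algebra_simps)
      moreover have "\<dots> \<ge> 0" using N by simp
      ultimately show ?thesis by linarith
    qed
    finally have "?b\<^sup>2 / (?r + 1)\<^sup>2 + 2 * ?b\<^sup>2 / (?r + 1) \<le> 4 * (?b - ?a)\<^sup>2 + 2 * ?a\<^sup>2 / ?r" .
    then show ?thesis using Suc.IH by (simp add: add.commute)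
  qed
qed simp

section \<open>The Hardy--Rellich inequality on the circle\<close>

context plane
begin

lemma integral_shifted_poly:
  assumes w: "norm w = 1"
  shows "(LINT x|\<sigma>. (w * z x) * poly Q (w * z x)) = 0"
proof -
  let ?y = "\<lambda>x. w * z x"
  have 0: "(LINT x|\<sigma>. ?y x ^ Suc n) = 0" for n
    using integral_power_z[of "Suc n"] by (simp add: power_mult_distrib del: power_Suc)
  have "(LINT x|\<sigma>. ?y x * poly Q (?y x)) = (LINT x|\<sigma>. (\<Sum>n\<le>degree Q. coeff Q n * ?y x ^ Suc n))"
    by (simp add: poly_altdef sum_distrib_left algebra_simps)
  also have "\<dots> = (\<Sum>n\<le>degree Q. coeff Q n * (LINT x|\<sigma>. ?y x ^ Suc n))"
  proof (subst Bochner_Integration.integral_sum)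
    show "integrable \<sigma> (\<lambda>x. coeff Q n * ?y x ^ Suc n)" for n
      by (intro continuous_sphere_integrable continuous_intros)
  qed simp
  finally show ?thesis unfolding 0 by simp
qed

text \<open>With \<open>U = \<Sum> a\<^sub>n y\<^sup>n\<close>, \<open>2 (Re U)\<^sup>2 = \<bar>U\<bar>\<^sup>2 + Re U\<^sup>2\<close>, where \<open>U\<^sup>2\<close> only contains powers at least \<open>2\<close>, so that
  \<open>(1 - Re y) U\<^sup>2\<close> integrates to \<open>0\<close>; on the circle \<open>2 (1 - Re y) = \<bar>1 - y\<bar>\<^sup>2\<close>, and \<open>(1 - y) U\<close> has the
  differences \<open>a\<^sub>n - a\<^sub>n\<^sub>-\<^sub>1\<close> as coefficients.\<close>

lemma weighted_integral_circle:
  fixes a :: "nat \<Rightarrow> complex" and m :: nat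
  assumes w: "norm w = 1" and a0: "a 0 = 0"
  defines "b \<equiv> \<lambda>n. (if n \<le> m then a n else 0) - (if n = 0 then 0 else a (n - 1))"
  shows "(LINT x|\<sigma>. (1 - Re (w * z x)) * (Re (\<Sum>n\<le>m. a n * (w * z x) ^ n))\<^sup>2) = \<omega> 2 / 4 * (\<Sum>n\<le>Suc m. (norm (b n))\<^sup>2)"
proof -
  let ?y = "\<lambda>x. w * z x"
  let ?U = "\<lambda>x. \<Sum>n\<le>m. a n * ?y x ^ n"
  have y1: "norm (?y x) = 1" if "x \<in> sphere 0 1" for x
    using norm_z[OF that] w by (simp add: norm_mult)
  have cy: "continuous_on S ?y" for S by (intro continuous_intros)
  have cU: "continuous_on S ?U" for S by (intro continuous_intros)
  \<comment> \<open>\<open>U = y V\<close>, as \<open>a 0 = 0\<close>; this supplies the two factors \<open>y\<close> that compensate the \<open>cnj y\<close> in \<open>Re y\<close>.\<close>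
  define V where "V = (\<Sum>n<m. monom (a (Suc n)) n)"
  have UV: "(\<Sum>n\<le>m. a n * y ^ n) = y * poly V y" for y
  proof -
    have "(\<Sum>n\<le>m. a n * y ^ n) = (\<Sum>n<Suc m. a n * y ^ n)" by (simp only: lessThan_Suc_atMost)
    also have "\<dots> = (\<Sum>n<m. a (Suc n) * y ^ Suc n)"
      by (subst sum.lessThan_Suc_shift) (simp add: a0)
    also have "\<dots> = y * poly V y"
      by (simp add: V_def poly_sum poly_monom sum_distrib_left algebra_simps)
    finally show ?thesis .
  qed
  have zero: "(LINT x|\<sigma>. of_real (1 - Re (?y x)) * (?U x)\<^sup>2) = 0"
  proof -
    have "(LINT x|\<sigma>. of_real (1 - Re (?y x)) * (?U x)\<^sup>2) =
        (LINT x|\<sigma>. ?y x * poly ([:-1/2, 1, -1/2:] * V * V) (?y x))"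
    proof (intro Bochner_Integration.integral_cong refl)
      fix x :: "real^'n" assume "x \<in> space \<sigma>"
      then have yy: "?y x * cnj (?y x) = 1"
        using y1[of x] by (simp add: complex_norm_square[symmetric] del: complex_cnj_mult)
      have r: "complex_of_real (1 - Re y) * y = y - (y * y) / 2 - 1 / 2" if "y * cnj y = 1" for y
      proof -
        have "complex_of_real (Re y) = (y + cnj y) / 2" by (simp add: complex_add_cnj)
        then have "complex_of_real (1 - Re y) * y = y - (y * y + y * cnj y) / 2"
          by (simp add: algebra_simps)
        then show ?thesis using that by (simp add: add_divide_distrib)
      qed
      show "of_real (1 - Re (?y x)) * (?U x)\<^sup>2 = ?y x * poly ([:-1/2, 1, -1/2:] * V * V) (?y x)"
      proof -
        have "of_real (1 - Re (?y x)) * (?U x)\<^sup>2 = (of_real (1 - Re (?y x)) * ?y x) * ?y x * (poly V (?y x))\<^sup>2"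
          unfolding UV by (simp add: power2_eq_square algebra_simps)
        also have "\<dots> = (?y x - (?y x * ?y x) / 2 - 1 / 2) * ?y x * (poly V (?y x))\<^sup>2"
          unfolding r[OF yy] ..
        also have "\<dots> = ?y x * poly ([:-1/2, 1, -1/2:] * V * V) (?y x)"
          by (simp add: power2_eq_square algebra_simps)
        finally show ?thesis .
      qed
    qed
    also have "\<dots> = 0" by (rule integral_shifted_poly[OF w])
    finally show ?thesis .
  qed
  have prod: "(1 - y) * (\<Sum>n\<le>m. a n * y ^ n) = (\<Sum>n\<le>Suc m. b n * y ^ n)" for y
  proof -
    have "(\<Sum>n\<le>Suc m. (if n = 0 then 0 else a (n - 1)) * y ^ n) = (\<Sum>n\<le>m. a n * y ^ Suc n)"
      by (subst sum.atMost_Suc_shift) simp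
    moreover have "(\<Sum>n\<le>Suc m. (if n \<le> m then a n else 0) * y ^ n) = (\<Sum>n\<le>m. a n * y ^ n)"
      by simp
    ultimately have "(\<Sum>n\<le>Suc m. b n * y ^ n) = (\<Sum>n\<le>m. a n * y ^ n) - (\<Sum>n\<le>m. a n * y ^ Suc n)"
      unfolding b_def by (simp only: left_diff_distrib sum_subtractf)
    moreover have "y * (\<Sum>n\<le>m. a n * y ^ n) = (\<Sum>n\<le>m. a n * y ^ Suc n)"
      unfolding sum_distrib_left by (intro sum.cong) auto
    ultimately show ?thesis by (simp only: left_diff_distrib mult_1_left)
  qed
  have "(LINT x|\<sigma>. (1 - Re (?y x)) * (Re (?U x))\<^sup>2) =
     (LINT x|\<sigma>. (1/4) * (norm (\<Sum>n\<le>Suc m. b n * ?y x ^ n))\<^sup>2 + (1/2) * Re (of_real (1 - Re (?y x)) * (?U x)\<^sup>2))"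
  proof (intro Bochner_Integration.integral_cong refl)
    fix x :: "real^'n" assume "x \<in> space \<sigma>"
    then have "norm (?y x) = 1" using y1[of x] by simp
    have alg: "(1 - Re y) * (Re v)\<^sup>2 = (1/4) * (norm ((1 - y) * v))\<^sup>2 + (1/2) * Re (of_real (1 - Re y) * v\<^sup>2)"
      if "norm y = 1" for y v
    proof -
      have "(Re y)\<^sup>2 + (Im y)\<^sup>2 = 1" using that by (simp add: cmod_power2[symmetric])
      moreover have "(norm (1 - y))\<^sup>2 = 1 - 2 * Re y + ((Re y)\<^sup>2 + (Im y)\<^sup>2)"
        unfolding cmod_power2 by (simp add: power2_eq_square algebra_simps)
      ultimately have 1: "(norm (1 - y))\<^sup>2 = 2 * (1 - Re y)" by simp
      have 2: "Re (of_real (1 - Re y) * v\<^sup>2) = (1 - Re y) * ((Re v)\<^sup>2 - (Im v)\<^sup>2)"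
        by (simp add: power2_eq_square)
      show ?thesis
        unfolding norm_mult power_mult_distrib unfolding 1 2 unfolding cmod_power2[of v]
        by (simp add: algebra_simps)
    qed
    show "(1 - Re (?y x)) * (Re (?U x))\<^sup>2 =
      (1/4) * (norm (\<Sum>n\<le>Suc m. b n * ?y x ^ n))\<^sup>2 + (1/2) * Re (of_real (1 - Re (?y x)) * (?U x)\<^sup>2)"
      unfolding prod[symmetric] by (rule alg) fact
  qed
  also have "\<dots> = (1/4) * (LINT x|\<sigma>. (norm (\<Sum>n\<le>Suc m. b n * ?y x ^ n))\<^sup>2)
      + (1/2) * (LINT x|\<sigma>. Re (of_real (1 - Re (?y x)) * (?U x)\<^sup>2))"
  proof -
    have "integrable \<sigma> (\<lambda>x. (norm (\<Sum>n\<le>Suc m. b n * ?y x ^ n))\<^sup>2)"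
      by (intro continuous_sphere_integrable continuous_intros cy)
    moreover have "integrable \<sigma> (\<lambda>x. Re (of_real (1 - Re (?y x)) * (?U x)\<^sup>2))"
      by (intro continuous_sphere_integrable continuous_intros cy cU)
    ultimately show ?thesis
      by (subst Bochner_Integration.integral_add) (auto simp del: times_complex.sel)
  qed
  also have "(LINT x|\<sigma>. Re (of_real (1 - Re (?y x)) * (?U x)\<^sup>2)) = 0"
  proof -
    have "integrable \<sigma> (\<lambda>x. complex_of_real (1 - Re (?y x)) * (?U x)\<^sup>2)"
      by (intro continuous_sphere_integrable continuous_intros cy cU)
    from complex_integral_eq[OF this] zero show ?thesis by (simp add: complex_eq_iff del: times_complex.sel)
  qed
  finally show ?thesis unfolding parseval_circle[OF w] by simp
qed

text \<open>The oscillating part \<open>Re (c z\<^sup>n)\<^sup>2\<close> of \<open>2 (Re (c z\<^sup>n))\<^sup>2\<close> integrates to \<open>0\<close>.\<close>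

lemma ip_re_power:
  assumes "1 \<le> n"
  shows "ip (\<lambda>x. Re (c * z x ^ n)) (\<lambda>x. Re (c * z x ^ n)) = \<omega> 2 / 2 * (norm c)\<^sup>2"
proof -
  have sq: "Re v * Re v = (1/2) * ((norm v)\<^sup>2 + Re (v\<^sup>2))" for v
    unfolding cmod_power2 by (simp add: power2_eq_square)
  have "ip (\<lambda>x. Re (c * z x ^ n)) (\<lambda>x. Re (c * z x ^ n)) = (LINT x|\<sigma>. (1/2) * (norm c)\<^sup>2 + (1/2) * Re (c\<^sup>2 * z x ^ (2 * n)))"
    unfolding ip_def
  proof (intro Bochner_Integration.integral_cong refl)
    fix x :: "real^'n" assume "x \<in> space \<sigma>"
    then have "norm (z x) = 1" using norm_z[of x] by simp
    then have "(norm (c * z x ^ n))\<^sup>2 = (norm c)\<^sup>2" by (simp add: norm_mult norm_power)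
    moreover have "(c * z x ^ n)\<^sup>2 = c\<^sup>2 * z x ^ (2 * n)" by (simp add: power_mult_distrib power_mult[symmetric] mult.commute)
    ultimately show "Re (c * z x ^ n) * Re (c * z x ^ n) = (1/2) * (norm c)\<^sup>2 + (1/2) * Re (c\<^sup>2 * z x ^ (2 * n))"
      unfolding sq by (simp only: distrib_left)
  qed
  also have "\<dots> = (LINT x|(\<sigma> :: (real^'n) measure). (1/2) * (norm c)\<^sup>2) + (LINT x|\<sigma>. (1/2) * Re (c\<^sup>2 * z x ^ (2 * n)))"
  proof (rule Bochner_Integration.integral_add)
    show "integrable \<sigma> (\<lambda>x::real^'n. (1/2) * (norm c)\<^sup>2)" by simp
    show "integrable \<sigma> (\<lambda>x. (1/2) * Re (c\<^sup>2 * z x ^ (2 * n)))"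
      by (rule continuous_sphere_integrable) (intro continuous_intros)
  qed
  also have "(LINT x|\<sigma>. (1/2) * Re (c\<^sup>2 * z x ^ (2 * n))) = 0"
  proof -
    have i: "integrable \<sigma> (\<lambda>x. c\<^sup>2 * z x ^ (2 * n))"
      by (intro continuous_sphere_integrable continuous_intros)
    have "(LINT x|\<sigma>. c\<^sup>2 * z x ^ (2 * n)) = 0" using integral_power_z[of "2 * n"] assms by simp
    with complex_integral_eq[OF i] show ?thesis by (simp add: complex_eq_iff del: times_complex.sel)
  qed
  also have "(LINT x|(\<sigma> :: (real^'n) measure). (1/2) * (norm c)\<^sup>2) = \<omega> 2 / 2 * (norm c)\<^sup>2"
    using measure_sphere[where 'n='n] by (simp add: card2)
  finally show ?thesis by simp
qed

text \<open>Write the projections as \<open>Re (a\<^sub>n y\<^sup>n)\<close> with \<open>y = w z\<close> rotated so that \<open>Re y = \<langle>x, e\<rangle>\<close>. Then the integral of \<open>(1 - \<langle>x, e\<rangle>) u\<^sup>2\<close> is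
  \<open>\<omega>/4\<close> times the sum of \<open>\<bar>a\<^sub>n - a\<^sub>n\<^sub>-\<^sub>1\<bar>\<^sup>2\<close>, which Hardy's inequality bounds below by the sum of \<open>\<bar>a\<^sub>n\<bar>\<^sup>2 / (4 n\<^sup>2)\<close>; and
  \<open>\<parallel>p\<^sub>n\<parallel>\<^sup>2 = \<omega> \<bar>a\<^sub>n\<bar>\<^sup>2 / 2\<close>. Together this is the factor \<open>8\<close>.\<close>

lemma hardy_rellich_circle:
  fixes u :: "real^'n \<Rightarrow> real"
  assumes u: "square_integrable u" and u0: "rproj 0 u = (\<lambda>x. 0)" and e: "norm e = 1"
  shows "(\<Sum>n<K. ip (rproj n u) (rproj n u) / (real n)\<^sup>2) \<le> 8 * (LINT x|\<sigma>. (1 - x \<bullet> e) * (u x)\<^sup>2)"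
proof -
  have d: "2 \<le> CARD('n)" using card2 by simp
  have om: "\<omega> 2 > 0" using sphere_area_pos[where 'n='n] by (simp add: card2)
  define c where "c n = (if n = 0 then 0 else SOME c. rproj n u = (\<lambda>x. Re (c * z x ^ n)))" for n
  have c: "rproj n u = (\<lambda>x. Re (c n * z x ^ n))" for n
  proof (cases "n = 0")
    case False
    then show ?thesis
      using someI_ex[OF harmonics_plane[OF rproj_harmonics[OF u]], of n] by (simp add: c_def)
  qed (simp add: c_def u0)
  have ew: "norm (z e) = 1" using norm_z[of e] e by simp
  define w where "w = cnj (z e)"
  have w: "norm w = 1" using ew by (simp add: w_def)
  have ww: "cnj w * w = 1"
    using w by (simp add: mult.commute complex_norm_square[symmetric])
  define a where "a n = c n * cnj w ^ n" for n
  have a0: "a 0 = 0" by (simp add: a_def c_def)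
  have na: "norm (a n) = norm (c n)" for n using w by (simp add: a_def norm_mult norm_power)
  have az: "c n * z x ^ n = a n * (w * z x) ^ n" for n x
  proof -
    have "a n * (w * z x) ^ n = c n * (cnj w * w) ^ n * z x ^ n"
      unfolding a_def power_mult_distrib by (simp only: mult_ac)
    then show ?thesis unfolding ww by simp
  qed
  have xe: "1 - x \<bullet> e = 1 - Re (w * z x)" for x
    by (simp add: w_def plane_coordinate_def inner_vec_def sum_ij)
  let ?S = "\<lambda>k x. \<Sum>n<k. rproj n u x"
  have fin: "(\<Sum>n<Suc m. ip (rproj n u) (rproj n u) / (real n)\<^sup>2) \<le> 8 * (LINT x|\<sigma>. (1 - x \<bullet> e) * (?S (Suc m) x)\<^sup>2)" for m
  proof -
    define b where "b = (\<lambda>n. (if n \<le> m then a n else 0) - (if n = 0 then 0 else a (n - 1)))"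
    define t where "t n = norm (if n \<le> m then a n else 0)" for n
    have S: "?S (Suc m) x = Re (\<Sum>n\<le>m. a n * (w * z x) ^ n)" for x
      unfolding c az by (simp only: lessThan_Suc_atMost Re_sum)
    have I: "(LINT x|\<sigma>. (1 - x \<bullet> e) * (?S (Suc m) x)\<^sup>2) = \<omega> 2 / 4 * (\<Sum>n\<le>Suc m. (norm (b n))\<^sup>2)"
      unfolding S xe b_def by (rule weighted_integral_circle[where a = a, OF w a0])
    have "(\<Sum>n<Suc m. ip (rproj n u) (rproj n u) / (real n)\<^sup>2) = (\<Sum>n=1..m. ip (rproj n u) (rproj n u) / (real n)\<^sup>2)"
      by (rule sum.mono_neutral_right) auto
    also have "\<dots> = (\<Sum>n=1..m. \<omega> 2 / 2 * ((t n)\<^sup>2 / (real n)\<^sup>2))"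
      by (intro sum.cong refl) (simp add: c ip_re_power t_def na del: times_complex.sel)
    also have "\<dots> \<le> (\<Sum>n=1..Suc m. \<omega> 2 / 2 * ((t n)\<^sup>2 / (real n)\<^sup>2))"
      using om by (intro sum_mono2) auto
    also have "\<dots> = \<omega> 2 / 2 * (\<Sum>n=1..Suc m. (t n)\<^sup>2 / (real n)\<^sup>2)"
      by (simp only: sum_distrib_left)
    also have "\<dots> \<le> \<omega> 2 / 2 * (4 * (\<Sum>n=1..Suc m. (t n - t (n - 1))\<^sup>2))"
    proof (rule mult_left_mono)
      have "t 0 = 0" by (simp add: t_def a0)
      from discrete_hardy[where x = t, OF this, of "Suc m"]
      show "(\<Sum>n=1..Suc m. (t n)\<^sup>2 / (real n)\<^sup>2) \<le> 4 * (\<Sum>n=1..Suc m. (t n - t (n - 1))\<^sup>2)"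
        by (smt (verit) divide_nonneg_nonneg of_nat_0_le_iff zero_le_power2)
    qed (use om in simp)
    also have "(\<Sum>n=1..Suc m. (t n - t (n - 1))\<^sup>2) \<le> (\<Sum>n=1..Suc m. (norm (b n))\<^sup>2)"
    proof (rule sum_mono)
      fix n assume n: "n \<in> {1..Suc m}"
      have "\<bar>t n - t (n - 1)\<bar> \<le> norm (b n)"
        using n norm_triangle_ineq3[of "if n \<le> m then a n else 0" "a (n - 1)"] by (auto simp: t_def b_def)
      then show "(t n - t (n - 1))\<^sup>2 \<le> (norm (b n))\<^sup>2" by (rule power2_le_iff_abs_le[THEN iffD2, rotated]) simp
    qed
    also have "(\<Sum>n=1..Suc m. (norm (b n))\<^sup>2) \<le> (\<Sum>n\<le>Suc m. (norm (b n))\<^sup>2)"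
      by (rule sum_mono2) auto
    finally have "(\<Sum>n<Suc m. ip (rproj n u) (rproj n u) / (real n)\<^sup>2) \<le> \<omega> 2 / 2 * (4 * (\<Sum>n\<le>Suc m. (norm (b n))\<^sup>2))"
      using om by simp
    moreover have "8 * (\<omega> 2 / 4 * r) = \<omega> 2 / 2 * (4 * r)" for r by simp
    ultimately show ?thesis unfolding I by (simp only:)
  qed
  have nn: "ip (rproj n u) (rproj n u) / (real n)\<^sup>2 \<ge> 0" for n by (simp add: ip_nonneg)
  have lim: "(\<lambda>k. 8 * (LINT x|\<sigma>. (1 - x \<bullet> e) * (?S k x)\<^sup>2)) \<longlonglongrightarrow> 8 * (LINT x|\<sigma>. (1 - x \<bullet> e) * (u x)\<^sup>2)"
    by (intro tendsto_intros weighted_square_tendsto[OF square_integrable_rproj_sum[OF u] u _ parseval_convergence[OF d u]]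
        continuous_intros)
  have "(\<Sum>n<K. ip (rproj n u) (rproj n u) / (real n)\<^sup>2) \<le> 8 * (LINT x|\<sigma>. (1 - x \<bullet> e) * (?S k x)\<^sup>2)"
    if k: "k \<ge> Suc K" for k
  proof -
    obtain m where m: "k = Suc m" using k by (cases k) auto
    have "(\<Sum>n<K. ip (rproj n u) (rproj n u) / (real n)\<^sup>2) \<le> (\<Sum>n<k. ip (rproj n u) (rproj n u) / (real n)\<^sup>2)"
      using k nn by (intro sum_mono2) auto
    also have "\<dots> \<le> 8 * (LINT x|\<sigma>. (1 - x \<bullet> e) * (?S k x)\<^sup>2)" unfolding m by (rule fin)
    finally show ?thesis .
  qed
  then show ?thesis by (intro LIMSEQ_le_const[OF lim] exI[of _ "Suc K"]) blast
qed

end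

section \<open>The uncertainty principle\<close>

text \<open>At \<open>t = c\<close> the two lower bounds for \<open>(1 - t) N\<close> agree, as \<open>(d - 1) c\<^sup>2 / 4 = 1 - c\<^sup>2\<close>. Below \<open>c\<close> the first one is the
  larger, above \<open>c\<close> the second.\<close>

lemma uncertainty_optimisation:
  fixes d N t :: real
  assumes d: "d \<ge> 2" and N: "N \<ge> d - 1" and t: "0 \<le> t" "t < 1"
    and u: "(d - 1)\<^sup>2 / 4 * t\<^sup>2 \<le> (1 - t\<^sup>2) * N"
  shows "(d - 1) * (1 - 2 / sqrt (d + 3)) \<le> (1 - t) * N"
proof -
  define c where "c = 2 / sqrt (d + 3)"
  have c2: "c\<^sup>2 = 4 / (d + 3)" using d by (simp add: c_def power_divide)
  have cpos: "c > 0" using d by (simp add: c_def)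
  show ?thesis
  proof (cases "t \<le> c")
    case True
    have "(d - 1) * (1 - c) \<le> (d - 1) * (1 - t)" using True d by (intro mult_left_mono) auto
    also have "\<dots> \<le> N * (1 - t)" using N t by (intro mult_right_mono) auto
    finally show ?thesis by (simp add: c_def mult.commute)
  next
    case False
    have e: "(d - 1) * (1 - c) * (1 + c) = (d - 1)\<^sup>2 / 4 * c\<^sup>2"
    proof -
      have e1: "(d - 1) / 4 * c\<^sup>2 = 1 - c\<^sup>2" unfolding c2 using d by (simp add: field_simps)
      have e2: "(d - 1) * (1 - c) * (1 + c) = (d - 1) * (1 - c\<^sup>2)"
        by (simp add: power2_eq_square algebra_simps)
      have "(d - 1) * (1 - c) * (1 + c) = (d - 1) * ((d - 1) / 4 * c\<^sup>2)" unfolding e2 e1 ..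
      then show ?thesis by (simp add: power2_eq_square)
    qed
    have "c\<^sup>2 * (1 + t) \<le> t\<^sup>2 * (1 + c)"
    proof -
      have "t\<^sup>2 * (1 + c) - c\<^sup>2 * (1 + t) = (t - c) * (t + c + t * c)"
        by (simp add: power2_eq_square algebra_simps)
      moreover have "\<dots> \<ge> 0" using False cpos t by (intro mult_nonneg_nonneg) auto
      ultimately show ?thesis by linarith
    qed
    note ct = this
    have "((1 + c) * (1 + t)) * ((d - 1) * (1 - c)) = (1 + t) * ((d - 1) * (1 - c) * (1 + c))"
      by (simp only: mult_ac)
    also have "\<dots> = (d - 1)\<^sup>2 / 4 * (c\<^sup>2 * (1 + t))" unfolding e by (simp only: mult_ac)
    also have "\<dots> \<le> (d - 1)\<^sup>2 / 4 * (t\<^sup>2 * (1 + c))"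
      using ct by (intro mult_left_mono) auto
    also have "\<dots> = (1 + c) * ((d - 1)\<^sup>2 / 4 * t\<^sup>2)" by (simp only: mult_ac)
    also have "\<dots> \<le> (1 + c) * ((1 - t\<^sup>2) * N)"
      using cpos by (intro mult_left_mono u) auto
    also have "\<dots> = ((1 + c) * (1 + t)) * ((1 - t) * N)"
      by (simp add: power2_eq_square algebra_simps)
    finally have "((1 + c) * (1 + t)) * ((d - 1) * (1 - c)) \<le> ((1 + c) * (1 + t)) * ((1 - t) * N)" .
    moreover have "(1 + c) * (1 + t) > 0" using cpos t by simp
    ultimately have "(d - 1) * (1 - c) \<le> (1 - t) * N" by (simp only: mult_le_cancel_left_pos)
    then show ?thesis by (simp add: c_def)
  qed
qed

lemma exists_centre_direction:
  fixes f :: "real^'n \<Rightarrow> complex"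
  assumes "square_integrable f"
  shows "\<exists>e. norm e = 1 \<and> (LINT x|\<sigma>. (x \<bullet> e) * (norm (f x))\<^sup>2) = \<omega> CARD('n) * norm (\<tau> f)"
proof (cases "\<tau> f = 0")
  case True
  obtain e :: "real^'n" where "norm e = 1" using vector_choose_size[of 1] by auto
  then show ?thesis using tau_inner[OF assms, of e] True by auto
next
  case False
  have "\<tau> f \<bullet> sgn (\<tau> f) = norm (\<tau> f)"
    using False by (simp add: sgn_div_norm power2_norm_eq_inner[symmetric] power2_eq_square)
  then show ?thesis using tau_inner[OF assms, of "sgn (\<tau> f)"] False
    by (intro exI[of _ "sgn (\<tau> f)"]) (simp add: norm_sgn)
qed

text \<open>By the variance inequality the integral of \<open>(1 - \<langle>x, e\<rangle>\<^sup>2) \<bar>f\<bar>\<^sup>2\<close> is at most \<open>\<omega> (1 - t\<^sup>2)\<close>, which leaves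
  \<open>(d - 1) t \<le> s (1 - t\<^sup>2) + N / s\<close> for all \<open>s > 0\<close>. Letting \<open>s\<close> grow excludes \<open>t = 1\<close>; otherwise take the \<open>s\<close> for which the
  first term is half of the left side.\<close>

lemma uncertainty_principle:
  fixes f :: "real^'n \<Rightarrow> complex"
  assumes d: "2 \<le> CARD('n)" and f: "f \<in> sobolev_W21" and n1: "sphere_norm2 f = 1"
  shows "norm (\<tau> f) < 1"
    and "(real CARD('n) - 1)\<^sup>2 / 4 * (norm (\<tau> f))\<^sup>2 \<le> (1 - (norm (\<tau> f))\<^sup>2) * (sphere_norm2 (\<nabla>\<^sub>0 f))\<^sup>2"
proof -
  have fs: "square_integrable f" using f by (simp add: sobolev_W21_def sphere_L2_def)
  have om: "\<omega> CARD('n) > 0" by (rule sphere_area_pos)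
  let ?t = "norm (\<tau> f)" and ?N = "(sphere_norm2 (\<nabla>\<^sub>0 f))\<^sup>2"
  let ?d = "real CARD('n) - 1"
  obtain e where e: "norm e = 1" "(LINT x|\<sigma>. (x \<bullet> e) * (norm (f x))\<^sup>2) = \<omega> CARD('n) * ?t"
    using exists_centre_direction[OF fs] by blast
  have tot: "(LINT x|\<sigma>. (norm (f x))\<^sup>2) = \<omega> CARD('n)"
    using sphere_norm2_square[of f] n1 om by simp
  have fi: "integrable \<sigma> (\<lambda>x. (norm (f x))\<^sup>2)" using fs by (simp add: square_integrable_def)
  have i1: "integrable \<sigma> (\<lambda>x. (x \<bullet> e) * (norm (f x))\<^sup>2)" "integrable \<sigma> (\<lambda>x. (x \<bullet> e)\<^sup>2 * (norm (f x))\<^sup>2)"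
    by (intro integrable_mult_continuous_sphere fi continuous_intros)+
  have var: "\<omega> CARD('n) * ?t\<^sup>2 \<le> (LINT x|\<sigma>. (x \<bullet> e)\<^sup>2 * (norm (f x))\<^sup>2)"
  proof -
    have "0 \<le> (LINT x|\<sigma>. (x \<bullet> e - ?t)\<^sup>2 * (norm (f x))\<^sup>2)"
      by (intro Bochner_Integration.integral_nonneg) auto
    also have "\<dots> = (LINT x|\<sigma>. (x \<bullet> e)\<^sup>2 * (norm (f x))\<^sup>2 - 2 * ?t * ((x \<bullet> e) * (norm (f x))\<^sup>2) + ?t\<^sup>2 * (norm (f x))\<^sup>2)"
      by (intro Bochner_Integration.integral_cong refl) (simp add: power2_eq_square algebra_simps)
    also have "\<dots> = (LINT x|\<sigma>. (x \<bullet> e)\<^sup>2 * (norm (f x))\<^sup>2) - 2 * ?t * (\<omega> CARD('n) * ?t) + ?t\<^sup>2 * \<omega> CARD('n)"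
      using i1 fi by (simp add: e(2) tot)
    finally show ?thesis by (simp add: power2_eq_square)
  qed
  have "(LINT x|\<sigma>. (1 - (x \<bullet> e)\<^sup>2) * (norm (f x))\<^sup>2) = \<omega> CARD('n) - (LINT x|\<sigma>. (x \<bullet> e)\<^sup>2 * (norm (f x))\<^sup>2)"
    using i1 fi tot by (simp add: left_diff_distrib)
  with var have tan: "(LINT x|\<sigma>. (1 - (x \<bullet> e)\<^sup>2) * (norm (f x))\<^sup>2) \<le> \<omega> CARD('n) * (1 - ?t\<^sup>2)"
    by (simp add: algebra_simps)
  have ineq: "?d * ?t \<le> s * (1 - ?t\<^sup>2) + ?N / s" if s: "s > 0" for s
  proof -
    have "?d * (\<omega> CARD('n) * ?t) \<le> s * (\<omega> CARD('n) * (1 - ?t\<^sup>2)) + \<omega> CARD('n) * ?N / s"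
    proof -
      have "s * (LINT x|\<sigma>. (1 - (x \<bullet> e)\<^sup>2) * (norm (f x))\<^sup>2) \<le> s * (\<omega> CARD('n) * (1 - ?t\<^sup>2))"
        using s by (intro mult_left_mono tan) auto
      then show ?thesis
        using vector_field_inequality_complex[OF d f e(1) s] unfolding e(2) by linarith
    qed
    then have "\<omega> CARD('n) * (?d * ?t) \<le> \<omega> CARD('n) * (s * (1 - ?t\<^sup>2) + ?N / s)"
      by (simp add: algebra_simps)
    then show ?thesis using om by (simp only: mult_le_cancel_left_pos)
  qed
  have t1: "?t \<le> 1"
  proof -
    have "(LINT x|\<sigma>. (x \<bullet> e) * (norm (f x))\<^sup>2) \<le> (LINT x|\<sigma>. (norm (f x))\<^sup>2)"
    proof (rule integral_mono[OF i1(1) fi])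
      fix x :: "real^'n" assume "x \<in> space \<sigma>"
      then have "x \<bullet> e \<le> 1" using norm_cauchy_schwarz[of x e] e(1) by simp
      then show "(x \<bullet> e) * (norm (f x))\<^sup>2 \<le> (norm (f x))\<^sup>2" using mult_right_mono[of "x \<bullet> e" 1 "(norm (f x))\<^sup>2"] by simp
    qed
    then show ?thesis using om by (simp add: e(2) tot)
  qed
  have dp: "?d > 0" using d by simp
  show lt: "?t < 1"
  proof (rule ccontr)
    assume "\<not> ?t < 1"
    then have "?t = 1" using t1 by simp
    then have "?d \<le> ?N / s" if "s > 0" for s using ineq[OF that] by simp
    \<comment> \<open>For this \<open>s\<close> the right side is \<open>?d * N / (N + 1)\<close>.\<close>
    from this[of "(?N + 1) / ?d"] have "?d \<le> ?N / ((?N + 1) / ?d)" using dp by (simp add: add_nonneg_pos)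
    also have "\<dots> = ?d * (?N / (?N + 1))" by simp
    also have "\<dots> < ?d * 1" using dp by (intro mult_strict_left_mono) (auto simp: add_nonneg_pos)
    finally show False by simp
  qed
  show "?d\<^sup>2 / 4 * ?t\<^sup>2 \<le> (1 - ?t\<^sup>2) * ?N"
  proof (cases "?t = 0")
    case False
    then have tp: "?t > 0" by simp
    define Q where "Q = 1 - ?t\<^sup>2"
    have q: "Q > 0" using lt by (simp add: Q_def power_less_one_iff abs_square_less_1)
    define s where "s = ?d * ?t / (2 * Q)"
    have s: "s > 0" using dp tp q by (simp add: s_def)
    have "s * Q = ?d * ?t / 2" using q by (simp add: s_def)
    then have "?d * ?t / 2 \<le> ?N / s"
      using ineq[OF s] unfolding Q_def[symmetric] by linarith
    then have "?d * ?t / 2 * s \<le> ?N" using s by (simp only: pos_le_divide_eq)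
    then have "?d * ?t / 2 * s * Q \<le> ?N * Q" using q by (intro mult_right_mono) auto
    moreover have "?d * ?t / 2 * s * Q = ?d\<^sup>2 / 4 * ?t\<^sup>2"
      using q by (simp add: s_def power2_eq_square)
    ultimately have "?d\<^sup>2 / 4 * ?t\<^sup>2 \<le> Q * ?N" by (simp only: mult.commute[of Q])
    then show ?thesis unfolding Q_def .
  qed simp
qed

theorem corollary4p4:
  fixes f :: "real^'n \<Rightarrow> complex"
  assumes "CARD('n) \<ge> 2"
    and "f \<in> sobolev_W21"
    and "mean_zero f"
    and "sphere_norm2 f = 1"
  shows "(1 - norm (\<tau> f)) * (sphere_norm2 (\<nabla>\<^sub>0 f))\<^sup>2 \<ge> uncertainty_constant CARD('n) \<and>
    (CARD('n) \<noteq> 3 \<longrightarrow> (\<forall>C. hardy_rellich_constant TYPE('n) C \<longrightarrow>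
      (1 - norm (\<tau> f)) * (sphere_norm2 (\<nabla>\<^sub>0 f))\<^sup>2 \<ge> inverse C))"
proof -
  note d = assms(1) and f = assms(2)
  have fL: "f \<in> sphere_L2" using f by (simp add: sobolev_W21_def)
  then have fs: "square_integrable f" by (simp add: sphere_L2_def)
  then have sq: "square_integrable (re f)" "square_integrable (im f)"
    unfolding square_integrable_complex_iff by auto
  have om: "\<omega> CARD('n) > 0" by (rule sphere_area_pos)
  let ?t = "norm (\<tau> f)" and ?N = "(sphere_norm2 (\<nabla>\<^sub>0 f))\<^sup>2" and ?w = "\<omega> CARD('n)"
  have t: "0 \<le> ?t" "?t < 1" using uncertainty_principle(1)[OF d f assms(4)] by auto
  have sums: "degree_energy f sums ?w" using degree_energy_sums[OF d fs] assms(4) by simp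
  have f0: "rproj 0 (re f) = (\<lambda>x. 0)" "rproj 0 (im f) = (\<lambda>x. 0)"
    using assms(3) unfolding mean_zero_iff[OF fs] by auto
  then have e0: "degree_energy f 0 = 0" by (simp add: degree_energy_def ip_def)
  note E = degree_energy_gradient[OF d f]
  have pos: "eigval CARD('n) n > 0" if "1 \<le> n" for n
    using eigval_ge[OF d that] d by simp
  obtain e where e: "norm e = 1" "(LINT x|\<sigma>. (x \<bullet> e) * (norm (f x))\<^sup>2) = ?w * ?t"
    using exists_centre_direction[OF fs] by blast
  have weight: "(LINT x|\<sigma>. (1 - x \<bullet> e) * (norm (f x))\<^sup>2) = ?w * (1 - ?t)"
  proof -
    have fi: "integrable \<sigma> (\<lambda>x. (norm (f x))\<^sup>2)" using fs by (simp add: square_integrable_def)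
    have "integrable \<sigma> (\<lambda>x. (x \<bullet> e) * (norm (f x))\<^sup>2)"
      by (intro integrable_mult_continuous_sphere fi continuous_intros)
    then show ?thesis
      using fi sphere_norm2_square[of f] assms(4) om e(2) by (simp add: left_diff_distrib right_diff_distrib)
  qed
  \<comment> \<open>The form in which both Hardy--Rellich constants, \<open>8\<close> on the circle and the given \<open>C\<close>, are used.\<close>
  have duality: "1 \<le> C * ((1 - ?t) * ?N)"
    if "\<And>k. (\<Sum>n<k. degree_energy f n / eigval CARD('n) n) \<le> C * (?w * (1 - ?t))" for C
  proof -
    have "?w\<^sup>2 \<le> (C * (?w * (1 - ?t))) * (?w * ?N)"
      by (rule weighted_cauchy_schwarz[OF degree_energy_nonneg e0 pos sums E that])
    then have "?w\<^sup>2 * 1 \<le> ?w\<^sup>2 * (C * ((1 - ?t) * ?N))"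
      by (simp add: power2_eq_square mult_ac)
    then show ?thesis using om by (simp only: mult_le_cancel_left_pos zero_less_power)
  qed
  have "uncertainty_constant CARD('n) \<le> (1 - ?t) * ?N"
  proof (cases "CARD('n) = 2")
    case True
    then obtain i j :: 'n where ij: "UNIV = {i, j}" "i \<noteq> j" by (auto simp: card_2_iff)
    interpret plane i j by unfold_locales (use ij in auto)
    have ev: "eigval CARD('n) n = (real n)\<^sup>2" for n by (simp add: eigval_def True power2_eq_square)
    have "(\<Sum>n<k. degree_energy f n / eigval CARD('n) n) \<le> 8 * (?w * (1 - ?t))" for k
    proof -
      have "continuous_on (sphere 0 1) (\<lambda>x::real^'n. 1 - x \<bullet> e)" by (intro continuous_intros)
      note split = integral_weighted_norm_square[OF fs this]
      show ?thesis
        using hardy_rellich_circle[OF sq(1) f0(1) e(1), of k] hardy_rellich_circle[OF sq(2) f0(2) e(1), of k]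
        unfolding weight[symmetric] split ev degree_energy_def by (simp add: add_divide_distrib sum.distrib)
    qed
    from duality[OF this] show ?thesis by (simp add: uncertainty_constant_def True)
  next
    case False
    have "(real CARD('n) - 1) * ?w \<le> ?w * ?N"
    proof (rule LIMSEQ_le_const2)
      show "(\<lambda>k. (real CARD('n) - 1) * (\<Sum>n<k. degree_energy f n)) \<longlonglongrightarrow> (real CARD('n) - 1) * ?w"
        using sums unfolding sums_def by (intro tendsto_intros)
      have "(real CARD('n) - 1) * (\<Sum>n<k. degree_energy f n) \<le> ?w * ?N" for k
      proof -
        have "(real CARD('n) - 1) * (\<Sum>n<k. degree_energy f n) = (\<Sum>n<k. (real CARD('n) - 1) * degree_energy f n)"
          by (simp add: sum_distrib_left)
        also have "\<dots> \<le> (\<Sum>n<k. eigval CARD('n) n * degree_energy f n)"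
        proof (rule sum_mono)
          fix n show "(real CARD('n) - 1) * degree_energy f n \<le> eigval CARD('n) n * degree_energy f n"
            using eigval_ge[OF d, of n] degree_energy_nonneg[of f n] e0
            by (cases "n = 0") (auto intro: mult_right_mono)
        qed
        also have "\<dots> \<le> ?w * ?N" by (rule E)
        finally show ?thesis .
      qed
      then show "\<exists>N. \<forall>k\<ge>N. (real CARD('n) - 1) * (\<Sum>n<k. degree_energy f n) \<le> ?w * ?N" by blast
    qed
    then have "?w * (real CARD('n) - 1) \<le> ?w * ?N" by (simp only: mult.commute)
    then have "real CARD('n) - 1 \<le> ?N" using om by (simp only: mult_le_cancel_left_pos)
    from uncertainty_optimisation[OF _ this t uncertainty_principle(2)[OF d f assms(4)]]
    show ?thesis using d False by (simp add: uncertainty_constant_def)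
  qed
  moreover have "inverse C \<le> (1 - ?t) * ?N" if C: "hardy_rellich_constant TYPE('n) C" for C
  proof (cases "C > 0")
    case True
    obtain B I where B: "(\<lambda>n. degree_energy f n / eigval CARD('n) n) sums B" "B \<le> C * I"
      "\<And>e. norm e = 1 \<Longrightarrow> I \<le> (LINT x|\<sigma>. (1 - x \<bullet> e) * (norm (f x))\<^sup>2)"
      using hardy_rellich_degree_energy[OF d fL assms(3) C] by blast
    have "(\<Sum>n<k. degree_energy f n / eigval CARD('n) n) \<le> C * (?w * (1 - ?t))" for k
    proof -
      have "(\<Sum>n<k. degree_energy f n / eigval CARD('n) n) \<le> B"
        using sum_le_suminf[OF sums_summable[OF B(1)], of "{..<k}"] sums_unique[OF B(1)]
          degree_energy_nonneg[of f] eigval_nonneg[OF d] by simp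
      also have "\<dots> \<le> C * I" by (rule B(2))
      also have "\<dots> \<le> C * (?w * (1 - ?t))"
        using B(3)[OF e(1)] True unfolding weight by (intro mult_left_mono) auto
      finally show ?thesis .
    qed
    from duality[OF this] True show ?thesis by (simp add: field_simps)
  next
    case False
    then have "inverse C \<le> 0" by simp
    also have "0 \<le> (1 - ?t) * ?N" using t by simp
    finally show ?thesis .
  qed
  ultimately show ?thesis by blast
qed

end
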